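(* (Lie's 3rd Theorem) Let $M$ be a smooth manifold with structure object $w=(w^i_j(x))$, invariance groupoid $\mathcal{N}_1(w)\subset\mathcal{U}_1$ with linearization $N_1(w)\to M$, integrability object $I(w)$, nonlinear curvature $\mathcal{R}$ and linear curvature $\mathfrak{R}$. The following six conditions are equivalent: 1) $\mathcal{R}=0$ on $M\times M$. 2) $\mathcal{N}_1(w)$ is uniquely locally integrable. 3) $\mathcal{N}_1(w)$, which leaves $w$ invariant by its definition, leaves also $I(w)$ invariant. 4) $\mathfrak{R}=0$. 5) $N_1(w)\to M$ is uniquely locally integrable. 6) $\mathcal{L}_{\varepsilon\xi}I(w)=0$ for all $\xi\in T$.
   Context: Summation over repeated indices is used; $[jk]$ denotes alternation, $[A_{jk}]_{[jk]}=A_{jk}-A_{kj}$. $T=T(M)$ is the tangent bundle and $J_1(T)\to M$ the bundle of $1$-jets of vector fields, with elements $(\xi^i,\xi^i_j)$ in coordinates. $\mathcal{U}_1$ is the groupoid of $1$-jets of local diffeomorphisms of $M$; a $1$-arrow from $\overline x$ to $\overline y$ is written $(\overline x^i,\overline y^i,\overline f^i_j)$ with $(\overline f^i_j)$ invertible. **Structure object.** A structure object $w$ on $M$ is a smooth geometric object whose components in each coordinate chart form an invertible matrix $(w^i_j(x))$ and transform under a coordinate change $x\mapsto y$ by $\frac{\partial y^i}{\partial x^a}w^a_j(x)=w^i_j(y)$ (the lower index $j$ does not transform). Put $\widetilde w=w^{-1}$ and $$\Gamma^i_{jk}(x)=\frac{\partial w^i_a(x)}{\partial x^j}\widetilde w^a_k(x),\qquad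 I^i_{jk}(w;x)=[\Gamma^i_{jk}(x)]_{[jk]} .$$ $I(w)=(I^i_{jk}(w;x))$ is the integrability object; it is a $(1,2)$-tensor. **Invariance groupoid.** $\mathcal{N}_1(w)\subset\mathcal{U}_1$ consists of the $1$-arrows with $\overline f^i_aw^a_j(\overline x)=w^i_j(\overline y)$; over each $(\overline x,\overline y)\in M\times M$ there is exactly one. It is uniquely locally integrable if for every $(\overline x,\overline y,\overline f_1)\in\mathcal{N}_1(w)$ there is a local diffeomorphism $f$ near $\overline x$, with unique germ at $\overline x$, satisfying $\frac{\partial f^i}{\partial x^a}w^a_j(x)=w^i_j(f(x))$ near $\overline x$, $f(\overline x)=\overline y$ and $\frac{\partial f^i}{\partial x^j}(\overline x)=\overline f^i_j$. **Nonlinear curvature.** For $(x,y)\in M\times M$, with $(x,y,f_1)$ the unique $1$-arrow of $\mathcal{N}_1(w)$ from $x$ to $y$ and $g_1=f_1^{-1}$, $$\mathcal{R}^i_{jk}(x,y)=I^i_{jk}(w;y)-I^c_{ab}(w;x)f^i_cg^a_jg^b_k .$$ $\mathcal{N}_1(w)$ leaves $I(w)$ invariant if $I^c_{ab}(w;x)f^i_cg^a_jg^b_k=I^i_{jk}(w;y)$ for every $1$-arrow $(x,y,f_1)$ of $\mathcal{N}_1(w)$, $g_1=f_1^{-1}$. **Linearization.** $N_1(w)\subset J_1(T)$ is the vector subbundle whose fiber over $x$ consists of all $(\xi^i,\xi^i_j)$ with $\xi^i_j=\Gamma^i_{aj}(x)\xi^a$; $\varepsilon:T\to N_1(w)$ is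 $\varepsilon(\xi^i)=(\xi^i,\Gamma^i_{aj}\xi^a)$. $N_1(w)$ is uniquely locally integrable if for every $\overline x$ and every element of $N_1(w)^{\overline x}$ there is a vector field $\xi$ near $\overline x$, with unique germ at $\overline x$, satisfying $\frac{\partial\xi^i}{\partial x^j}=\Gamma^i_{aj}\xi^a$ and having the given element as its $1$-jet at $\overline x$. **Linear curvature.** $\mathfrak{R}^i_{kj,a}=\big[\frac{\partial\Gamma^i_{aj}}{\partial x^k}+\Gamma^i_{bj}\Gamma^b_{ak}\big]_{[kj]}$. **Formal Lie derivative.** For a tensor field $\alpha$ and a section $\xi_1=(\xi^i,\xi^i_j)$ of $J_1(T)$, $\mathcal{L}_{\{\xi_1\}}\alpha$ is obtained from the coordinate formula for the ordinary Lie derivative $\mathcal{L}_\xi\alpha$ by replacing $\partial\xi^i/\partial x^j$ with $\xi^i_j$; $\mathcal{L}_{\varepsilon\xi}$ is the case $\xi_1=\varepsilon\xi$. Explicitly, $$(\mathcal{L}_{\varepsilon\xi}I(w))^i_{kj}=\Big(\frac{\partial I^i_{kj}}{\partial x^a}-\Gamma^i_{ab}I^b_{kj}+\Gamma^b_{ak}I^i_{bj}+\Gamma^b_{aj}I^i_{kb}\Big)\xi^a .$$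
   Formalization: M is assumed connected: on the disjoint union of R^3 with the coordinate frame and R^3 with a left-invariant Heisenberg frame, conditions 4–6 hold while 1–3 fail, so the equivalence is false for disconnected M. *)

theory Defs
  imports "HOL-Analysis.Analysis"
begin

section \<open>Smooth functions on open subsets of Euclidean spaces\<close>

text \<open>Both notions are meant for an open set \<open>S\<close> of a Euclidean space: all iterated directional
  derivatives of \<open>f\<close> of order at most \<open>k\<close> (of all orders) exist on \<open>S\<close> and are continuous there.\<close>

primrec Ck_on :: "nat \<Rightarrow> 'a::euclidean_space set \<Rightarrow> ('a \<Rightarrow> 'b::real_normed_vector) \<Rightarrow> bool" where
  "Ck_on 0 S f \<longleftrightarrow> continuous_on S f"
| "Ck_on (Suc k) S f \<longleftrightarrow> (\<forall>x\<in>S. f differentiable (at x)) \<and>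
     (\<forall>v. Ck_on k S (\<lambda>x. frechet_derivative f (at x) v))"

definition smooth_on :: "'a::euclidean_space set \<Rightarrow> ('a \<Rightarrow> 'b::real_normed_vector) \<Rightarrow> bool" where
  "smooth_on S f \<longleftrightarrow> (\<forall>k. Ck_on k S f)"

definition pd :: "'n::finite \<Rightarrow> (real^'n \<Rightarrow> 'b::real_normed_vector) \<Rightarrow> real^'n \<Rightarrow> 'b" where
  "pd j f x = frechet_derivative f (at x) (axis j 1)"

definition alt :: "('n \<Rightarrow> 'n \<Rightarrow> real) \<Rightarrow> 'n \<Rightarrow> 'n \<Rightarrow> real" where
  "alt B j k = B j k - B k j"


section \<open>Smooth manifolds\<close>

text \<open>A chart is a domain together with a coordinate map; outside the domain the map is arbitrary.\<close>

type_synonym ('m, 'n) chart = "'m set \<times> ('m \<Rightarrow> real^'n)"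

abbreviation cdom :: "('m, 'n::finite) chart \<Rightarrow> 'm set" where "cdom c \<equiv> fst c"
abbreviation cmap :: "('m, 'n::finite) chart \<Rightarrow> 'm \<Rightarrow> real^'n" where "cmap c \<equiv> snd c"

definition cinv :: "('m, 'n::finite) chart \<Rightarrow> real^'n \<Rightarrow> 'm" where
  "cinv c = inv_into (cdom c) (cmap c)"

definition is_chart :: "'m topology \<Rightarrow> ('m, 'n::finite) chart \<Rightarrow> bool" where
  "is_chart M c \<longleftrightarrow> openin M (cdom c) \<and> open (cmap c ` cdom c) \<and>
     homeomorphic_map (subtopology M (cdom c)) (top_of_set (cmap c ` cdom c)) (cmap c)"

text \<open>The coordinate change \<open>x \<mapsto> y\<close> from the chart \<open>c\<close> to the chart \<open>d\<close>.\<close>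

definition trans_map :: "('m, 'n::finite) chart \<Rightarrow> ('m, 'n) chart \<Rightarrow> real^'n \<Rightarrow> real^'n" where
  "trans_map c d = cmap d \<circ> cinv c"

text \<open>The atlas \<open>A\<close> is not required to be maximal; a maximal atlas is a special case.\<close>

definition smooth_manifold :: "'m topology \<Rightarrow> ('m, 'n::finite) chart set \<Rightarrow> bool" where
  "smooth_manifold M A \<longleftrightarrow> Hausdorff_space M \<and> second_countable M \<and>
     (\<forall>c\<in>A. is_chart M c) \<and> (\<Union>c\<in>A. cdom c) = topspace M \<and>
     (\<forall>c\<in>A. \<forall>d\<in>A. smooth_on (cmap c ` (cdom c \<inter> cdom d)) (trans_map c d))"

definition charts_at :: "('m, 'n::finite) chart set \<Rightarrow> 'm \<Rightarrow> ('m, 'n) chart set" where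
  "charts_at A p = {c \<in> A. p \<in> cdom c}"

definition local_rep ::
  "('m, 'n::finite) chart \<Rightarrow> ('m, 'n) chart \<Rightarrow> ('m \<Rightarrow> 'm) \<Rightarrow> real^'n \<Rightarrow> real^'n" where
  "local_rep c d f = cmap d \<circ> f \<circ> cinv c"

definition smooth_map ::
  "'m topology \<Rightarrow> ('m, 'n::finite) chart set \<Rightarrow> 'm set \<Rightarrow> ('m \<Rightarrow> 'm) \<Rightarrow> bool" where
  "smooth_map M A U f \<longleftrightarrow> continuous_map (subtopology M U) M f \<and>
     (\<forall>c\<in>A. \<forall>d\<in>A. smooth_on (cmap c ` {p \<in> cdom c \<inter> U. f p \<in> cdom d}) (local_rep c d f))"

definition local_diffeo ::
  "'m topology \<Rightarrow> ('m, 'n::finite) chart set \<Rightarrow> 'm set \<Rightarrow> ('m \<Rightarrow> 'm) \<Rightarrow> bool" where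
  "local_diffeo M A U f \<longleftrightarrow> openin M U \<and> openin M (f ` U) \<and> inj_on f U \<and>
     smooth_map M A U f \<and> smooth_map M A (f ` U) (inv_into U f)"


section \<open>Jets\<close>

text \<open>A 1-arrow \<open>(p, q, F)\<close> consists of its source, its target and the Jacobian matrices \<open>F c d\<close>
  of its representatives in all charts \<open>c\<close> at \<open>p\<close> and \<open>d\<close> at \<open>q\<close>.  The value 0 for the other
  \<open>c\<close> and \<open>d\<close> makes equality of triples coincide with equality of 1-jets; the same convention
  is used for vectors and for 1-jets of vector fields.\<close>

type_synonym ('m, 'n) arrow =
  "'m \<times> 'm \<times> (('m, 'n) chart \<Rightarrow> ('m, 'n) chart \<Rightarrow> real^'n^'n)"

definition jet ::
  "('m, 'n::finite) chart set \<Rightarrow> ('m \<Rightarrow> 'm) \<Rightarrow> 'm \<Rightarrow>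
    ('m, 'n) chart \<Rightarrow> ('m, 'n) chart \<Rightarrow> real^'n^'n" where
  "jet A f p = (\<lambda>c d. if c \<in> charts_at A p \<and> d \<in> charts_at A (f p)
     then jacobian (local_rep c d f) (at (cmap c p)) else 0)"

definition U1 :: "'m topology \<Rightarrow> ('m, 'n::finite) chart set \<Rightarrow> ('m, 'n) arrow set" where
  "U1 M A = {(p, f p, jet A f p) | p f. \<exists>U. p \<in> U \<and> local_diffeo M A U f}"

text \<open>A vector field is given by its components \<open>v c x\<close> in the charts \<open>c\<close>, as functions of the
  coordinates \<open>x\<close>.\<close>

definition vector_field_on ::
  "'m topology \<Rightarrow> ('m, 'n::finite) chart set \<Rightarrow> 'm set \<Rightarrow>
    (('m, 'n) chart \<Rightarrow> real^'n \<Rightarrow> real^'n) \<Rightarrow> bool" where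
  "vector_field_on M A U v \<longleftrightarrow> openin M U \<and>
     (\<forall>c\<in>A. smooth_on (cmap c ` (cdom c \<inter> U)) (v c)) \<and>
     (\<forall>c\<in>A. \<forall>d\<in>A. \<forall>p \<in> cdom c \<inter> cdom d \<inter> U.
        jacobian (trans_map c d) (at (cmap c p)) *v v c (cmap c p) = v d (cmap d p))"

definition tangent_bundle ::
  "'m topology \<Rightarrow> ('m, 'n::finite) chart set \<Rightarrow> ('m \<times> (('m, 'n) chart \<Rightarrow> real^'n)) set" where
  "tangent_bundle M A = {(p, \<tau>). p \<in> topspace M \<and>
     (\<forall>c \<in> charts_at A p. \<forall>d \<in> charts_at A p.
        jacobian (trans_map c d) (at (cmap c p)) *v \<tau> c = \<tau> d) \<and>
     (\<forall>c. c \<notin> charts_at A p \<longrightarrow> \<tau> c = 0)}"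

text \<open>In each chart \<open>c\<close> at \<open>p\<close> the components of a 1-jet of a vector field at \<open>p\<close> form the pair
  \<open>(\<xi>, \<Xi>)\<close> of the vector \<open>\<xi>\<^sup>i\<close> and the matrix \<open>\<xi>\<^sup>i\<^sub>j\<close> with row index \<open>i\<close>.\<close>

type_synonym ('m, 'n) vjet = "'m \<times> (('m, 'n) chart \<Rightarrow> (real^'n) \<times> (real^'n^'n))"

definition vjet ::
  "('m, 'n::finite) chart set \<Rightarrow> (('m, 'n) chart \<Rightarrow> real^'n \<Rightarrow> real^'n) \<Rightarrow> 'm \<Rightarrow>
    ('m, 'n) chart \<Rightarrow> (real^'n) \<times> (real^'n^'n)" where
  "vjet A v p = (\<lambda>c. if c \<in> charts_at A p
     then (v c (cmap c p), jacobian (v c) (at (cmap c p))) else 0)"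

definition J1T :: "'m topology \<Rightarrow> ('m, 'n::finite) chart set \<Rightarrow> ('m, 'n) vjet set" where
  "J1T M A = {(p, vjet A v p) | p v. \<exists>U. p \<in> U \<and> vector_field_on M A U v}"


section \<open>Structure objects\<close>

text \<open>The component \<open>w\<^sup>i\<^sub>j(x)\<close> in the chart \<open>c\<close> is \<open>w c x $ i $ j\<close>.\<close>

type_synonym ('m, 'n) geom_object = "('m, 'n) chart \<Rightarrow> real^'n \<Rightarrow> real^'n^'n"

definition structure_object ::
  "('m, 'n::finite) chart set \<Rightarrow> ('m, 'n) geom_object \<Rightarrow> bool" where
  "structure_object A w \<longleftrightarrow>
     (\<forall>c\<in>A. smooth_on (cmap c ` cdom c) (w c) \<and> (\<forall>x \<in> cmap c ` cdom c. invertible (w c x))) \<and>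
     (\<forall>c\<in>A. \<forall>d\<in>A. \<forall>p \<in> cdom c \<inter> cdom d.
        jacobian (trans_map c d) (at (cmap c p)) ** w c (cmap c p) = w d (cmap d p))"

text \<open>The following formulas live in one chart; there \<open>u\<close> is the matrix function \<open>w c\<close>.  The order
  of the index arguments is that of the indices in \<open>\<Gamma>\<^sup>i\<^sub>j\<^sub>k\<close>, \<open>I\<^sup>i\<^sub>j\<^sub>k\<close> and, for the linear curvature,
  \<open>i\<close>, \<open>k\<close>, \<open>j\<close>, \<open>a\<close>.\<close>

definition Gam :: "(real^'n \<Rightarrow> real^'n^'n) \<Rightarrow> real^'n::finite \<Rightarrow> 'n \<Rightarrow> 'n \<Rightarrow> 'n \<Rightarrow> real" where
  "Gam u x i j k = (\<Sum>a\<in>UNIV. pd j (\<lambda>x. u x $ i $ a) x * matrix_inv (u x) $ a $ k)"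

definition integ :: "(real^'n \<Rightarrow> real^'n^'n) \<Rightarrow> real^'n::finite \<Rightarrow> 'n \<Rightarrow> 'n \<Rightarrow> 'n \<Rightarrow> real" where
  "integ u x i j k = alt (\<lambda>j k. Gam u x i j k) j k"

definition lin_curv ::
  "(real^'n \<Rightarrow> real^'n^'n) \<Rightarrow> real^'n::finite \<Rightarrow> 'n \<Rightarrow> 'n \<Rightarrow> 'n \<Rightarrow> 'n \<Rightarrow> real" where
  "lin_curv u x i k j a =
     alt (\<lambda>k j. pd k (\<lambda>x. Gam u x i a j) x + (\<Sum>b\<in>UNIV. Gam u x i b j * Gam u x b a k)) k j"

definition lin_curv_zero ::
  "('m, 'n::finite) chart set \<Rightarrow> ('m, 'n) geom_object \<Rightarrow> bool" where
  "lin_curv_zero A w \<longleftrightarrow>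
     (\<forall>c\<in>A. \<forall>x \<in> cmap c ` cdom c. \<forall>i k j a. lin_curv (w c) x i k j a = 0)"


section \<open>Invariance groupoid and nonlinear curvature\<close>

definition N1_groupoid ::
  "'m topology \<Rightarrow> ('m, 'n::finite) chart set \<Rightarrow> ('m, 'n) geom_object \<Rightarrow> ('m, 'n) arrow set" where
  "N1_groupoid M A w = {(p, q, F). (p, q, F) \<in> U1 M A \<and>
     (\<forall>c \<in> charts_at A p. \<forall>d \<in> charts_at A q. F c d ** w c (cmap c p) = w d (cmap d q))}"

definition groupoid_solution ::
  "'m topology \<Rightarrow> ('m, 'n::finite) chart set \<Rightarrow> ('m, 'n) geom_object \<Rightarrow> ('m, 'n) arrow \<Rightarrow>
    'm set \<Rightarrow> ('m \<Rightarrow> 'm) \<Rightarrow> bool" where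
  "groupoid_solution M A w = (\<lambda>(p, q, F) U f. p \<in> U \<and> local_diffeo M A U f \<and>
     (\<forall>r\<in>U. \<forall>c \<in> charts_at A r. \<forall>d \<in> charts_at A (f r).
        jacobian (local_rep c d f) (at (cmap c r)) ** w c (cmap c r) = w d (cmap d (f r))) \<and>
     f p = q \<and> jet A f p = F)"

definition groupoid_uniquely_locally_integrable ::
  "'m topology \<Rightarrow> ('m, 'n::finite) chart set \<Rightarrow> ('m, 'n) geom_object \<Rightarrow> bool" where
  "groupoid_uniquely_locally_integrable M A w \<longleftrightarrow>
     (\<forall>(p, q, F) \<in> N1_groupoid M A w.
        \<exists>U f. groupoid_solution M A w (p, q, F) U f \<and>
          (\<forall>V g. groupoid_solution M A w (p, q, F) V g \<longrightarrow>
             (\<exists>W. openin M W \<and> p \<in> W \<and> W \<subseteq> U \<inter> V \<and> (\<forall>r\<in>W. f r = g r))))"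

text \<open>The push-forward \<open>B\<^sup>c\<^sub>a\<^sub>b f\<^sup>i\<^sub>c g\<^sup>a\<^sub>j g\<^sup>b\<^sub>k\<close>, where \<open>g\<close> is the inverse of \<open>f\<close>.\<close>

definition push ::
  "real^'n^'n \<Rightarrow> ('n::finite \<Rightarrow> 'n \<Rightarrow> 'n \<Rightarrow> real) \<Rightarrow> 'n \<Rightarrow> 'n \<Rightarrow> 'n \<Rightarrow> real" where
  "push f B i j k = (let g = matrix_inv f in
     \<Sum>c\<in>UNIV. \<Sum>a\<in>UNIV. \<Sum>b\<in>UNIV. B c a b * f $ i $ c * g $ a $ j * g $ b $ k)"

definition N1_leaves_integ_invariant ::
  "'m topology \<Rightarrow> ('m, 'n::finite) chart set \<Rightarrow> ('m, 'n) geom_object \<Rightarrow> bool" where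
  "N1_leaves_integ_invariant M A w \<longleftrightarrow>
     (\<forall>(p, q, F) \<in> N1_groupoid M A w. \<forall>c \<in> charts_at A p. \<forall>d \<in> charts_at A q. \<forall>i j k.
        push (F c d) (integ (w c) (cmap c p)) i j k = integ (w d) (cmap d q) i j k)"

text \<open>For a structure object there is exactly one 1-arrow of the invariance groupoid from \<open>p\<close> to
  \<open>q\<close>, so the description below is well defined: in charts it is \<open>w\<^sub>d(q) w\<^sub>c(p)\<^sup>-\<^sup>1\<close>, the jet of a map
  that is affine in a chart at \<open>p\<close> and a chart at \<open>q\<close>.\<close>

definition N1_arrow ::
  "'m topology \<Rightarrow> ('m, 'n::finite) chart set \<Rightarrow> ('m, 'n) geom_object \<Rightarrow> 'm \<Rightarrow> 'm \<Rightarrow>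
    ('m, 'n) chart \<Rightarrow> ('m, 'n) chart \<Rightarrow> real^'n^'n" where
  "N1_arrow M A w p q = (THE F. (p, q, F) \<in> N1_groupoid M A w)"

definition nonlin_curv ::
  "'m topology \<Rightarrow> ('m, 'n::finite) chart set \<Rightarrow> ('m, 'n) geom_object \<Rightarrow> 'm \<Rightarrow> 'm \<Rightarrow>
    ('m, 'n) chart \<Rightarrow> ('m, 'n) chart \<Rightarrow> 'n \<Rightarrow> 'n \<Rightarrow> 'n \<Rightarrow> real" where
  "nonlin_curv M A w p q c d i j k = integ (w d) (cmap d q) i j k
     - push (N1_arrow M A w p q c d) (integ (w c) (cmap c p)) i j k"

definition nonlin_curv_zero ::
  "'m topology \<Rightarrow> ('m, 'n::finite) chart set \<Rightarrow> ('m, 'n) geom_object \<Rightarrow> bool" where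
  "nonlin_curv_zero M A w \<longleftrightarrow>
     (\<forall>p \<in> topspace M. \<forall>q \<in> topspace M. \<forall>c \<in> charts_at A p. \<forall>d \<in> charts_at A q. \<forall>i j k.
        nonlin_curv M A w p q c d i j k = 0)"


section \<open>Linearization and formal Lie derivative\<close>

definition N1_bundle ::
  "'m topology \<Rightarrow> ('m, 'n::finite) chart set \<Rightarrow> ('m, 'n) geom_object \<Rightarrow> ('m, 'n) vjet set" where
  "N1_bundle M A w = {(p, \<eta>). (p, \<eta>) \<in> J1T M A \<and>
     (\<forall>c \<in> charts_at A p. \<forall>i j.
        snd (\<eta> c) $ i $ j = (\<Sum>a\<in>UNIV. Gam (w c) (cmap c p) i a j * fst (\<eta> c) $ a))}"

definition bundle_solution ::
  "'m topology \<Rightarrow> ('m, 'n::finite) chart set \<Rightarrow> ('m, 'n) geom_object \<Rightarrow> ('m, 'n) vjet \<Rightarrow>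
    'm set \<Rightarrow> (('m, 'n) chart \<Rightarrow> real^'n \<Rightarrow> real^'n) \<Rightarrow> bool" where
  "bundle_solution M A w = (\<lambda>(p, \<eta>) U v. p \<in> U \<and> vector_field_on M A U v \<and>
     (\<forall>c\<in>A. \<forall>x \<in> cmap c ` (cdom c \<inter> U). \<forall>i j.
        pd j (\<lambda>x. v c x $ i) x = (\<Sum>a\<in>UNIV. Gam (w c) x i a j * v c x $ a)) \<and>
     vjet A v p = \<eta>)"

definition bundle_uniquely_locally_integrable ::
  "'m topology \<Rightarrow> ('m, 'n::finite) chart set \<Rightarrow> ('m, 'n) geom_object \<Rightarrow> bool" where
  "bundle_uniquely_locally_integrable M A w \<longleftrightarrow>
     (\<forall>(p, \<eta>) \<in> N1_bundle M A w.
        \<exists>U v. bundle_solution M A w (p, \<eta>) U v \<and>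
          (\<forall>V v'. bundle_solution M A w (p, \<eta>) V v' \<longrightarrow>
             (\<exists>W. openin M W \<and> p \<in> W \<and> W \<subseteq> U \<inter> V \<and>
                (\<forall>c\<in>A. \<forall>x \<in> cmap c ` (cdom c \<inter> W). v c x = v' c x))))"

text \<open>The splitting \<open>\<epsilon>\<close> of the projection onto the tangent bundle.\<close>

definition eps ::
  "('m, 'n::finite) chart set \<Rightarrow> ('m, 'n) geom_object \<Rightarrow>
    'm \<times> (('m, 'n) chart \<Rightarrow> real^'n) \<Rightarrow> ('m, 'n) vjet" where
  "eps A w = (\<lambda>(p, \<tau>). (p, \<lambda>c. if c \<in> charts_at A p
     then (\<tau> c, \<chi> i j. \<Sum>a\<in>UNIV. Gam (w c) (cmap c p) i a j * \<tau> c $ a) else 0))"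

text \<open>The formula for the Lie derivative of a (1,2)-tensor field with components \<open>\<alpha> x i k j\<close>
  along \<open>\<xi>\<close>, with \<open>\<partial>\<xi>\<^sup>i/\<partial>x\<^sup>j\<close> replaced by \<open>\<Xi> $ i $ j\<close>.\<close>

definition formal_lie ::
  "(real^'n \<Rightarrow> 'n::finite \<Rightarrow> 'n \<Rightarrow> 'n \<Rightarrow> real) \<Rightarrow> real^'n \<Rightarrow> (real^'n) \<times> (real^'n^'n) \<Rightarrow>
    'n \<Rightarrow> 'n \<Rightarrow> 'n \<Rightarrow> real" where
  "formal_lie \<alpha> x = (\<lambda>(\<xi>, \<Xi>) i k j.
     (\<Sum>a\<in>UNIV. pd a (\<lambda>x. \<alpha> x i k j) x * \<xi> $ a)
     - (\<Sum>b\<in>UNIV. \<Xi> $ i $ b * \<alpha> x b k j)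
     + (\<Sum>b\<in>UNIV. \<Xi> $ b $ k * \<alpha> x i b j)
     + (\<Sum>b\<in>UNIV. \<Xi> $ b $ j * \<alpha> x i k b))"

definition lie_eps_integ_zero ::
  "'m topology \<Rightarrow> ('m, 'n::finite) chart set \<Rightarrow> ('m, 'n) geom_object \<Rightarrow> bool" where
  "lie_eps_integ_zero M A w \<longleftrightarrow>
     (\<forall>(p, \<tau>) \<in> tangent_bundle M A. \<forall>c \<in> charts_at A p. \<forall>i k j.
        formal_lie (integ (w c)) (cmap c p) (snd (eps A w (p, \<tau>)) c) i k j = 0)"

end

theory Submission
  imports Defs
begin

text \<open>The columns of \<open>w\<close> are vector fields \<open>e\<^sub>a\<close> on \<open>M\<close> that form a frame at every point.
  Contracted with this frame the integrability object is the bracket,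
  \<open>I(e\<^sub>a, e\<^sub>b) = [e\<^sub>a, e\<^sub>b]\<close>, and the coefficients of \<open>[e\<^sub>a, e\<^sub>b]\<close> in the frame are functions on
  \<open>M\<close>, the structure functions (\<open>struct_fun\<close> in a chart, \<open>struct_at\<close> on \<open>M\<close>).  Each of the six
  conditions says that the structure functions are constant.

  The arrow of the invariance groupoid from \<open>p\<close> to \<open>q\<close> maps the frame at \<open>p\<close> to the frame at \<open>q\<close>.
  It therefore maps \<open>I\<close> at \<open>p\<close> to \<open>I\<close> at \<open>q\<close> if and only if the structure functions agree at the
  two points (\<open>push_integ_iff\<close>).  Since over every pair of points there is exactly one arrow, the
  vanishing of the nonlinear curvature and the invariance of \<open>I\<close> both mean constancy.

  The linear curvature and the formal Lie derivative of \<open>I\<close> have the same components, and these are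
  the components of the derivative of the structure functions (\<open>lin_curv_eq\<close>, \<open>formal_lie_eq\<close>,
  \<open>struct_fun_has_derivative\<close>).  So each of them vanishes if and only if the structure functions
  are locally constant, which on the connected space \<open>M\<close> means constant.

  The two integrability conditions concern total differential equations \<open>Dy(x) = F(x, y(x))\<close>.
  If a solution passes through \<open>(x, y)\<close>, the symmetry of its second derivative gives the condition
  that \<open>DF(x, y)(h, F(x, y) h) k\<close> is symmetric in \<open>h\<close> and \<open>k\<close>
  (\<open>total_differential_integrability\<close>).  Conversely, if this holds everywhere, there is a solution
  through every point (\<open>frobenius_exists\<close>), and its germ is unique
  (\<open>total_differential_unique\<close>).  For the equation of the groupoid the condition at \<open>(x, y)\<close> is
  the equality of the structure functions at \<open>x\<close> and \<open>y\<close> (\<open>frame_field_curvature\<close>).  For the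
  equation of the linearization it is the vanishing of the linear curvature applied to the value
  of the section (\<open>N1_field_curvature\<close>).

  The Frobenius theorem is proved by the Picard iteration along rays,
  \<open>y \<mapsto> (x \<mapsto> y\<^sub>0 + \<integral>\<^sub>0\<^sup>1 F(t x, y(t x)) x dt)\<close>.  On a small ball it is a contraction, and because
  of the integrability condition each step also halves the error \<open>Dy - F(x, y)\<close>, up to the
  change of \<open>y\<close> itself (\<open>picard_derivative\<close>, \<open>approx_sol_picard\<close>).  Hence the derivatives
  converge uniformly as well, and the limit solves the equation in all directions and not only
  along the rays.\<close>

section \<open>Calculus of \<open>C\<^sup>k\<close> maps\<close>

abbreviation fderiv :: "('a::real_normed_vector \<Rightarrow> 'b::real_normed_vector) \<Rightarrow> 'a \<Rightarrow> 'a \<Rightarrow> 'b" where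
  "fderiv f x \<equiv> frechet_derivative f (at x)"

lemma Ck_on_subset: "Ck_on k S f \<Longrightarrow> T \<subseteq> S \<Longrightarrow> Ck_on k T f"
  by (induction k arbitrary: f) (auto intro: continuous_on_subset)

lemma Ck_on_cong:
  assumes "open S" "\<And>x. x \<in> S \<Longrightarrow> f x = g x" "Ck_on k S f"
  shows "Ck_on k S g"
  using assms(2,3)
proof (induction k arbitrary: f g)
  case 0
  then show ?case by (simp cong: continuous_on_cong)
next
  case (Suc k)
  have d: "f differentiable (at x)" if "x \<in> S" for x using Suc.prems(2) that by simp
  have eq: "fderiv f x = fderiv g x" if "x \<in> S" for x
    using frechet_derivative_transform_within_open[OF d[OF that] \<open>open S\<close> that] Suc.prems(1) by blast
  have "g differentiable (at x)" if "x \<in> S" for x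
    using has_derivative_transform_within_open[OF _ \<open>open S\<close> that, of f] d[OF that] Suc.prems(1)
    unfolding differentiable_def by metis
  moreover have "Ck_on k S (\<lambda>x. fderiv g x v)" for v
    by (rule Suc.IH[of "\<lambda>x. fderiv f x v"]) (use eq Suc.prems(2) in auto)
  ultimately show ?case by simp
qed

text \<open>A derivative that is known explicitly replaces the Frechet derivative chosen in the
  definition of \<open>Ck_on\<close>; the inductions below go through this rule.\<close>

lemma Ck_on_SucI:
  assumes "open S" "\<And>x. x \<in> S \<Longrightarrow> (f has_derivative f' x) (at x)" "\<And>v. Ck_on k S (\<lambda>x. f' x v)"
  shows "Ck_on (Suc k) S f"
proof -
  have "Ck_on k S (\<lambda>x. fderiv f x v)" for v
    by (rule Ck_on_cong[OF assms(1) _ assms(3)[of v]]) (simp add: frechet_derivative_at[OF assms(2)])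
  then show ?thesis using assms(2) by (auto simp: differentiable_def)
qed

lemma Ck_on_SucD:
  assumes "Ck_on (Suc k) S f" "x \<in> S"
  shows "(f has_derivative fderiv f x) (at x)"
  using assms frechet_derivative_works by auto

lemma Ck_on_Suc_imp: "Ck_on (Suc k) S f \<Longrightarrow> Ck_on k S f"
proof (induction k arbitrary: f)
  case 0
  then show ?case
    by (auto intro!: continuous_at_imp_continuous_on differentiable_imp_continuous_within)
next
  case (Suc k)
  then show ?case by (metis Ck_on.simps(2))
qed

lemma Ck_on_imp_continuous_on: "Ck_on k S f \<Longrightarrow> continuous_on S f"
proof (induction k)
  case (Suc k)
  then show ?case using Ck_on_Suc_imp by blast
qed simp

lemma Ck_on_const: "open S \<Longrightarrow> Ck_on k S (\<lambda>x. c)"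
proof (induction k arbitrary: c)
  case (Suc k)
  show ?case by (rule Ck_on_SucI[OF Suc.prems has_derivative_const]) (rule Suc.IH[OF Suc.prems])
qed simp

lemma Ck_on_linear:
  assumes "bounded_linear L" "open S" "Ck_on k S f"
  shows "Ck_on k S (\<lambda>x. L (f x))"
  using assms(3)
proof (induction k arbitrary: f)
  case 0
  then show ?case by (simp add: bounded_linear.continuous_on[OF assms(1)])
next
  case (Suc k)
  show ?case
    by (rule Ck_on_SucI[OF \<open>open S\<close> bounded_linear.has_derivative[OF assms(1) Ck_on_SucD[OF Suc.prems]]])
      (use Suc in auto)
qed

lemma Ck_on_id: "open S \<Longrightarrow> Ck_on k S (\<lambda>x. x)"
proof (cases k)
  case (Suc l)
  assume "open S"
  show ?thesis unfolding Suc by (rule Ck_on_SucI[OF \<open>open S\<close> has_derivative_ident]) (rule Ck_on_const[OF \<open>open S\<close>])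
qed simp

lemma Ck_on_add:
  assumes "open S" "Ck_on k S f" "Ck_on k S g"
  shows "Ck_on k S (\<lambda>x. f x + g x)"
  using assms(2,3)
proof (induction k arbitrary: f g)
  case 0
  then show ?case by (auto intro: continuous_intros)
next
  case (Suc k)
  show ?case
    by (rule Ck_on_SucI[OF \<open>open S\<close> has_derivative_add[OF Ck_on_SucD[OF Suc.prems(1)] Ck_on_SucD[OF Suc.prems(2)]]])
      (use Suc in auto)
qed

lemma Ck_on_sum:
  assumes "open S" "\<And>i. i \<in> I \<Longrightarrow> Ck_on k S (f i)"
  shows "Ck_on k S (\<lambda>x. \<Sum>i\<in>I. f i x)"
  using assms(2)
  by (induction I rule: infinite_finite_induct) (auto intro: Ck_on_const Ck_on_add \<open>open S\<close>)

lemma Ck_on_bilinear: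
  assumes "bounded_bilinear B" "open S" "Ck_on k S f" "Ck_on k S g"
  shows "Ck_on k S (\<lambda>x. B (f x) (g x))"
  using assms(3,4)
proof (induction k arbitrary: f g)
  case 0
  then show ?case by (simp add: bounded_bilinear.continuous_on[OF assms(1)])
next
  case (Suc k)
  note IH = Suc.IH
  show ?case
  proof (rule Ck_on_SucI[OF \<open>open S\<close> bounded_bilinear.FDERIV[OF assms(1) Ck_on_SucD[OF Suc.prems(1)] Ck_on_SucD[OF Suc.prems(2)]]])
    fix v
    show "Ck_on k S (\<lambda>x. B (f x) (fderiv g x v) + B (fderiv f x v) (g x))"
      using Suc.prems by (intro Ck_on_add IH \<open>open S\<close>) (auto intro: Ck_on_Suc_imp simp del: Ck_on.simps(2), auto)
  qed
qed

lemma Ck_on_scaleR: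
  assumes "open S" "Ck_on k S f" "Ck_on k S g"
  shows "Ck_on k S (\<lambda>x. f x *\<^sub>R g x)"
  by (rule Ck_on_bilinear[OF bounded_bilinear_scaleR assms])

text \<open>By the chain rule \<open>D(g \<circ> f)(x) v = \<Sum>\<^sub>b (Df(x) v \<bullet> b) Dg(f x) b\<close>, summed over a basis.
  The sum is what allows the induction: it involves only the directional derivatives
  \<open>y \<mapsto> Dg(y) b\<close> in fixed directions, to which the induction hypothesis applies.\<close>

lemma Ck_on_compose:
  fixes f :: "'a::euclidean_space \<Rightarrow> 'b::euclidean_space" and g :: "'b \<Rightarrow> 'c::real_normed_vector"
  assumes "open S" "Ck_on k S f" "Ck_on k T g" "f ` S \<subseteq> T"
  shows "Ck_on k S (\<lambda>x. g (f x))"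
  using assms(2,3)
proof (induction k arbitrary: g)
  case 0
  then show ?case using continuous_on_compose2 assms(4) by auto
next
  case (Suc k)
  have f: "Ck_on k S f" by (rule Ck_on_Suc_imp[OF Suc.prems(1)])
  have in_T: "f x \<in> T" if "x \<in> S" for x using assms(4) that by blast
  have lin: "linear (fderiv g y)" if "y \<in> T" for y
    using Suc.prems(2) that by (auto intro: linear_frechet_derivative)
  have expand: "(\<Sum>b\<in>Basis. (u \<bullet> b) *\<^sub>R fderiv g y b) = fderiv g y u"
    if "y \<in> T" for y u
    by (simp only: linear_sum[OF lin[OF that], symmetric] linear_cmul[OF lin[OF that], symmetric]
        euclidean_representation)
  show ?case
  proof (rule Ck_on_SucI[OF \<open>open S\<close>])
    fix x assume x: "x \<in> S"
    show "((\<lambda>x. g (f x)) has_derivative (\<lambda>v. \<Sum>b\<in>Basis. (fderiv f x v \<bullet> b) *\<^sub>R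
        fderiv g (f x) b)) (at x)"
      using diff_chain_at[OF Ck_on_SucD[OF Suc.prems(1) x] Ck_on_SucD[OF Suc.prems(2) in_T[OF x]]]
      by (simp add: o_def expand[OF in_T[OF x]])
  next
    fix v
    show "Ck_on k S (\<lambda>x. \<Sum>b\<in>Basis. (fderiv f x v \<bullet> b) *\<^sub>R
        fderiv g (f x) b)"
    proof (intro Ck_on_sum Ck_on_scaleR \<open>open S\<close>)
      fix b :: 'b
      show "Ck_on k S (\<lambda>x. fderiv f x v \<bullet> b)"
        using Suc.prems(1) by (intro Ck_on_linear[OF bounded_linear_inner_left \<open>open S\<close>]) simp
      show "Ck_on k S (\<lambda>x. fderiv g (f x) b)"
        by (rule Suc.IH[OF f, of "\<lambda>y. fderiv g y b"]) (use Suc.prems(2) in simp)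
    qed
  qed
qed

lemma Ck_on_Pair:
  assumes "open S" "Ck_on k S f" "Ck_on k S g"
  shows "Ck_on k S (\<lambda>x. (f x, g x))"
proof -
  have "Ck_on k S (\<lambda>x. (f x, 0) + (0, g x))"
    by (rule Ck_on_add[OF assms(1) Ck_on_linear[of "\<lambda>y. (y, 0)", OF _ assms(1,2)]
          Ck_on_linear[of "\<lambda>y. (0, y)", OF _ assms(1,3)]])
      (intro bounded_linear_Pair bounded_linear_ident bounded_linear_zero)+
  then show ?thesis by simp
qed

lemma smooth_on_subset: "smooth_on S f \<Longrightarrow> T \<subseteq> S \<Longrightarrow> smooth_on T f"
  unfolding smooth_on_def by (metis Ck_on_subset)

lemma smooth_on_cong: "open S \<Longrightarrow> (\<And>x. x \<in> S \<Longrightarrow> f x = g x) \<Longrightarrow> smooth_on S f \<Longrightarrow> smooth_on S g"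
  unfolding smooth_on_def by (auto intro: Ck_on_cong[of S f g])

lemma smooth_on_linear:
  "bounded_linear L \<Longrightarrow> open S \<Longrightarrow> smooth_on S f \<Longrightarrow> smooth_on S (\<lambda>x. L (f x))"
  unfolding smooth_on_def by (simp add: Ck_on_linear)

lemma smooth_on_bilinear:
  "bounded_bilinear B \<Longrightarrow> open S \<Longrightarrow> smooth_on S f \<Longrightarrow> smooth_on S g \<Longrightarrow>
    smooth_on S (\<lambda>x. B (f x) (g x))"
  unfolding smooth_on_def by (simp add: Ck_on_bilinear)

lemma smooth_on_compose:
  fixes f :: "'a::euclidean_space \<Rightarrow> 'b::euclidean_space" and g :: "'b \<Rightarrow> 'c::real_normed_vector"
  shows "open S \<Longrightarrow> smooth_on S f \<Longrightarrow> smooth_on T g \<Longrightarrow> f ` S \<subseteq> T \<Longrightarrow>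
    smooth_on S (\<lambda>x. g (f x))"
  unfolding smooth_on_def by (auto intro: Ck_on_compose[of S _ f T g])

lemma smooth_on_add: "open S \<Longrightarrow> smooth_on S f \<Longrightarrow> smooth_on S g \<Longrightarrow> smooth_on S (\<lambda>x. f x + g x)"
  unfolding smooth_on_def by (simp add: Ck_on_add)

lemma smooth_on_id: "open S \<Longrightarrow> smooth_on S (\<lambda>x. x)"
  unfolding smooth_on_def by (simp add: Ck_on_id)

lemma smooth_on_const: "open S \<Longrightarrow> smooth_on S (\<lambda>x. c)"
  unfolding smooth_on_def by (simp add: Ck_on_const)

lemma smooth_on_has_derivative:
  "smooth_on S f \<Longrightarrow> x \<in> S \<Longrightarrow> (f has_derivative fderiv f x) (at x)"
  unfolding smooth_on_def using Ck_on_SucD[of 0 S f x] by simp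

lemma smooth_on_frechet_derivative:
  "smooth_on S f \<Longrightarrow> smooth_on S (\<lambda>x. fderiv f x v)"
proof -
  assume "smooth_on S f"
  then have "Ck_on (Suc k) S f" for k unfolding smooth_on_def by blast
  then show ?thesis by (simp add: smooth_on_def)
qed

lemma smooth_on_imp_continuous_on: "smooth_on S f \<Longrightarrow> continuous_on S f"
  unfolding smooth_on_def using Ck_on_imp_continuous_on[of 0 S f] by simp

section \<open>Matrices\<close>

lemma bilin_mv:
  "bounded_bilinear ((*v) :: real^'n^'m \<Rightarrow> real^'n \<Rightarrow> real^'m)"
  unfolding bilinear_conv_bounded_bilinear[symmetric] bilinear_def linear_iff
  by (intro conjI allI matrix_vector_right_distrib matrix_vector_mult_add_rdistrib
      matrix_vector_mult_scaleR scaleR_matrix_vector_assoc[symmetric])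

lemma bilin_mm:
  "bounded_bilinear ((**) :: real^'n^'m \<Rightarrow> real^'k^'n \<Rightarrow> real^'k^'m)"
proof -
  have s: "(r *\<^sub>R A) ** B = r *\<^sub>R (A ** B)" "A ** (r *\<^sub>R B) = r *\<^sub>R (A ** B)"
    for r and A :: "real^'n^'m" and B :: "real^'k^'n"
    by (simp_all add: vec_eq_iff matrix_matrix_mult_def sum_distrib_left ac_simps)
  have a: "(A + B) ** C = A ** C + B ** C" for A B :: "real^'n^'m" and C :: "real^'k^'n"
    by (simp add: vec_eq_iff matrix_matrix_mult_def sum.distrib distrib_right)
  show ?thesis
    unfolding bilinear_conv_bounded_bilinear[symmetric] bilinear_def linear_iff
    by (intro conjI allI matrix_add_ldistrib s a)
qed

lemma matrix_inv_left: "invertible A \<Longrightarrow> matrix_inv A ** A = mat 1"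
  and matrix_inv_right: "invertible A \<Longrightarrow> A ** matrix_inv A = mat 1" for A :: "real^'n^'n"
  using someI_ex[of "\<lambda>B. A ** B = mat 1 \<and> B ** A = mat 1"]
  unfolding invertible_def matrix_inv_def by blast+

lemma differentiable_det:
  fixes M :: "'a::real_normed_vector \<Rightarrow> real^'n^'n"
  assumes "\<And>i j. (\<lambda>x. M x $ i $ j) differentiable (at x)"
  shows "(\<lambda>x. det (M x)) differentiable (at x)"
proof -
  obtain D where D: "\<And>i j. ((\<lambda>x. M x $ i $ j) has_derivative D i j) (at x)"
    using assms unfolding differentiable_def by metis
  have "(\<lambda>x. \<Prod>i\<in>UNIV. M x $ i $ p i) differentiable (at x)" for p
    unfolding differentiable_def
    using has_derivative_prod[of UNIV "\<lambda>i x. M x $ i $ p i" "\<lambda>i. D i (p i)", OF D] by blast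
  then show ?thesis unfolding det_def by (intro differentiable_sum differentiable_mult) auto
qed

lemma differentiable_matrix_entry: "(\<lambda>A :: real^'n^'m. A $ i $ j) differentiable (at A0)"
proof -
  have "bounded_linear (\<lambda>A :: real^'n^'m. A $ i $ j)"
    by (rule bounded_linear_compose[OF bounded_linear_vec_nth bounded_linear_vec_nth])
  from bounded_linear_imp_has_derivative[OF this] show ?thesis unfolding differentiable_def by blast
qed

lemma open_invertible: "open {A :: real^'n^'n. invertible A}"
proof -
  have "continuous_on UNIV (det :: real^'n^'n \<Rightarrow> real)"
    by (intro differentiable_imp_continuous_on)
      (auto simp: differentiable_on_def intro: differentiable_det differentiable_matrix_entry)
  then have "open {A :: real^'n^'n. det A \<noteq> 0}"
    by (intro open_Collect_neq) auto
  then show ?thesis by (simp add: invertible_det_nz)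
qed

text \<open>Cramer's rule shows that the entries of the inverse are differentiable; the value of the
  derivative then comes from differentiating \<open>B ** B\<^sup>-\<^sup>1 = 1\<close>.\<close>

lemma has_derivative_matrix_inv:
  fixes A :: "real^'n^'n"
  assumes "invertible A"
  shows "(matrix_inv has_derivative (\<lambda>H. - (matrix_inv A ** H ** matrix_inv A))) (at A)"
proof -
  let ?R = "\<lambda>j k (B :: real^'n^'n). \<chi> i l. if l = k then axis j 1 $ i else B $ i $ l"
  have entry: "matrix_inv B $ k $ j = det (?R j k B) / det B" if "invertible B" for B :: "real^'n^'n" and k j
  proof -
    have "B *v (matrix_inv B *v axis j 1) = axis j 1"
      by (simp add: matrix_vector_mul_assoc matrix_inv_right[OF that])
    then have "matrix_inv B *v axis j 1 = (\<chi> k. det (?R j k B) / det B)"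
      using cramer[of B] that by (simp add: invertible_det_nz)
    then have "(matrix_inv B *v axis j 1) $ k = det (?R j k B) / det B" by (simp only: vec_lambda_beta)
    then show ?thesis by (simp only: matrix_vector_mult_basis column_def vec_lambda_beta)
  qed
  have "(\<lambda>B. det (?R j k B) / det B) differentiable (at A)" for j k
  proof (intro differentiable_divide differentiable_det differentiable_matrix_entry)
    fix i l
    show "(\<lambda>B. ?R j k B $ i $ l) differentiable (at A)"
      by (cases "l = k") (auto intro: differentiable_matrix_entry)
    show "det A \<noteq> 0" using assms by (simp add: invertible_det_nz)
  qed
  then have diff: "\<exists>R'. ((\<lambda>B. det (?R j k B) / det B) has_derivative R') (at A)" for j k
    by (simp only: differentiable_def)
  have "(\<lambda>B :: real^'n^'n. matrix_inv B $ k $ j) differentiable (at A)" for j k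
  proof -
    obtain R' where "((\<lambda>B. det (?R j k B) / det B) has_derivative R') (at A)" using diff by (rule exE)
    then have "((\<lambda>B :: real^'n^'n. matrix_inv B $ k $ j) has_derivative R') (at A)"
      by (rule has_derivative_transform_within_open[OF _ open_invertible]) (simp_all add: assms entry)
    then show ?thesis by (rule differentiableI)
  qed
  then have "matrix_inv differentiable (at A)"
    by (subst differentiable_componentwise_within) (auto simp: Basis_vec_def inner_axis)
  then obtain D where D: "(matrix_inv has_derivative D) (at A)" unfolding differentiable_def by blast
  have "((\<lambda>B. B ** matrix_inv B) has_derivative (\<lambda>H. A ** D H + H ** matrix_inv A)) (at A)"
    by (rule bounded_bilinear.FDERIV[OF bilin_mm has_derivative_ident D])
  moreover have "((\<lambda>B. B ** matrix_inv B) has_derivative (\<lambda>H. 0)) (at A)"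
    by (rule has_derivative_transform_within_open[OF has_derivative_const[of "mat 1"] open_invertible])
      (simp_all add: assms matrix_inv_right)
  ultimately have "(\<lambda>H. A ** D H + H ** matrix_inv A) = (\<lambda>H. 0)" by (rule has_derivative_unique)
  then have "A ** D H + H ** matrix_inv A = 0" for H by (rule fun_cong)
  then have "A ** D H = - (H ** matrix_inv A)" for H by (simp only: eq_neg_iff_add_eq_0)
  then have "matrix_inv A ** (A ** D H) = - (matrix_inv A ** H ** matrix_inv A)" for H
    by (simp only: bounded_bilinear.minus_right[OF bilin_mm] matrix_mul_assoc)
  then have "D = (\<lambda>H. - (matrix_inv A ** H ** matrix_inv A))"
    by (simp add: fun_eq_iff matrix_mul_assoc matrix_inv_left[OF assms])
  with D show ?thesis by simp
qed

lemma smooth_on_matrix_inv: "smooth_on {A :: real^'n^'n. invertible A} matrix_inv"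
  unfolding smooth_on_def
proof
  fix k show "Ck_on k {A :: real^'n^'n. invertible A} matrix_inv"
  proof (induction k)
    case 0
    show ?case
      by (auto intro!: continuous_at_imp_continuous_on has_derivative_continuous has_derivative_matrix_inv)
  next
    case (Suc k)
    have "Ck_on k {A :: real^'n^'n. invertible A} (\<lambda>A. - (matrix_inv A ** H ** matrix_inv A))" for H
      by (intro Ck_on_linear[OF bounded_linear_minus[OF bounded_linear_ident]]
          Ck_on_bilinear[OF bilin_mm] Suc Ck_on_const open_invertible)
    then show ?case by (intro Ck_on_SucI[OF open_invertible has_derivative_matrix_inv]) auto
  qed
qed

section \<open>Symmetry of the second derivative\<close>

text \<open>The mean value inequality for \<open>s \<mapsto> f(x\<^sub>0 + s h + t k) - f(x\<^sub>0 + s h) - s t f'' k\<close>, whose derivative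
  is \<open>o(t)\<close> because \<open>f''\<close> is the derivative of \<open>x \<mapsto> f' x h\<close> at \<open>x\<^sub>0\<close>.\<close>

lemma second_difference_estimate:
  fixes f :: "'a::real_normed_vector \<Rightarrow> 'b::real_normed_vector"
  assumes S: "open S" "x0 \<in> S" and f': "\<And>x. x \<in> S \<Longrightarrow> (f has_derivative f' x) (at x)"
    and f'': "((\<lambda>x. f' x h) has_derivative f'') (at x0)" and e: "e > 0"
  shows "\<exists>d>0. \<forall>t. 0 < t \<and> t < d \<longrightarrow>
    norm (f (x0 + t *\<^sub>R h + t *\<^sub>R k) - f (x0 + t *\<^sub>R h) - f (x0 + t *\<^sub>R k) + f x0 - t\<^sup>2 *\<^sub>R f'' k)
      \<le> e * t\<^sup>2 * (2 * (norm h + norm k))" (is "\<exists>d>0. \<forall>t. _ \<longrightarrow> norm (?E t) \<le> _")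
proof -
  obtain d1 where d1: "d1 > 0" "\<And>y. norm (y - x0) < d1 \<Longrightarrow>
      norm (f' y h - f' x0 h - f'' (y - x0)) \<le> e * norm (y - x0)"
    using f'' e unfolding has_derivative_at_alt by blast
  obtain d2 where d2: "d2 > 0" "ball x0 d2 \<subseteq> S" using S open_contains_ball by blast
  define N where "N = norm h + norm k"
  define d where "d = min d1 d2 / (N + 1)"
  have N: "N \<ge> 0" by (simp add: N_def)
  have lin: "linear f''" using f'' has_derivative_linear by blast
  show ?thesis
  proof (intro exI[of _ d] conjI allI impI)
    show "d > 0" using d1 d2 N by (simp add: d_def)
  next
    fix t assume t: "0 < t \<and> t < d"
    then have "t * (N + 1) < min d1 d2" using N by (simp add: d_def field_simps)
    then have tN: "t * N < d1" "t * N < d2" using t by (simp_all add: algebra_simps)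
    have le: "norm (s *\<^sub>R h) \<le> t * N" "norm (s *\<^sub>R h + t *\<^sub>R k) \<le> t * N" if "0 \<le> s" "s \<le> t" for s
    proof -
      have "norm (s *\<^sub>R h) \<le> t * norm h" using that by (simp add: mult_right_mono)
      moreover have "norm (t *\<^sub>R k) = t * norm k" using t by simp
      ultimately show "norm (s *\<^sub>R h) \<le> t * N" "norm (s *\<^sub>R h + t *\<^sub>R k) \<le> t * N"
        using t norm_triangle_ineq[of "s *\<^sub>R h" "t *\<^sub>R k"] mult_nonneg_nonneg[of t "norm k"]
        unfolding N_def distrib_left by (metis add_increasing2 norm_ge_zero less_imp_le, linarith)
    qed
    define g where "g s = f (x0 + (s *\<^sub>R h + t *\<^sub>R k)) - f (x0 + s *\<^sub>R h) - (s * t) *\<^sub>R f'' k" for s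
    define D where "D s = f' (x0 + (s *\<^sub>R h + t *\<^sub>R k)) h - f' (x0 + s *\<^sub>R h) h - t *\<^sub>R f'' k" for s
    have "norm (g t - g 0) \<le> (e * (2 * (t * N))) * norm (t - 0)"
    proof (rule differentiable_bound[where S="{0..t}" and f'="\<lambda>s u. u *\<^sub>R D s"])
      fix s assume s: "s \<in> {0..t}"
      have mem: "x0 + (s *\<^sub>R h + t *\<^sub>R k) \<in> S" "x0 + s *\<^sub>R h \<in> S"
        using le[of s] s tN norm_minus_cancel[of "s *\<^sub>R h + t *\<^sub>R k"]
        by (auto intro!: subsetD[OF d2(2)] simp: dist_norm)
      have "(g has_derivative (\<lambda>u. f' (x0 + (s *\<^sub>R h + t *\<^sub>R k)) (u *\<^sub>R h) - f' (x0 + s *\<^sub>R h) (u *\<^sub>R h)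
          - (u * t) *\<^sub>R f'' k)) (at s)"
        unfolding g_def
      proof (intro has_derivative_diff)
        show "((\<lambda>s. f (x0 + (s *\<^sub>R h + t *\<^sub>R k))) has_derivative
            (\<lambda>u. f' (x0 + (s *\<^sub>R h + t *\<^sub>R k)) (u *\<^sub>R h))) (at s)"
          by (rule has_derivative_compose[where f="\<lambda>s. x0 + (s *\<^sub>R h + t *\<^sub>R k)" and f'="\<lambda>u. u *\<^sub>R h"
                and g=f and g'="f' (x0 + (s *\<^sub>R h + t *\<^sub>R k))"])
            (auto intro!: derivative_eq_intros f'[OF mem(1)])
        show "((\<lambda>s. f (x0 + s *\<^sub>R h)) has_derivative (\<lambda>u. f' (x0 + s *\<^sub>R h) (u *\<^sub>R h))) (at s)"
          by (rule has_derivative_compose[where f="\<lambda>s. x0 + s *\<^sub>R h" and f'="\<lambda>u. u *\<^sub>R h"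
                and g=f and g'="f' (x0 + s *\<^sub>R h)"])
            (auto intro!: derivative_eq_intros f'[OF mem(2)])
        show "((\<lambda>s. (s * t) *\<^sub>R f'' k) has_derivative (\<lambda>u. (u * t) *\<^sub>R f'' k)) (at s)"
          by (auto intro!: derivative_eq_intros)
      qed
      then show "(g has_derivative (\<lambda>u. u *\<^sub>R D s)) (at s within {0..t})"
        using linear_cmul[OF has_derivative_linear[OF f'[OF mem(1)]]]
          linear_cmul[OF has_derivative_linear[OF f'[OF mem(2)]]]
        by (simp add: D_def scaleR_diff_right has_derivative_at_withinI)
      have "norm (f' (x0 + (s *\<^sub>R h + t *\<^sub>R k)) h - f' x0 h - f'' (s *\<^sub>R h + t *\<^sub>R k)) \<le> e * (t * N)"
        using order_trans[OF d1(2)[of "x0 + (s *\<^sub>R h + t *\<^sub>R k)"], of "e * (t * N)"]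
          mult_left_mono[OF le(2)[of s], of e] le(2)[of s] s tN e by simp
      moreover have "norm (f' (x0 + s *\<^sub>R h) h - f' x0 h - f'' (s *\<^sub>R h)) \<le> e * (t * N)"
        using order_trans[OF d1(2)[of "x0 + s *\<^sub>R h"], of "e * (t * N)"]
          mult_left_mono[OF le(1)[of s], of e] le(1)[of s] s tN e by simp
      moreover have "D s = (f' (x0 + (s *\<^sub>R h + t *\<^sub>R k)) h - f' x0 h - f'' (s *\<^sub>R h + t *\<^sub>R k))
          - (f' (x0 + s *\<^sub>R h) h - f' x0 h - f'' (s *\<^sub>R h))"
        by (simp add: D_def linear_add[OF lin] linear_cmul[OF lin])
      ultimately have "norm (D s) \<le> e * (t * N) + e * (t * N)"
        by (simp only: norm_triangle_le_diff add_mono)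
      then have "norm (D s) \<le> e * (2 * (t * N))" by (simp only: mult_2 distrib_left)
      then show "onorm (\<lambda>u. u *\<^sub>R D s) \<le> e * (2 * (t * N))"
        by (intro onorm_le) (simp add: mult.commute mult_left_mono)
    qed (use t in auto)
    moreover have "g t - g 0 =
        ?E t"
      by (simp add: g_def power2_eq_square add.assoc)
    moreover have "(e * (2 * (t * N))) * norm (t - 0) = e * t\<^sup>2 * (2 * (norm h + norm k))"
      using t by (simp add: N_def power2_eq_square)
    ultimately show "norm (?E t)
        \<le> e * t\<^sup>2 * (2 * (norm h + norm k))"
      by (simp only:)
  qed
qed

text \<open>The second difference is symmetric in \<open>h\<close> and \<open>k\<close>, so its two leading terms agree.\<close>

lemma second_derivative_symmetric:
  fixes f :: "'a::real_normed_vector \<Rightarrow> 'b::real_normed_vector"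
  assumes S: "open S" "x0 \<in> S" and f': "\<And>x. x \<in> S \<Longrightarrow> (f has_derivative f' x) (at x)"
    and f'': "\<And>h. ((\<lambda>x. f' x h) has_derivative f'' h) (at x0)"
  shows "f'' h k = f'' k h"
proof (rule ccontr)
  assume ne: "f'' h k \<noteq> f'' k h"
  define N where "N = norm h + norm k"
  define \<delta> where "\<delta> = norm (f'' h k - f'' k h)"
  \<comment> \<open>Small enough that the two errors \<open>2 e N t\<^sup>2\<close> together stay below \<open>\<delta> t\<^sup>2\<close>.\<close>
  define e where "e = \<delta> / (8 * (N + 1))"
  have N: "N \<ge> 0" by (simp add: N_def)
  have \<delta>: "\<delta> > 0" using ne by (simp add: \<delta>_def)
  then have e: "e > 0" using N by (simp add: e_def)
  define E where "E h k t = f (x0 + t *\<^sub>R h + t *\<^sub>R k) - f (x0 + t *\<^sub>R h) - f (x0 + t *\<^sub>R k) + f x0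
    - t\<^sup>2 *\<^sub>R f'' h k" for h k t
  have "\<exists>d>0. \<forall>t. 0 < t \<and> t < d \<longrightarrow> norm (E h k t) \<le> e * t\<^sup>2 * (2 * N)"
    unfolding E_def N_def by (rule second_difference_estimate[OF S f' f'' e])
  then obtain d1 where d1: "d1 > 0" "\<And>t. 0 < t \<Longrightarrow> t < d1 \<Longrightarrow> norm (E h k t) \<le> e * t\<^sup>2 * (2 * N)"
    by auto
  have "\<exists>d>0. \<forall>t. 0 < t \<and> t < d \<longrightarrow> norm (E k h t) \<le> e * t\<^sup>2 * (2 * N)"
    unfolding E_def N_def add.commute[of "norm h"] by (rule second_difference_estimate[OF S f' f'' e])
  then obtain d2 where d2: "d2 > 0" "\<And>t. 0 < t \<Longrightarrow> t < d2 \<Longrightarrow> norm (E k h t) \<le> e * t\<^sup>2 * (2 * N)"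
    by auto
  define t where "t = min d1 d2 / 2"
  have t: "0 < t" "t < d1" "t < d2" using d1(1) d2(1) by (auto simp: t_def)
  have comm: "x0 + t *\<^sub>R k + t *\<^sub>R h = x0 + t *\<^sub>R h + t *\<^sub>R k" by (simp only: ac_simps)
  have "t\<^sup>2 *\<^sub>R (f'' h k - f'' k h) = E k h t - E h k t"
    unfolding E_def comm scaleR_diff_right by simp
  then have "norm (E k h t - E h k t) = norm (t\<^sup>2 *\<^sub>R (f'' h k - f'' k h))" by (simp only:)
  then have "t\<^sup>2 * \<delta> = norm (E k h t - E h k t)" by (simp only: \<delta>_def norm_scaleR abs_power2)
  also have "\<dots> \<le> e * t\<^sup>2 * (2 * N) + e * t\<^sup>2 * (2 * N)"
    using norm_triangle_ineq4[of "E k h t" "E h k t"] d1(2)[OF t(1,2)] d2(2)[OF t(1,3)] by linarith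
  also have "\<dots> = t\<^sup>2 * (e * (4 * N))" by simp
  finally have "\<delta> \<le> e * (4 * N)" using t(1) by (subst (asm) mult_le_cancel_left_pos) auto
  also have "\<dots> = \<delta> * (N / (2 * (N + 1)))" using N by (simp add: e_def field_simps)
  also have "\<dots> < \<delta> * 1" using N \<delta> by (intro mult_strict_left_mono) (auto simp: field_simps)
  finally show False by simp
qed

section \<open>Total differential equations\<close>

text \<open>The setting of the iteration, centred at \<open>0\<close>: \<open>F\<close> is \<open>C\<^sup>1\<close> on a ball times a ball, \<open>M\<close> and
  \<open>L\<close> bound \<open>F\<close> and its derivative, and the radius \<open>r\<close> is so small that the iteration stays in
  the box (\<open>r M \<le> \<rho>\<close>), contracts distances by \<open>1/4\<close> and halves the error of the derivative
  (\<open>4 L r \<le> 1\<close>).\<close>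

locale picard_box =
  fixes F :: "'a::euclidean_space \<times> 'b::euclidean_space \<Rightarrow> 'a \<Rightarrow>\<^sub>L 'b"
    and DF :: "'a \<times> 'b \<Rightarrow> ('a \<times> 'b) \<Rightarrow>\<^sub>L ('a \<Rightarrow>\<^sub>L 'b)"
    and r \<rho> M L :: real and y0 :: 'b
  assumes r_pos: "r > 0" and \<rho>_nonneg: "\<rho> \<ge> 0"
    and DF: "\<And>x y. x \<in> ball 0 r \<Longrightarrow> y \<in> cball y0 \<rho> \<Longrightarrow> (F has_derivative DF (x, y)) (at (x, y))"
    and cont_DF: "continuous_on (ball 0 r \<times> cball y0 \<rho>) DF"
    and sym: "\<And>x y h k. x \<in> ball 0 r \<Longrightarrow> y \<in> cball y0 \<rho> \<Longrightarrow>
      DF (x, y) (h, F (x, y) h) k = DF (x, y) (k, F (x, y) k) h"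
    and M: "\<And>x y. x \<in> ball 0 r \<Longrightarrow> y \<in> cball y0 \<rho> \<Longrightarrow> norm (F (x, y)) \<le> M"
    and L: "\<And>x y. x \<in> ball 0 r \<Longrightarrow> y \<in> cball y0 \<rho> \<Longrightarrow> norm (DF (x, y)) \<le> L"
    and rM: "r * M \<le> \<rho>" and rL: "4 * L * r \<le> 1"
begin

definition picard :: "('a \<Rightarrow> 'b) \<Rightarrow> 'a \<Rightarrow> 'b" where
  "picard y x = y0 + integral (cbox 0 1) (\<lambda>t. F (t *\<^sub>R x, y (t *\<^sub>R x)) x)"

text \<open>The derivative \<open>Y\<close> is continuous so that the next iterate can be differentiated under the
  integral.\<close>

definition approx_sol :: "real \<Rightarrow> ('a \<Rightarrow> 'b) \<Rightarrow> bool" where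
  "approx_sol e y \<longleftrightarrow> (\<exists>Y. continuous_on (ball 0 r) Y \<and> (\<forall>x\<in>ball 0 r. y x \<in> cball y0 \<rho> \<and>
     (y has_derivative blinfun_apply (Y x)) (at x) \<and> norm (Y x - F (x, y x)) \<le> e))"

lemma M_nonneg: "M \<ge> 0" and L_nonneg: "L \<ge> 0"
  using order_trans[OF norm_ge_zero M[of 0 y0]] order_trans[OF norm_ge_zero L[of 0 y0]] r_pos \<rho>_nonneg
  by auto

lemma ray_in_ball: "x \<in> ball 0 r \<Longrightarrow> 0 \<le> t \<Longrightarrow> t \<le> 1 \<Longrightarrow> t *\<^sub>R x \<in> ball (0::'a) r"
  using mult_right_mono[of t 1 "norm x"] by (simp add: dist_norm)

lemma cont_F: "continuous_on (ball 0 r \<times> cball y0 \<rho>) F"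
  using DF by (auto intro!: continuous_at_imp_continuous_on has_derivative_continuous)

lemma F_lipschitz:
  assumes "x \<in> ball 0 r" "y \<in> cball y0 \<rho>" "z \<in> cball y0 \<rho>"
  shows "norm (F (x, y) - F (x, z)) \<le> L * norm (y - z)"
proof (rule differentiable_bound[where S="cball y0 \<rho>" and f="\<lambda>y. F (x, y)" and f'="\<lambda>y k. DF (x, y) (0, k)"])
  fix y assume y: "y \<in> cball y0 \<rho>"
  have "((\<lambda>y. F (x, y)) has_derivative (\<lambda>k. DF (x, y) (0, k))) (at y)"
    by (rule has_derivative_compose[where f="\<lambda>y. (x, y)" and f'="\<lambda>k. (0, k)" and g=F])
      (auto intro!: derivative_eq_intros DF assms y)
  then show "((\<lambda>y. F (x, y)) has_derivative (\<lambda>k. DF (x, y) (0, k))) (at y within cball y0 \<rho>)"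
    by (rule has_derivative_at_withinI)
  have "norm (DF (x, y) (0, k)) \<le> L * norm k" for k
    using order_trans[OF norm_blinfun mult_right_mono[OF L[OF assms(1) y] norm_ge_zero], of "(0, k)"]
    by simp
  then show "onorm (\<lambda>k. DF (x, y) (0, k)) \<le> L" by (rule onorm_le)
qed (use assms in auto)

lemma cont_integrand:
  assumes "continuous_on (ball 0 r) y" "\<And>x. x \<in> ball 0 r \<Longrightarrow> y x \<in> cball y0 \<rho>" "x \<in> ball 0 r"
  shows "continuous_on (cbox 0 1) (\<lambda>t. F (t *\<^sub>R x, y (t *\<^sub>R x)) x)"
proof -
  have "continuous_on (cbox 0 1) (\<lambda>t. (t *\<^sub>R x, y (t *\<^sub>R x)))"
    by (intro continuous_intros continuous_on_compose2[OF assms(1)]) (use ray_in_ball assms(3) in auto)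
  then have "continuous_on (cbox 0 1) (\<lambda>t. F (t *\<^sub>R x, y (t *\<^sub>R x)))"
    by (rule continuous_on_compose2[OF cont_F]) (use ray_in_ball assms(2,3) in auto)
  then show ?thesis by (intro blinfun.continuous_on continuous_on_const)
qed

lemma picard_at_0: "picard y 0 = y0"
  by (simp add: picard_def blinfun.zero_right)

lemma picard_in_cball:
  assumes "continuous_on (ball 0 r) y" "\<And>x. x \<in> ball 0 r \<Longrightarrow> y x \<in> cball y0 \<rho>" "x \<in> ball 0 r"
  shows "picard y x \<in> cball y0 \<rho>"
proof -
  have "norm (integral (cbox 0 1) (\<lambda>t. F (t *\<^sub>R x, y (t *\<^sub>R x)) x)) \<le> (M * r) * Henstock_Kurzweil_Integration.content (cbox 0 (1::real))"
  proof (rule integrable_bound)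
    fix t :: real assume "t \<in> cbox 0 1"
    then have m: "t *\<^sub>R x \<in> ball 0 r" using ray_in_ball assms(3) by auto
    have "norm (F (t *\<^sub>R x, y (t *\<^sub>R x)) x) \<le> norm (F (t *\<^sub>R x, y (t *\<^sub>R x))) * norm x"
      by (rule norm_blinfun)
    also have "\<dots> \<le> M * r"
      using assms(3) M_nonneg by (intro mult_mono M m assms(2)) auto
    finally show "norm (F (t *\<^sub>R x, y (t *\<^sub>R x)) x) \<le> M * r" .
  qed (use M_nonneg r_pos integrable_continuous[OF cont_integrand[OF assms]] in auto)
  then show ?thesis using rM by (simp add: picard_def dist_norm mult.commute)
qed

lemma picard_contraction:
  assumes y: "continuous_on (ball 0 r) y" "\<And>x. x \<in> ball 0 r \<Longrightarrow> y x \<in> cball y0 \<rho>"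
    and z: "continuous_on (ball 0 r) z" "\<And>x. x \<in> ball 0 r \<Longrightarrow> z x \<in> cball y0 \<rho>"
    and d: "\<And>x. x \<in> ball 0 r \<Longrightarrow> norm (y x - z x) \<le> d" and x: "x \<in> ball 0 r"
  shows "norm (picard y x - picard z x) \<le> d / 4"
proof -
  have d0: "d \<ge> 0" using d[OF x] norm_ge_zero order_trans by blast
  note int = integrable_continuous[OF cont_integrand[OF y x]] integrable_continuous[OF cont_integrand[OF z x]]
  have "picard y x - picard z x =
      integral (cbox 0 1) (\<lambda>t. F (t *\<^sub>R x, y (t *\<^sub>R x)) x - F (t *\<^sub>R x, z (t *\<^sub>R x)) x)"
    by (simp only: picard_def add_diff_cancel_left Henstock_Kurzweil_Integration.integral_diff[OF int])
  also have "norm \<dots> \<le> (L * d * r) * Henstock_Kurzweil_Integration.content (cbox 0 (1::real))"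
  proof (rule integrable_bound)
    fix t :: real assume "t \<in> cbox 0 1"
    then have m: "t *\<^sub>R x \<in> ball 0 r" using ray_in_ball x by auto
    have "norm (F (t *\<^sub>R x, y (t *\<^sub>R x)) x - F (t *\<^sub>R x, z (t *\<^sub>R x)) x)
        \<le> norm (F (t *\<^sub>R x, y (t *\<^sub>R x)) - F (t *\<^sub>R x, z (t *\<^sub>R x))) * norm x"
      using norm_blinfun by (simp only: blinfun.diff_left[symmetric])
    also have "\<dots> \<le> (L * d) * r"
      using x L_nonneg d0 order_trans[OF F_lipschitz[OF m y(2)[OF m] z(2)[OF m]] mult_left_mono[OF d[OF m] L_nonneg]]
      by (intro mult_mono) auto
    finally show "norm (F (t *\<^sub>R x, y (t *\<^sub>R x)) x - F (t *\<^sub>R x, z (t *\<^sub>R x)) x) \<le> L * d * r" .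
  qed (use d0 L_nonneg r_pos integrable_diff[OF int] in auto)
  also have "\<dots> \<le> d / 4" using mult_left_mono[OF rL d0] by (simp add: mult.commute mult.left_commute)
  finally show ?thesis .
qed

text \<open>The heart of the Frobenius theorem.  With \<open>E(x) = Dy(x) - F(x, y x)\<close>, differentiating under
  the integral gives the derivative of the new iterate in the direction \<open>h\<close> as the integral of
  \<open>t DF(h, F h + E h) x + F h\<close>, taken at \<open>(t x, y(t x))\<close>, while \<open>F(x, y x) h\<close> is the integral of
  \<open>d/dt (t F h) = F h + t DF(x, F x + E x) h\<close>.  By the integrability condition the terms without
  \<open>E\<close> cancel in the difference, which leaves \<open>t (DF(0, E h) x - DF(0, E x) h)\<close>, of norm at most
  \<open>2 L e r |h|\<close>.\<close>

lemma picard_derivative: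
  assumes contY: "continuous_on (ball 0 r) Y" and y_in: "\<And>x. x \<in> ball 0 r \<Longrightarrow> y x \<in> cball y0 \<rho>"
    and Y: "\<And>x. x \<in> ball 0 r \<Longrightarrow> (y has_derivative blinfun_apply (Y x)) (at x)"
    and e: "\<And>x. x \<in> ball 0 r \<Longrightarrow> norm (Y x - F (x, y x)) \<le> e"
  shows "\<exists>Z. continuous_on (ball 0 r) Z \<and> (\<forall>x\<in>ball 0 r.
    (picard y has_derivative blinfun_apply (Z x)) (at x) \<and> norm (Z x - F (x, y x)) \<le> e / 2)"
proof -
  let ?B = "ball (0::'a) r"
  let ?p = "\<lambda>x t. (t *\<^sub>R x, y (t *\<^sub>R x))"
  have conty: "continuous_on ?B y"
    using Y by (intro continuous_at_imp_continuous_on ballI) (rule has_derivative_continuous)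
  have e0: "e \<ge> 0" using order_trans[OF norm_ge_zero e[of 0]] r_pos by simp
  define G where "G x t h = t *\<^sub>R DF (?p x t) (h, Y (t *\<^sub>R x) h) x + F (?p x t) h" for x t h
  have pair_scaleR: "(c *\<^sub>R v, c *\<^sub>R w) = c *\<^sub>R (v, w)" for c :: real and v :: 'a and w :: 'b
    by simp
  define g where "g x t = Blinfun (G x t)" for x t
  have "bounded_linear (G x t)" for x t
    unfolding G_def
    by (intro bounded_linear_add bounded_linear_const_scaleR blinfun.bounded_linear_right
        bounded_linear_compose[OF bounded_linear_compose[OF blinfun.bounded_linear_left
            blinfun.bounded_linear_right] bounded_linear_Pair[OF bounded_linear_ident blinfun.bounded_linear_right]])
  then have g: "blinfun_apply (g x t) = G x t" for x t
    unfolding g_def by (rule bounded_linear_Blinfun_apply)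
  have ray: "t *\<^sub>R x \<in> ?B" "?p x t \<in> ?B \<times> cball y0 \<rho>" if "x \<in> ?B" "t \<in> cbox 0 1" for x t
    using ray_in_ball[of x t] that y_in by auto
  have cont_g: "continuous_on (?B \<times> cbox 0 1) (\<lambda>(x, t). g x t)"
  proof -
    have s: "continuous_on (?B \<times> cbox 0 1) (\<lambda>q. snd q *\<^sub>R fst q)" by (intro continuous_intros)
    have s': "(\<lambda>q. snd q *\<^sub>R fst q) ` (?B \<times> cbox 0 1) \<subseteq> ?B" using ray(1) by auto
    have p: "continuous_on (?B \<times> cbox 0 1) (\<lambda>q. ?p (fst q) (snd q))"
      by (intro continuous_on_Pair s continuous_on_compose2[OF conty s s'])
    have p': "(\<lambda>q. ?p (fst q) (snd q)) ` (?B \<times> cbox 0 1) \<subseteq> ?B \<times> cball y0 \<rho>" using ray(2) by auto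
    have "continuous_on (?B \<times> cbox 0 1) (\<lambda>q. G (fst q) (snd q) i)" for i
      unfolding G_def
      by (intro continuous_on_add continuous_on_scaleR continuous_on_snd continuous_on_fst continuous_on_id
          blinfun.continuous_on continuous_on_Pair continuous_on_const
          continuous_on_compose2[OF cont_DF p p'] continuous_on_compose2[OF cont_F p p']
          continuous_on_compose2[OF contY s s'])
    then show ?thesis
      by (intro continuous_on_blinfun_componentwise) (simp add: case_prod_beta g)
  qed
  define Z where "Z x = integral (cbox 0 1) (g x)" for x
  have contZ: "continuous_on ?B Z"
    unfolding Z_def by (rule integral_continuous_on_param[OF cont_g])
  have der: "(picard y has_derivative blinfun_apply (Z x)) (at x)" if x: "x \<in> ?B" for x
  proof -
    have "((\<lambda>x. integral (cbox 0 1) (\<lambda>t. F (?p x t) x)) has_derivative blinfun_apply (Z x)) (at x within ?B)"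
      unfolding Z_def
    proof (rule leibniz_rule[where f="\<lambda>x t. F (?p x t) x" and fx=g, OF _ _ cont_g x convex_ball])
      fix x :: 'a and t :: real assume x: "x \<in> ?B" and t: "t \<in> cbox 0 1"
      have s: "((\<lambda>x. t *\<^sub>R x) has_derivative (\<lambda>h. t *\<^sub>R h)) (at x)"
        by (auto intro!: derivative_eq_intros)
      have "((\<lambda>x. F (?p x t)) has_derivative (\<lambda>h. DF (?p x t) (t *\<^sub>R h, Y (t *\<^sub>R x) (t *\<^sub>R h)))) (at x)"
        using has_derivative_compose[OF has_derivative_Pair[OF s
              has_derivative_compose[OF s Y[OF ray(1)[OF x t]]]] DF] ray[OF x t] by auto
      from blinfun.FDERIV[OF this has_derivative_ident]
      have "((\<lambda>x. F (?p x t) x) has_derivative G x t) (at x)"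
        by (rule has_derivative_eq_rhs)
          (simp add: G_def fun_eq_iff pair_scaleR blinfun.scaleR_right blinfun.scaleR_left add.commute
            del: scaleR_Pair)
      then show "((\<lambda>x. F (?p x t) x) has_derivative blinfun_apply (g x t)) (at x within ?B)"
        unfolding g by (rule has_derivative_at_withinI)
    next
      fix x assume "x \<in> ?B"
      then show "(\<lambda>t. F (?p x t) x) integrable_on cbox 0 1"
        using integrable_continuous[OF cont_integrand[OF conty y_in, of x]] by simp
    qed
    then have "((\<lambda>x. integral (cbox 0 1) (\<lambda>t. F (?p x t) x)) has_derivative blinfun_apply (Z x)) (at x)"
      using x by (simp add: at_within_open[OF _ open_ball])
    then show ?thesis
      unfolding picard_def[abs_def]
      by (auto intro!: derivative_eq_intros)
  qed
  have "norm (Z x - F (x, y x)) \<le> e / 2" if x: "x \<in> ?B" for x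
  proof (rule norm_blinfun_bound)
    fix h
    define H where "H t = F (?p x t) h + t *\<^sub>R DF (?p x t) (x, Y (t *\<^sub>R x) x) h" for t
    have Zh: "((\<lambda>t. G x t h) has_integral Z x h) (cbox 0 1)"
    proof -
      have "continuous_on (cbox 0 1) (g x)"
      proof -
        have "continuous_on (cbox 0 1) (\<lambda>t::real. (x, t))"
          by (intro continuous_on_Pair continuous_on_const continuous_on_id)
        from continuous_on_compose2[OF cont_g this] show ?thesis using x by (simp add: image_subset_iff)
      qed
      then have "(g x has_integral Z x) (cbox 0 1)"
        unfolding Z_def by (intro integrable_integral integrable_continuous)
      from has_integral_linear[OF this blinfun.bounded_linear_left[of h]]
      show ?thesis by (simp add: o_def g)
    qed
    have Fh: "(H has_integral F (x, y x) h) (cbox 0 1)"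
    proof -
      have "((\<lambda>t. t *\<^sub>R F (?p x t) h) has_vector_derivative H t) (at t within {0..1})" if t: "t \<in> {0..1}" for t
      proof -
        have t': "t \<in> cbox 0 1" using t by simp
        have s: "((\<lambda>t. t *\<^sub>R x) has_derivative (\<lambda>u. u *\<^sub>R x)) (at t)"
          by (auto intro!: derivative_eq_intros)
        have "((\<lambda>t. F (?p x t)) has_derivative (\<lambda>u. DF (?p x t) (u *\<^sub>R x, Y (t *\<^sub>R x) (u *\<^sub>R x)))) (at t)"
          using has_derivative_compose[OF has_derivative_Pair[OF s
              has_derivative_compose[OF s Y[OF ray(1)[OF x t']]]] DF] ray[OF x t'] by auto
        from has_derivative_scaleR[OF has_derivative_ident blinfun.FDERIV[OF this has_derivative_const[of h]]]
        have "((\<lambda>t. t *\<^sub>R F (?p x t) h) has_derivative (\<lambda>u. u *\<^sub>R H t)) (at t)"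
          by (rule has_derivative_eq_rhs)
            (simp add: H_def fun_eq_iff pair_scaleR blinfun.scaleR_right blinfun.scaleR_left
              blinfun.zero_right scaleR_add_right add.commute mult.commute del: scaleR_Pair)
        then show ?thesis unfolding has_vector_derivative_def by (rule has_derivative_at_withinI)
      qed
      from fundamental_theorem_of_calculus[OF _ this] show ?thesis by simp
    qed
    have "norm (Z x h - F (x, y x) h) \<le> (e / 2 * norm h) * Henstock_Kurzweil_Integration.content (cbox 0 (1::real))"
    proof (rule has_integral_bound[OF _ has_integral_diff[OF Zh Fh]])
      fix t :: real assume t: "t \<in> cbox 0 1"
      let ?A = "DF (?p x t)" and ?E = "Y (t *\<^sub>R x) - F (?p x t)"
      have E: "norm (?E v) \<le> e * norm v" for v
        using order_trans[OF norm_blinfun mult_right_mono[OF e[OF ray(1)[OF x t]] norm_ge_zero]] .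
      have A: "norm (?A (0, ?E v) u) \<le> L * (e * norm v) * norm u" for u v
      proof -
        have "norm (?A (0, ?E v)) \<le> L * norm (?E v)"
          using order_trans[OF norm_blinfun mult_right_mono[OF L norm_ge_zero], of "t *\<^sub>R x" "y (t *\<^sub>R x)" "(0, ?E v)"]
            ray[OF x t] by simp
        also have "\<dots> \<le> L * (e * norm v)" by (rule mult_left_mono[OF E L_nonneg])
        finally show ?thesis by (rule order_trans[OF norm_blinfun mult_right_mono[OF _ norm_ge_zero]])
      qed
      have split: "(v, Y (t *\<^sub>R x) v) = (v, F (?p x t) v) + (0, ?E v)" for v
        by (simp add: blinfun.diff_left)
      have "G x t h - H t = t *\<^sub>R (?A (h, Y (t *\<^sub>R x) h) x - ?A (x, Y (t *\<^sub>R x) x) h)"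
        by (simp add: G_def H_def scaleR_diff_right)
      also have "\<dots> = t *\<^sub>R (?A (0, ?E h) x - ?A (0, ?E x) h)"
        using ray(2)[OF x t] sym[of "t *\<^sub>R x" "y (t *\<^sub>R x)" h x]
        by (simp only: split[of h] split[of x] blinfun.add_right blinfun.add_left mem_Sigma_iff simp_thms
            add_diff_cancel_left)
      also have "norm \<dots> \<le> 1 * (2 * (L * e * r * norm h))"
        unfolding norm_scaleR
      proof (rule mult_mono)
        have Lx: "L * (e * norm h) * norm x \<le> L * (e * norm h) * r"
          using x L_nonneg e0 by (intro mult_left_mono mult_nonneg_nonneg) (simp_all add: less_imp_le)
        have "norm (?A (0, ?E h) x) \<le> L * (e * norm h) * r"
          by (rule order_trans[OF A Lx])
        moreover have "norm (?A (0, ?E x) h) \<le> L * (e * norm h) * r"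
          using order_trans[OF A[of x h], of "L * (e * norm h) * r"] Lx by (simp only: ac_simps)
        ultimately show "norm (?A (0, ?E h) x - ?A (0, ?E x) h) \<le> 2 * (L * e * r * norm h)"
          using norm_triangle_ineq4[of "?A (0, ?E h) x" "?A (0, ?E x) h"] by (simp only: ac_simps)
        show "\<bar>t\<bar> \<le> 1" using t by simp
      qed simp_all
      also have "\<dots> = (4 * L * r) * (e / 2 * norm h)" by simp
      also have "\<dots> \<le> 1 * (e / 2 * norm h)" by (rule mult_right_mono[OF rL]) (use e0 in simp)
      also have "\<dots> = e / 2 * norm h" by (rule mult_1)
      finally show "norm (G x t h - H t) \<le> e / 2 * norm h" .
    qed (use e0 in simp)
    then show "norm ((Z x - F (x, y x)) h) \<le> e / 2 * norm h" by (simp add: blinfun.diff_left)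
  qed (use e0 in simp)
  with contZ der show ?thesis by (intro exI[of _ Z] conjI ballI)
qed

text \<open>Replacing \<open>F(x, y x)\<close> by its value at the new iterate costs \<open>L\<close> times the distance of the
  two iterates.\<close>

lemma approx_sol_picard:
  assumes "approx_sol e y" and d: "\<And>x. x \<in> ball 0 r \<Longrightarrow> norm (picard y x - y x) \<le> d"
  shows "approx_sol (e / 2 + L * d) (picard y)"
proof -
  obtain Y where contY: "continuous_on (ball 0 r) Y" and y_in: "\<And>x. x \<in> ball 0 r \<Longrightarrow> y x \<in> cball y0 \<rho>"
    and Y: "\<And>x. x \<in> ball 0 r \<Longrightarrow> (y has_derivative blinfun_apply (Y x)) (at x)"
    and e: "\<And>x. x \<in> ball 0 r \<Longrightarrow> norm (Y x - F (x, y x)) \<le> e"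
    using assms(1) unfolding approx_sol_def by auto
  have conty: "continuous_on (ball 0 r) y"
    using Y by (intro continuous_at_imp_continuous_on ballI) (rule has_derivative_continuous)
  obtain Z where Z: "continuous_on (ball 0 r) Z"
      "\<And>x. x \<in> ball 0 r \<Longrightarrow> (picard y has_derivative blinfun_apply (Z x)) (at x)"
      "\<And>x. x \<in> ball 0 r \<Longrightarrow> norm (Z x - F (x, y x)) \<le> e / 2"
    using picard_derivative[OF contY y_in Y e] by auto
  have "norm (Z x - F (x, picard y x)) \<le> e / 2 + L * d" if x: "x \<in> ball 0 r" for x
  proof -
    have "norm (F (x, picard y x) - F (x, y x)) \<le> L * norm (picard y x - y x)"
      by (rule F_lipschitz[OF x picard_in_cball[OF conty y_in x] y_in[OF x]])
    also have "\<dots> \<le> L * d" by (rule mult_left_mono[OF d[OF x] L_nonneg])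
    finally have "norm (F (x, picard y x) - F (x, y x)) \<le> L * d" .
    then show ?thesis
      using Z(3)[OF x] norm_triangle_ineq4[of "Z x - F (x, y x)" "F (x, picard y x) - F (x, y x)"]
      by simp
  qed
  with Z(1,2) picard_in_cball[OF conty y_in] show ?thesis unfolding approx_sol_def by auto
qed

text \<open>The distance of consecutive iterates decreases like \<open>4\<^sup>-\<^sup>n\<close> and the error of the derivative
  like \<open>(3/4)\<^sup>n\<close>, so iterates and derivatives converge uniformly.\<close>

lemma exists_solution:
  "\<exists>y. y 0 = y0 \<and> (\<forall>x\<in>ball 0 r. y x \<in> cball y0 \<rho> \<and>
     (y has_derivative blinfun_apply (F (x, y x))) (at x))"
proof -
  let ?B = "ball (0::'a) r"
  define y where "y n = (picard ^^ n) (\<lambda>_. y0)" for n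
  have y_Suc: "y (Suc n) = picard (y n)" for n by (simp add: y_def)
  have y_0: "y 0 x = y0" for x by (simp add: y_def)
  \<comment> \<open>\<open>M\<close> bounds the error of the constant map; the second term absorbs the change of the iterates.\<close>
  define K where "K = M + 4 * L * \<rho>"
  have K: "K \<ge> M" "K / 4 \<ge> L * \<rho>" using M_nonneg L_nonneg \<rho>_nonneg by (simp_all add: K_def)
  have cont_in: "continuous_on ?B z \<and> (\<forall>x\<in>?B. z x \<in> cball y0 \<rho>)" if "approx_sol e z" for e z
    using that unfolding approx_sol_def
    by (auto intro!: continuous_at_imp_continuous_on has_derivative_continuous)
  have inv: "approx_sol (K * (3/4) ^ n) (y n) \<and> (\<forall>x\<in>?B. norm (y (Suc n) x - y n x) \<le> \<rho> * (1/4) ^ n)" for n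
  proof (induction n)
    case 0
    have "norm (0 - F (x, y0)) \<le> K" if "x \<in> ?B" for x
      using M[OF that, of y0] \<rho>_nonneg K by simp
    then have "approx_sol K (y 0)"
      unfolding approx_sol_def y_def using \<rho>_nonneg
      by (intro exI[of _ "\<lambda>_. 0"]) (auto simp: zero_blinfun.rep_eq)
    moreover have "norm (y (Suc 0) x - y 0 x) \<le> \<rho>" if "x \<in> ?B" for x
    proof -
      have "picard (y 0) x \<in> cball y0 \<rho>"
        using cont_in[OF \<open>approx_sol K (y 0)\<close>] that by (intro picard_in_cball) blast+
      then show ?thesis by (simp add: y_def dist_norm norm_minus_commute)
    qed
    ultimately show ?case by simp
  next
    case (Suc n)
    have d: "norm (picard (y n) x - y n x) \<le> \<rho> * (1/4) ^ n" if "x \<in> ?B" for x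
      using Suc that by (simp add: y_Suc)
    have "approx_sol (K * (3/4) ^ n / 2 + L * (\<rho> * (1/4) ^ n)) (y (Suc n))"
      using approx_sol_picard[OF _ d] Suc by (simp add: y_Suc)
    moreover have "K * (3/4) ^ n / 2 + L * (\<rho> * (1/4) ^ n) \<le> K * (3/4) ^ Suc n"
    proof -
      have "L * \<rho> * (1/4) ^ n \<le> K / 4 * (3/4) ^ n"
        using K M_nonneg L_nonneg \<rho>_nonneg by (intro mult_mono power_mono) auto
      then show ?thesis by simp
    qed
    ultimately have a: "approx_sol (K * (3/4) ^ Suc n) (y (Suc n))"
      unfolding approx_sol_def by (meson order_trans)
    have "norm (y (Suc (Suc n)) x - y (Suc n) x) \<le> \<rho> * (1/4) ^ Suc n" if x: "x \<in> ?B" for x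
    proof -
      have "norm (picard (y (Suc n)) x - picard (y n) x) \<le> (\<rho> * (1/4) ^ n) / 4"
        using cont_in[OF a] cont_in Suc x by (intro picard_contraction) auto
      then show ?thesis by (simp add: y_Suc)
    qed
    with a show ?case by blast
  qed
  define s where "s x = y0 + (\<Sum>i. y (Suc i) x - y i x)" for x
  have "uniform_limit ?B (\<lambda>n x. \<Sum>i<n. y (Suc i) x - y i x) (\<lambda>x. \<Sum>i. y (Suc i) x - y i x) sequentially"
  proof (rule Weierstrass_m_test)
    show "summable (\<lambda>n. \<rho> * (1/4) ^ n)" by (intro summable_mult summable_geometric) simp
  qed (use inv in auto)
  moreover have "(\<Sum>i<n. y (Suc i) x - y i x) = y n x - y0" for n x
    by (induction n) (simp_all add: y_0)
  ultimately have ul: "uniform_limit ?B y s sequentially"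
    unfolding uniform_limit_iff dist_norm s_def by (simp add: diff_diff_eq)
  have y_in: "y n x \<in> cball y0 \<rho>" if "x \<in> ?B" for n x
    using cont_in inv that by blast
  have lim: "(\<lambda>n. y n x) \<longlonglongrightarrow> s x" if "x \<in> ?B" for x
    by (rule tendsto_uniform_limitI[OF ul that])
  have s_in: "s x \<in> cball y0 \<rho>" if "x \<in> ?B" for x
    using Lim_in_closed_set[OF closed_cball _ _ lim[OF that]] y_in[OF that] by auto
  have "\<forall>n. \<exists>Y. \<forall>x\<in>?B. (y n has_derivative blinfun_apply (Y x)) (at x) \<and>
      norm (Y x - F (x, y n x)) \<le> K * (3/4) ^ n"
    using inv unfolding approx_sol_def by blast
  from choice[OF this] obtain Y where Y: "\<And>n x. x \<in> ?B \<Longrightarrow> (y n has_derivative blinfun_apply (Y n x)) (at x)"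
      "\<And>n x. x \<in> ?B \<Longrightarrow> norm (Y n x - F (x, y n x)) \<le> K * (3/4) ^ n" by blast
  have "\<exists>g. \<forall>x\<in>?B. (\<lambda>n. y n x) \<longlonglongrightarrow> g x \<and> (g has_derivative blinfun_apply (F (x, s x))) (at x within ?B)"
  proof (rule has_derivative_sequence[where f'="\<lambda>n x. blinfun_apply (Y n x)"])
    fix e :: real assume e: "e > 0"
    have "(\<lambda>n. K * (3/4) ^ n) \<longlonglongrightarrow> K * 0" by (intro tendsto_mult tendsto_const LIMSEQ_power_zero) simp
    then have "\<forall>\<^sub>F n in sequentially. K * (3/4) ^ n < e / 2" using e by (intro order_tendstoD(2)) auto
    moreover have "\<forall>\<^sub>F n in sequentially. \<forall>x\<in>?B. dist (y n x) (s x) < e / (2 * (L + 1))"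
      using ul e L_nonneg unfolding uniform_limit_iff by simp
    ultimately show "\<forall>\<^sub>F n in sequentially. \<forall>x\<in>?B. \<forall>h. norm (Y n x h - F (x, s x) h) \<le> e * norm h"
    proof eventually_elim
      case (elim n)
      show ?case
      proof (intro ballI allI)
        fix x h assume x: "x \<in> ?B"
        have "L * norm (y n x - s x) \<le> (L + 1) * (e / (2 * (L + 1)))"
          using elim(2) x L_nonneg e by (intro mult_mono) (auto simp: dist_norm less_imp_le)
        moreover have "(L + 1) * (e / (2 * (L + 1))) = e / 2" using L_nonneg by (simp add: field_simps)
        ultimately have "norm (F (x, y n x) - F (x, s x)) \<le> e / 2"
          using F_lipschitz[OF x y_in[OF x, of n] s_in[OF x]] by linarith
        then have "norm (Y n x - F (x, s x)) \<le> e"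
          using Y(2)[OF x, of n] elim(1)
            norm_triangle_ineq[of "Y n x - F (x, y n x)" "F (x, y n x) - F (x, s x)"] by simp
        then show "norm (Y n x h - F (x, s x) h) \<le> e * norm h"
          using order_trans[OF norm_blinfun mult_right_mono[OF _ norm_ge_zero]]
          by (simp only: blinfun.diff_left[symmetric])
      qed
    qed
  next
    show "0 \<in> ?B" using r_pos by simp
    from lim[OF this] show "(\<lambda>n. y n 0) \<longlonglongrightarrow> s 0" .
  qed (use Y(1) in \<open>auto intro: has_derivative_at_withinI\<close>)
  then obtain g where g: "\<And>x. x \<in> ?B \<Longrightarrow> (\<lambda>n. y n x) \<longlonglongrightarrow> g x"
      "\<And>x. x \<in> ?B \<Longrightarrow> (g has_derivative blinfun_apply (F (x, s x))) (at x within ?B)" by blast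
  have gs: "g x = s x" if "x \<in> ?B" for x using LIMSEQ_unique[OF g(1) lim] that by blast
  have der: "(s has_derivative blinfun_apply (F (x, s x))) (at x)" if "x \<in> ?B" for x
  proof (rule has_derivative_transform_within_open[OF _ open_ball that gs])
    show "(g has_derivative blinfun_apply (F (x, s x))) (at x)"
      using g(2)[OF that] that by (simp add: at_within_open[OF _ open_ball])
  qed
  have "y n 0 = y0" for n by (cases n) (simp_all add: y_def picard_at_0)
  then have "s 0 = y0" using LIMSEQ_unique[OF lim[of 0], of y0] r_pos by simp
  with s_in der show ?thesis by (intro exI[of _ s] conjI ballI)
qed

end

lemma open_contains_cball_Times:
  assumes "open O'" "(x0, y0) \<in> O'"
  obtains r \<rho> where "r > 0" "\<rho> > 0" "cball x0 r \<times> cball y0 \<rho> \<subseteq> O'"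
proof -
  obtain U V where "open U" "open V" "(x0, y0) \<in> U \<times> V" and UV: "U \<times> V \<subseteq> O'"
    by (rule open_prod_elim[OF assms])
  then obtain r \<rho> where r: "r > 0" "cball x0 r \<subseteq> U" and \<rho>: "\<rho> > 0" "cball y0 \<rho> \<subseteq> V"
    unfolding open_contains_cball mem_Times_iff fst_conv snd_conv by blast
  show ?thesis by (rule that[OF r(1) \<rho>(1) order_trans[OF Sigma_mono[OF r(2) \<rho>(2)] UV]])
qed

lemma blinfun_frechet_derivative:
  fixes F :: "'a::euclidean_space \<Rightarrow> 'b::real_normed_vector"
  assumes F: "smooth_on S F"
  obtains DF :: "'a \<Rightarrow> 'a \<Rightarrow>\<^sub>L 'b" where "continuous_on S DF"
    "\<And>p. p \<in> S \<Longrightarrow> blinfun_apply (DF p) = fderiv F p"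
proof
  let ?DF = "\<lambda>p. Blinfun (fderiv F p)"
  show DF: "blinfun_apply (?DF p) = fderiv F p" if "p \<in> S" for p
    by (rule bounded_linear_Blinfun_apply[OF has_derivative_bounded_linear[OF smooth_on_has_derivative[OF F that]]])
  show "continuous_on S ?DF"
  proof (rule continuous_on_blinfun_componentwise)
    fix i
    show "continuous_on S (\<lambda>p. ?DF p i)"
      using smooth_on_imp_continuous_on[OF smooth_on_frechet_derivative[OF F, of i]]
      by (simp add: DF cong: continuous_on_cong)
  qed
qed

text \<open>Translate the base point to \<open>0\<close> and choose a compact box around the initial value, on which
  \<open>F\<close> and its derivative are bounded; a small radius then satisfies the requirements of the
  iteration.\<close>

theorem frobenius_exists:
  fixes F :: "'a::euclidean_space \<times> 'b::euclidean_space \<Rightarrow> 'a \<Rightarrow>\<^sub>L 'b"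
  assumes O: "open O'" "(x0, y0) \<in> O'" and F: "smooth_on O' F"
    and sym: "\<And>x y h k. (x, y) \<in> O' \<Longrightarrow>
      fderiv F (x, y) (h, F (x, y) h) k = fderiv F (x, y) (k, F (x, y) k) h"
  shows "\<exists>r>0. \<exists>y. y x0 = y0 \<and> (\<forall>x\<in>ball x0 r. (x, y x) \<in> O' \<and>
     (y has_derivative blinfun_apply (F (x, y x))) (at x))"
proof -
  obtain r1 \<rho> where r1: "r1 > 0" and \<rho>: "\<rho> > 0" and box: "cball x0 r1 \<times> cball (y0) \<rho> \<subseteq> O'"
    by (rule open_contains_cball_Times[OF O])
  define T :: "'a \<times> 'b \<Rightarrow> 'a \<times> 'b" where "T p = (x0 + fst p, snd p)" for p
  define C where "C = cball (0::'a) r1 \<times> cball y0 \<rho>"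
  have T_in: "T p \<in> O'" if "p \<in> C" for p
  proof -
    have "x0 + fst p \<in> cball x0 r1" "snd p \<in> cball y0 \<rho>" using that by (auto simp: C_def dist_norm)
    then show ?thesis using box unfolding T_def by blast
  qed
  have cont_T: "continuous_on C T" unfolding T_def by (intro continuous_intros)
  have T_der: "(T has_derivative (\<lambda>h. h)) (at p)" for p
    unfolding T_def by (auto intro!: derivative_eq_intros)
  have F_der: "(F has_derivative fderiv F p) (at p)" if "p \<in> O'" for p
    using smooth_on_has_derivative[OF F that] .
  obtain DF0 where DF0: "continuous_on O' DF0"
    "\<And>p. p \<in> O' \<Longrightarrow> blinfun_apply (DF0 p) = fderiv F p"
    by (rule blinfun_frechet_derivative[OF F]) (rule that)
  define DF where "DF p = DF0 (T p)" for p
  have DF: "blinfun_apply (DF p) = fderiv F (T p)" if "p \<in> C" for p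
    unfolding DF_def by (rule DF0(2)[OF T_in[OF that]])
  have cont_DF: "continuous_on C DF"
    unfolding DF_def by (rule continuous_on_compose2[OF DF0(1) cont_T]) (use T_in in auto)
  have cont_FT: "continuous_on C (\<lambda>p. F (T p))"
    by (rule continuous_on_compose2[OF smooth_on_imp_continuous_on[OF F] cont_T]) (use T_in in auto)
  have comp: "compact C" unfolding C_def by (intro compact_Times compact_cball)
  have bdd: "\<exists>b>0. \<forall>p\<in>C. norm (f p) \<le> b" if "continuous_on C f" for f :: "_ \<Rightarrow> 'e::real_normed_vector"
    using compact_imp_bounded[OF compact_continuous_image[OF that comp]] by (auto simp: bounded_pos)
  obtain M where M: "M > 0" "\<And>p. p \<in> C \<Longrightarrow> norm (F (T p)) \<le> M" using bdd[OF cont_FT] by blast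
  obtain L where L: "L > 0" "\<And>p. p \<in> C \<Longrightarrow> norm (DF p) \<le> L" using bdd[OF cont_DF] by blast
  define r where "r = min r1 (min (\<rho> / M) (1 / (4 * L)))"
  have r: "r > 0" "r \<le> r1" "r \<le> \<rho> / M" "r \<le> 1 / (4 * L)" using r1 \<rho> M L by (auto simp: r_def)
  have in_C: "(x, y) \<in> C" if "x \<in> ball 0 r" "y \<in> cball y0 \<rho>" for x y
    using that r(2) by (auto simp: C_def)
  interpret picard_box "\<lambda>p. F (T p)" DF r \<rho> M L y0
  proof
    fix x :: 'a and y :: 'b assume "x \<in> ball 0 r" "y \<in> cball y0 \<rho>"
    note b = in_C[OF this]
    have "((\<lambda>p. F (T p)) has_derivative (\<lambda>h. fderiv F (T (x, y)) h)) (at (x, y))"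
      by (rule has_derivative_compose[OF T_der F_der[OF T_in[OF b]]])
    then show "((\<lambda>p. F (T p)) has_derivative DF (x, y)) (at (x, y))" by (simp add: DF[OF b])
    show "DF (x, y) (h, F (T (x, y)) h) k = DF (x, y) (k, F (T (x, y)) k) h" for h k
      using sym T_in[OF b] unfolding DF[OF b] T_def by simp
    show "norm (F (T (x, y))) \<le> M" "norm (DF (x, y)) \<le> L" using M(2) L(2) b by blast+
  next
    show "continuous_on (ball 0 r \<times> cball y0 \<rho>) DF"
      using continuous_on_subset[OF cont_DF] in_C by (simp add: subset_iff)
    show "r * M \<le> \<rho>" "4 * L * r \<le> 1" using r(3,4) M(1) L(1) by (simp_all add: field_simps)
  qed (use r \<rho> in auto)
  obtain y where y: "y 0 = y0" "\<And>x. x \<in> ball 0 r \<Longrightarrow> y x \<in> cball y0 \<rho>"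
      "\<And>x. x \<in> ball 0 r \<Longrightarrow> (y has_derivative blinfun_apply (F (T (x, y x)))) (at x)"
    using exists_solution by auto
  show ?thesis
  proof (intro exI[of _ r] conjI exI[of _ "\<lambda>x. y (x - x0)"] ballI)
    fix x assume "x \<in> ball x0 r"
    then have m: "x - x0 \<in> ball 0 r" by (simp add: dist_norm norm_minus_commute)
    show "(x, y (x - x0)) \<in> O'" using T_in[OF in_C[OF m y(2)[OF m]]] by (simp add: T_def)
    have "((\<lambda>x. x - x0) has_derivative (\<lambda>h. h)) (at x)" by (auto intro!: derivative_eq_intros)
    from has_derivative_compose[OF this y(3)[OF m]]
    show "((\<lambda>x. y (x - x0)) has_derivative blinfun_apply (F (x, y (x - x0)))) (at x)"
      by (simp add: T_def)
  qed (use r y(1) in auto)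
qed

text \<open>If \<open>y\<close> is \<open>C\<^sup>k\<close>, so is its derivative \<open>F(x, y x)\<close>, and hence \<open>y\<close> is \<open>C\<^sup>k\<^sup>+\<^sup>1\<close>.\<close>

lemma total_differential_smooth:
  fixes F :: "'a::euclidean_space \<times> 'b::euclidean_space \<Rightarrow> 'a \<Rightarrow>\<^sub>L 'b"
  assumes S: "open S" and F: "smooth_on O' F" and in_O: "\<And>x. x \<in> S \<Longrightarrow> (x, y x) \<in> O'"
    and der: "\<And>x. x \<in> S \<Longrightarrow> (y has_derivative blinfun_apply (F (x, y x))) (at x)"
  shows "smooth_on S y"
  unfolding smooth_on_def
proof
  fix k show "Ck_on k S y"
  proof (induction k)
    case 0
    show ?case using der by (auto intro!: continuous_at_imp_continuous_on has_derivative_continuous)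
  next
    case (Suc k)
    have "Ck_on k S (\<lambda>x. F (x, y x))"
      by (rule Ck_on_compose[OF S Ck_on_Pair[OF S Ck_on_id[OF S] Suc]])
        (use F in_O in \<open>auto simp: smooth_on_def\<close>)
    then have "Ck_on k S (\<lambda>x. F (x, y x) v)" for v
      by (rule Ck_on_linear[OF blinfun.bounded_linear_left S])
    then show ?case by (rule Ck_on_SucI[OF S, rotated]) (rule der)
  qed
qed

text \<open>Near \<open>x\<^sub>0\<close> the difference of two solutions satisfies \<open>|D(y - z)| \<le> L |y - z|\<close>.  On a ball of
  radius at most \<open>1/(2 L)\<close> the mean value inequality turns every bound of \<open>|y - z|\<close> into half of
  it.\<close>

lemma total_differential_unique:
  fixes F :: "'a::euclidean_space \<times> 'b::euclidean_space \<Rightarrow> 'a \<Rightarrow>\<^sub>L 'b"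
  assumes S: "open S" "x0 \<in> S" and O: "open O'" "(x0, y x0) \<in> O'" and F: "smooth_on O' F"
    and y: "\<And>x. x \<in> S \<Longrightarrow> (y has_derivative blinfun_apply (F (x, y x))) (at x)"
    and z: "\<And>x. x \<in> S \<Longrightarrow> (z has_derivative blinfun_apply (F (x, z x))) (at x)"
    and eq: "y x0 = z x0"
  shows "\<exists>r>0. \<forall>x\<in>ball x0 r. y x = z x"
proof -
  obtain r1 \<rho> where r1: "r1 > 0" and \<rho>: "\<rho> > 0" and box: "cball x0 r1 \<times> cball (y x0) \<rho> \<subseteq> O'"
    by (rule open_contains_cball_Times[OF O])
  define C where "C = cball x0 r1 \<times> cball (y x0) \<rho>"
  have C: "C \<subseteq> O'" unfolding C_def by (rule box)
  have F_der: "(F has_derivative fderiv F p) (at p)" if "p \<in> C" for p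
    using smooth_on_has_derivative[OF F] C that by blast
  obtain DF where DF0: "continuous_on O' DF"
    "\<And>p. p \<in> O' \<Longrightarrow> blinfun_apply (DF p) = fderiv F p"
    by (rule blinfun_frechet_derivative[OF F]) (rule that)
  have DF: "blinfun_apply (DF p) = fderiv F p" if "p \<in> C" for p
    using DF0(2) C that by blast
  have cont_DF: "continuous_on C DF" by (rule continuous_on_subset[OF DF0(1) C])
  have "compact C" unfolding C_def by (intro compact_Times compact_cball)
  from compact_imp_bounded[OF compact_continuous_image[OF cont_DF this]]
  obtain L where L: "L > 0" "\<And>p. p \<in> C \<Longrightarrow> norm (DF p) \<le> L" by (auto simp: bounded_pos)
  have lip: "norm (F (x, u) - F (x, v)) \<le> L * norm (u - v)"
    if "x \<in> cball x0 r1" "u \<in> cball (y x0) \<rho>" "v \<in> cball (y x0) \<rho>" for x u v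
  proof -
    have "norm (F (x, u) - F (x, v)) \<le> L * norm ((x, u) - (x, v))"
    proof (rule differentiable_bound[where S=C and f'=DF])
      show "convex C" unfolding C_def by (intro convex_Times convex_cball)
      show "(F has_derivative DF p) (at p within C)" if "p \<in> C" for p
        using F_der[OF that] by (simp add: DF[OF that] has_derivative_at_withinI)
      show "onorm (DF p) \<le> L" if "p \<in> C" for p using L(2)[OF that] by (simp add: norm_blinfun.rep_eq)
    qed (use that in \<open>auto simp: C_def\<close>)
    then show ?thesis by simp
  qed
  have near: "\<exists>d>0. \<forall>x. dist x x0 < d \<longrightarrow> dist (f x) (f x0) < \<rho>"
    if "continuous (at x0) f" for f :: "'a \<Rightarrow> 'b"
    using that \<rho>(1) unfolding continuous_at_eps_delta by simp
  obtain r2 where r2: "r2 > 0" "\<And>x. dist x x0 < r2 \<Longrightarrow> dist (y x) (y x0) < \<rho>"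
    using near[OF has_derivative_continuous[OF y[OF S(2)]]] by auto
  obtain r3 where r3: "r3 > 0" "\<And>x. dist x x0 < r3 \<Longrightarrow> dist (z x) (z x0) < \<rho>"
    using near[OF has_derivative_continuous[OF z[OF S(2)]]] by auto
  obtain r4 where r4: "r4 > 0" "ball x0 r4 \<subseteq> S" using S open_contains_ball by blast
  define r where "r = Min {r1, r2, r3, r4, 1 / (2 * L)}"
  have r: "r > 0" "r \<le> r1" "r \<le> r2" "r \<le> r3" "r \<le> r4" "r \<le> 1 / (2 * L)"
    using r1 r2 r3 r4 L by (auto simp: r_def)
  have rL: "L * r \<le> 1 / 2" using r(6) L(1) by (simp add: field_simps)
  have mem: "x \<in> S" "x \<in> cball x0 r1" "y x \<in> cball (y x0) \<rho>" "z x \<in> cball (y x0) \<rho>" if "x \<in> ball x0 r" for x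
  proof -
    have "dist x x0 < r2" "dist x x0 < r3" using that r by (simp_all add: dist_commute)
    from r2(2)[OF this(1)] r3(2)[OF this(2)] show "y x \<in> cball (y x0) \<rho>" "z x \<in> cball (y x0) \<rho>"
      by (simp_all add: eq dist_commute)
    show "x \<in> S" using that r r4 by auto
    show "x \<in> cball x0 r1" using that r by auto
  qed
  have bound: "\<forall>x\<in>ball x0 r. norm (y x - z x) \<le> 2 * \<rho> / 2 ^ n" for n
  proof (induction n)
    case 0
    show ?case
    proof
      fix x assume "x \<in> ball x0 r"
      from mem(3,4)[OF this] show "norm (y x - z x) \<le> 2 * \<rho> / 2 ^ 0"
        using norm_triangle_ineq4[of "y x - y x0" "z x - y x0"] by (simp add: dist_norm norm_minus_commute)
    qed
  next
    case (Suc n)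
    let ?B = "2 * \<rho> / 2 ^ n"
    show ?case
    proof
      fix x assume x: "x \<in> ball x0 r"
      have "norm ((y x - z x) - (y x0 - z x0)) \<le> (L * ?B) * norm (x - x0)"
      proof (rule differentiable_bound[where S="ball x0 r" and f="\<lambda>x. y x - z x"
            and f'="\<lambda>x. blinfun_apply (F (x, y x) - F (x, z x))"])
        fix x assume x: "x \<in> ball x0 r"
        show "((\<lambda>x. y x - z x) has_derivative blinfun_apply (F (x, y x) - F (x, z x))) (at x within ball x0 r)"
          using has_derivative_diff[OF y[OF mem(1)[OF x]] z[OF mem(1)[OF x]]]
          by (simp add: has_derivative_at_withinI minus_blinfun.rep_eq)
        have "norm (F (x, y x) - F (x, z x)) \<le> L * norm (y x - z x)"
          by (rule lip[OF mem(2)[OF x] mem(3)[OF x] mem(4)[OF x]])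
        also have "\<dots> \<le> L * ?B" using Suc x L(1) by (intro mult_left_mono) auto
        finally show "onorm (blinfun_apply (F (x, y x) - F (x, z x))) \<le> L * ?B"
          by (simp only: norm_blinfun.rep_eq)
      qed (use x r in auto)
      also have "\<dots> \<le> (L * ?B) * r"
        using x L(1) \<rho>(1) by (intro mult_left_mono) (auto simp: dist_norm norm_minus_commute)
      also have "\<dots> = (L * r) * ?B" by simp
      also have "\<dots> \<le> (1 / 2) * ?B" using \<rho>(1) by (intro mult_right_mono rL) simp
      finally show "norm (y x - z x) \<le> 2 * \<rho> / 2 ^ Suc n" by (simp add: eq)
    qed
  qed
  have "y x = z x" if x: "x \<in> ball x0 r" for x
  proof -
    have "(\<lambda>n. 2 * \<rho> * (1 / 2) ^ n) \<longlonglongrightarrow> 2 * \<rho> * 0"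
      by (intro tendsto_mult tendsto_const LIMSEQ_power_zero) simp
    moreover have "norm (y x - z x) \<le> 2 * \<rho> * (1 / 2) ^ n" for n
      using bound[of n] x by (simp add: power_one_over)
    ultimately have "norm (y x - z x) \<le> 0" by (intro LIMSEQ_le_const) auto
    then show ?thesis by simp
  qed
  then show ?thesis using r(1) by blast
qed

text \<open>The two sides are the mixed second derivatives of \<open>y\<close> at \<open>x\<^sub>0\<close>.\<close>

lemma total_differential_integrability:
  fixes F :: "'a::euclidean_space \<times> 'b::euclidean_space \<Rightarrow> 'a \<Rightarrow>\<^sub>L 'b"
  assumes S: "open S" "x0 \<in> S" and DF: "(F has_derivative DF) (at (x0, y x0))"
    and y: "\<And>x. x \<in> S \<Longrightarrow> (y has_derivative blinfun_apply (F (x, y x))) (at x)"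
  shows "DF (h, F (x0, y x0) h) k = DF (k, F (x0, y x0) k) h"
proof -
  have "((\<lambda>x. F (x, y x)) has_derivative (\<lambda>h. DF (h, F (x0, y x0) h))) (at x0)"
    by (rule has_derivative_compose[OF has_derivative_Pair[OF has_derivative_ident y[OF S(2)]] DF])
  then have D: "((\<lambda>x. F (x, y x) k) has_derivative (\<lambda>h. DF (h, F (x0, y x0) h) k)) (at x0)" for k
    by (rule bounded_linear.has_derivative[OF blinfun.bounded_linear_left])
  show ?thesis
    by (rule second_derivative_symmetric[where f=y and f'="\<lambda>x. blinfun_apply (F (x, y x))"
          and f''="\<lambda>k h. DF (h, F (x0, y x0) h) k", OF S y D, symmetric])
qed

section \<open>Frames in a chart\<close>

text \<open>The equations in a chart have matrices as right-hand sides; this is the bridge to bounded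
  linear maps.\<close>

definition mat_blinfun :: "real^'n^'m \<Rightarrow> (real^'n) \<Rightarrow>\<^sub>L (real^'m)" where
  "mat_blinfun A = Blinfun ((*v) A)"

lemma apply_mat_blinfun: "blinfun_apply (mat_blinfun A) = (*v) A"
  unfolding mat_blinfun_def
  by (rule bounded_linear_Blinfun_apply[OF bounded_bilinear.bounded_linear_right[OF bilin_mv]])

lemma bounded_linear_mat_blinfun: "bounded_linear mat_blinfun"
  unfolding linear_conv_bounded_linear[symmetric]
  by (intro linearI blinfun_eqI)
    (simp_all add: apply_mat_blinfun blinfun.add_left blinfun.scaleR_left
      matrix_vector_mult_add_rdistrib scaleR_matrix_vector_assoc)

lemma matrix_total_differential_smooth:
  fixes \<Phi> :: "(real^'n) \<times> (real^'m) \<Rightarrow> real^'n^'m"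
  assumes "open S" "smooth_on O' \<Phi>" "open O'" "\<And>x. x \<in> S \<Longrightarrow> (x, y x) \<in> O'"
    "\<And>x. x \<in> S \<Longrightarrow> (y has_derivative (*v) (\<Phi> (x, y x))) (at x)"
  shows "smooth_on S y"
  by (rule total_differential_smooth[OF assms(1) smooth_on_linear[OF bounded_linear_mat_blinfun assms(3,2)]])
    (simp_all add: assms(4,5) apply_mat_blinfun)

lemma matrix_total_differential_unique:
  fixes \<Phi> :: "(real^'n) \<times> (real^'m) \<Rightarrow> real^'n^'m"
  assumes "open S" "x0 \<in> S" "open O'" "(x0, y x0) \<in> O'" "smooth_on O' \<Phi>"
    and y: "\<And>x. x \<in> S \<Longrightarrow> (y has_derivative (*v) (\<Phi> (x, y x))) (at x)"
    and z: "\<And>x. x \<in> S \<Longrightarrow> (z has_derivative (*v) (\<Phi> (x, z x))) (at x)" and eq: "y x0 = z x0"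
  shows "\<exists>r>0. \<forall>x\<in>ball x0 r. y x = z x"
  by (rule total_differential_unique[where y=y and z=z, OF assms(1-4)
        smooth_on_linear[OF bounded_linear_mat_blinfun assms(3,5)] _ _ eq])
    (simp_all add: y z apply_mat_blinfun)

lemma matrix_total_differential_integrability:
  fixes \<Phi> :: "(real^'n) \<times> (real^'m) \<Rightarrow> real^'n^'m"
  assumes S: "open S" "x0 \<in> S" and D: "(\<Phi> has_derivative D) (at (x0, y x0))"
    and y: "\<And>x. x \<in> S \<Longrightarrow> (y has_derivative (*v) (\<Phi> (x, y x))) (at x)"
  shows "D (h, \<Phi> (x0, y x0) *v h) *v k = D (k, \<Phi> (x0, y x0) *v k) *v h"
proof -
  have "(y has_derivative blinfun_apply (mat_blinfun (\<Phi> (x, y x)))) (at x)" if "x \<in> S" for x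
    unfolding apply_mat_blinfun by (rule y[OF that])
  from total_differential_integrability[OF S bounded_linear.has_derivative[OF bounded_linear_mat_blinfun D] this]
  show ?thesis by (simp only: apply_mat_blinfun)
qed

lemma matrix_frobenius_exists:
  fixes \<Phi> :: "(real^'n) \<times> (real^'m) \<Rightarrow> real^'n^'m"
  assumes O: "open O'" "(x0, y0) \<in> O'" and \<Phi>: "smooth_on O' \<Phi>"
    and sym: "\<And>x y D h k. (x, y) \<in> O' \<Longrightarrow> (\<Phi> has_derivative D) (at (x, y)) \<Longrightarrow>
      D (h, \<Phi> (x, y) *v h) *v k = D (k, \<Phi> (x, y) *v k) *v h"
  obtains r y where "r > 0" "y x0 = y0" "smooth_on (ball x0 r) y"
    "\<And>x. x \<in> ball x0 r \<Longrightarrow> (x, y x) \<in> O'"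
    "\<And>x. x \<in> ball x0 r \<Longrightarrow> (y has_derivative (*v) (\<Phi> (x, y x))) (at x)"
proof -
  let ?F = "\<lambda>p. mat_blinfun (\<Phi> p)"
  have "\<exists>r>0. \<exists>y. y x0 = y0 \<and> (\<forall>x\<in>ball x0 r. (x, y x) \<in> O' \<and>
      (y has_derivative blinfun_apply (?F (x, y x))) (at x))"
  proof (rule frobenius_exists[OF O smooth_on_linear[OF bounded_linear_mat_blinfun O(1) \<Phi>]])
    fix x y h k assume m: "(x, y) \<in> O'"
    note D = smooth_on_has_derivative[OF \<Phi> m]
    have "fderiv ?F (x, y) = (\<lambda>h. mat_blinfun (fderiv \<Phi> (x, y) h))"
      by (rule frechet_derivative_at[OF bounded_linear.has_derivative[OF bounded_linear_mat_blinfun D], symmetric])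
    then show "fderiv ?F (x, y) (h, ?F (x, y) h) k = fderiv ?F (x, y) (k, ?F (x, y) k) h"
      using assms(4)[OF m D] by (simp only: apply_mat_blinfun)
  qed
  then obtain r y where r: "r > 0" "y x0 = y0" "\<And>x. x \<in> ball x0 r \<Longrightarrow> (x, y x) \<in> O'"
    "\<And>x. x \<in> ball x0 r \<Longrightarrow> (y has_derivative (*v) (\<Phi> (x, y x))) (at x)"
    unfolding apply_mat_blinfun by blast
  show ?thesis
    by (rule that[OF r(1,2) matrix_total_differential_smooth[OF open_ball \<Phi> O(1) r(3,4)] r(3,4)])
qed

text \<open>Contraction of an index is evaluation of a linear map; with this lemma the coordinate formulas
  turn into formulas about vectors.\<close>

lemma linear_axis_sum:
  fixes f :: "real^'n \<Rightarrow> real^'m"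
  assumes "linear f"
  shows "(\<Sum>b\<in>UNIV. v $ b * f (axis b 1) $ i) = f v $ i"
proof -
  have "f v = f (\<Sum>b\<in>UNIV. v $ b *\<^sub>R axis b 1)"
    by (simp add: basis_expansion scalar_mult_eq_scaleR[symmetric])
  also have "\<dots> = (\<Sum>b\<in>UNIV. v $ b *\<^sub>R f (axis b 1))"
    by (simp only: linear_sum[OF assms] linear_cmul[OF assms])
  finally show ?thesis by simp
qed

lemma linear_eq_0_axis:
  fixes f :: "real^'n \<Rightarrow> real^'m"
  assumes "linear f" "\<And>b. f (axis b 1) = 0"
  shows "f v = 0"
  using linear_axis_sum[OF assms(1), of v] by (simp add: vec_eq_iff assms(2))

lemma smooth_on_matrix_mult:
  "open S \<Longrightarrow> smooth_on S f \<Longrightarrow> smooth_on S g \<Longrightarrow> smooth_on S (\<lambda>x. f x ** g x)"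
  for f :: "_ \<Rightarrow> real^'n^'m" and g :: "_ \<Rightarrow> real^'k^'n"
  by (rule smooth_on_bilinear[OF bilin_mm])

lemma smooth_on_matrix_vector_mult:
  "open S \<Longrightarrow> smooth_on S f \<Longrightarrow> smooth_on S g \<Longrightarrow> smooth_on S (\<lambda>x. f x *v g x)"
  for f :: "_ \<Rightarrow> real^'n^'m"
  by (rule smooth_on_bilinear[OF bilin_mv])

text \<open>The next three notions are \<open>\<Gamma>\<^sup>i\<^sub>j\<^sub>k v\<^sup>j v'\<^sup>k\<close>, \<open>I\<^sup>i\<^sub>j\<^sub>k v\<^sup>j v'\<^sup>k\<close> for vectors \<open>v\<close> and \<open>v'\<close>,
  and the coefficients of \<open>I(u a, u b)\<close> in the frame \<open>u\<close>.\<close>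

definition conn :: "(real^'n \<Rightarrow> real^'n^'n) \<Rightarrow> real^'n \<Rightarrow> real^'n \<Rightarrow> real^'n \<Rightarrow> real^'n" where
  "conn u x h k = fderiv u x h *v (matrix_inv (u x) *v k)"

definition brk :: "(real^'n \<Rightarrow> real^'n^'n) \<Rightarrow> real^'n \<Rightarrow> real^'n \<Rightarrow> real^'n \<Rightarrow> real^'n" where
  "brk u x h k = conn u x h k - conn u x k h"

definition struct_fun :: "(real^'n \<Rightarrow> real^'n^'n) \<Rightarrow> real^'n \<Rightarrow> real^'n \<Rightarrow> real^'n \<Rightarrow> real^'n" where
  "struct_fun u x a b = matrix_inv (u x) *v brk u x (u x *v a) (u x *v b)"

definition deriv2 :: "(real^'n \<Rightarrow> real^'n^'n) \<Rightarrow> real^'n \<Rightarrow> real^'n \<Rightarrow> real^'n \<Rightarrow> real^'n^'n" where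
  "deriv2 u x h k = frechet_derivative (\<lambda>y. fderiv u y h) (at x) k"

text \<open>The linear curvature without indices: its components \<open>R\<^sup>i\<^sub>k\<^sub>j\<^sub>,\<^sub>a\<close> contracted with the vectors
  \<open>k\<close>, \<open>j\<close> and \<open>a\<close>, with the derivative of \<open>\<Gamma>\<close> expressed by the second derivative of \<open>u\<close>.\<close>

definition curv :: "(real^'n \<Rightarrow> real^'n^'n) \<Rightarrow> real^'n \<Rightarrow> real^'n \<Rightarrow> real^'n \<Rightarrow> real^'n \<Rightarrow> real^'n" where
  "curv u x k j a =
     (deriv2 u x a k *v (matrix_inv (u x) *v j) - conn u x a (conn u x k j) + conn u x (conn u x a k) j)
   - (deriv2 u x a j *v (matrix_inv (u x) *v k) - conn u x a (conn u x j k) + conn u x (conn u x a j) k)"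

text \<open>A structure object in one chart.\<close>

locale frame =
  fixes u :: "real^'n \<Rightarrow> real^'n^'n" and S :: "(real^'n) set"
  assumes open_S: "open S" and smooth_u: "smooth_on S u"
    and invertible_u: "\<And>x. x \<in> S \<Longrightarrow> invertible (u x)"
begin

abbreviation "Du x \<equiv> fderiv u x"
abbreviation "G x \<equiv> matrix_inv (u x)"

lemma Du: "x \<in> S \<Longrightarrow> (u has_derivative Du x) (at x)"
  by (rule smooth_on_has_derivative[OF smooth_u])

lemma linear_Du: "x \<in> S \<Longrightarrow> linear (Du x)"
  by (rule has_derivative_linear[OF Du])

lemma inv_simps [simp]:
  assumes "x \<in> S"
  shows "G x *v (u x *v a) = a" "u x *v (G x *v a) = a" "G x ** u x = mat 1" "u x ** G x = mat 1"
  by (simp_all add: matrix_vector_mul_assoc matrix_inv_left matrix_inv_right invertible_u[OF assms])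

lemma smooth_G: "smooth_on S G"
  by (rule smooth_on_compose[OF open_S smooth_u smooth_on_matrix_inv]) (use invertible_u in auto)

lemma DG: "x \<in> S \<Longrightarrow> (G has_derivative (\<lambda>h. - (G x ** Du x h ** G x))) (at x)"
  by (rule has_derivative_compose[OF Du has_derivative_matrix_inv[OF invertible_u]])

lemma Du_has_derivative: "x \<in> S \<Longrightarrow> ((\<lambda>y. Du y h) has_derivative deriv2 u x h) (at x)"
  unfolding deriv2_def by (rule smooth_on_has_derivative[OF smooth_on_frechet_derivative[OF smooth_u]])

lemma deriv2_sym: "x \<in> S \<Longrightarrow> deriv2 u x h k = deriv2 u x k h"
  by (rule second_derivative_symmetric[OF open_S _ Du Du_has_derivative])

lemma linear_deriv2: "x \<in> S \<Longrightarrow> linear (deriv2 u x h)" "x \<in> S \<Longrightarrow> linear (\<lambda>h. deriv2 u x h k)"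
proof -
  show l: "linear (deriv2 u x h)" if "x \<in> S" for h by (rule has_derivative_linear[OF Du_has_derivative[OF that]])
  show "linear (\<lambda>h. deriv2 u x h k)" if "x \<in> S"
    unfolding deriv2_sym[OF that, of _ k] by (rule l[OF that])
qed

lemma linear_conn: "x \<in> S \<Longrightarrow> linear (\<lambda>h. conn u x h k)" "linear (conn u x h)"
proof -
  show "linear (conn u x h)" unfolding conn_def matrix_vector_mul_assoc by (rule matrix_vector_mul_linear)
  show "linear (\<lambda>h. conn u x h k)" if "x \<in> S"
    unfolding conn_def
    by (rule linear_compose[OF linear_Du[OF that] bounded_linear.linear[OF
          bounded_bilinear.bounded_linear_left[OF bilin_mv]], unfolded o_def])
qed

lemmas conn_diff = linear_diff[OF linear_conn(1)] linear_diff[OF linear_conn(2)]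

lemma linear_brk: "x \<in> S \<Longrightarrow> linear (\<lambda>h. brk u x h k)" "x \<in> S \<Longrightarrow> linear (brk u x h)"
  unfolding brk_def by (intro linear_compose_sub linear_conn; simp)+

lemma linear_curv:
  assumes "x \<in> S"
  shows "linear (\<lambda>k. curv u x k j a)" "linear (\<lambda>j. curv u x k j a)" "linear (\<lambda>a. curv u x k j a)"
proof -
  have m: "linear (\<lambda>h. f h *v v)" if "linear f" for f :: "real^'n \<Rightarrow> real^'n^'n" and v
    by (rule linear_compose[OF that bounded_linear.linear[OF
          bounded_bilinear.bounded_linear_left[OF bilin_mv]], unfolded o_def])
  have c: "linear (\<lambda>h. conn u x a (f h))" "linear (\<lambda>h. conn u x (f h) a)" if "linear f" for f a
    by (rule linear_compose[OF that linear_conn(2), unfolded o_def],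
        rule linear_compose[OF that linear_conn(1)[OF assms], unfolded o_def])
  have v: "linear (\<lambda>h. A *v (B *v h))" for A B :: "real^'n^'n"
    unfolding matrix_vector_mul_assoc by (rule matrix_vector_mul_linear)
  note l = linear_compose_sub linear_compose_add m linear_deriv2[OF assms] v c linear_conn(1)[OF assms] linear_conn(2)
  show "linear (\<lambda>k. curv u x k j a)" unfolding curv_def by (intro l)
  show "linear (\<lambda>j. curv u x k j a)" unfolding curv_def by (intro l)
  show "linear (\<lambda>a. curv u x k j a)" unfolding curv_def by (intro l)
qed

lemma Gam_eq:
  assumes "x \<in> S"
  shows "Gam u x i j k = conn u x (axis j 1) (axis k 1) $ i"
proof -
  have "pd j (\<lambda>x. u x $ i $ a) x = Du x (axis j 1) $ i $ a" for a
  proof -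
    have "((\<lambda>x. u x $ i $ a) has_derivative (\<lambda>h. Du x h $ i $ a)) (at x)"
      by (rule bounded_linear.has_derivative[OF bounded_linear_vec_nth
            bounded_linear.has_derivative[OF bounded_linear_vec_nth Du[OF assms]]])
    from frechet_derivative_at[OF this] show ?thesis unfolding pd_def by metis
  qed
  moreover have "(G x *v axis k 1) $ a = G x $ a $ k" for a
    by (simp only: matrix_vector_mult_basis column_def vec_lambda_beta)
  ultimately show ?thesis
    by (simp add: Gam_def conn_def matrix_vector_mult_def[of "Du x (axis j 1)"])
qed

lemma Gam_contract:
  assumes "x \<in> S"
  shows "(\<Sum>a\<in>UNIV. Gam u x i a j * \<xi> $ a) = conn u x \<xi> (axis j 1) $ i"
  using linear_axis_sum[OF linear_conn(1)[OF assms], of \<xi> "axis j 1" i]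
  by (simp only: Gam_eq[OF assms] mult.commute)

lemma integ_eq: "x \<in> S \<Longrightarrow> integ u x i j k = brk u x (axis j 1) (axis k 1) $ i"
  by (simp add: integ_def alt_def Gam_eq brk_def)

lemma conn_has_derivative:
  assumes "x \<in> S"
  shows "((\<lambda>y. conn u y h k) has_derivative (\<lambda>l. deriv2 u x h l *v (G x *v k) - conn u x h (conn u x l k))) (at x)"
proof -
  have "((\<lambda>y. G y *v k) has_derivative (\<lambda>l. - (G x ** Du x l ** G x) *v k)) (at x)"
    by (rule bounded_linear.has_derivative[OF bounded_bilinear.bounded_linear_left[OF
            bilin_mv] DG[OF assms]])
  from bounded_bilinear.FDERIV[OF bilin_mv Du_has_derivative[OF assms] this]
  show ?thesis unfolding conn_def
    by (rule has_derivative_eq_rhs)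
      (simp add: fun_eq_iff matrix_vector_mul_assoc[symmetric]
        bounded_bilinear.minus_left[OF bilin_mv]
        bounded_bilinear.minus_right[OF bilin_mv])
qed

lemma pd_component:
  assumes "x \<in> S" "\<And>y. y \<in> S \<Longrightarrow> f y = g y $ i" "(g has_derivative g') (at x)"
  shows "pd k f x = g' (axis k 1) $ i"
proof -
  have "((\<lambda>y. g y $ i) has_derivative (\<lambda>h. g' h $ i)) (at x)"
    by (rule bounded_linear.has_derivative[OF bounded_linear_vec_nth assms(3)])
  then have "(f has_derivative (\<lambda>h. g' h $ i)) (at x)"
    by (rule has_derivative_transform_within_open[OF _ open_S assms(1)]) (simp add: assms(2))
  from frechet_derivative_at[OF this] show ?thesis unfolding pd_def by metis
qed

lemma lin_curv_eq:
  assumes "x \<in> S"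
  shows "lin_curv u x i k j a = curv u x (axis k 1) (axis j 1) (axis a 1) $ i"
proof -
  have p: "pd k (\<lambda>x. Gam u x i a j) x = (deriv2 u x (axis a 1) (axis k 1) *v (G x *v axis j 1)
      - conn u x (axis a 1) (conn u x (axis k 1) (axis j 1))) $ i" for k j
    by (rule pd_component[OF assms Gam_eq conn_has_derivative[OF assms]])
  have q: "(\<Sum>b\<in>UNIV. Gam u x i b j * Gam u x b a k) = conn u x (conn u x (axis a 1) (axis k 1)) (axis j 1) $ i" for k j
    using Gam_contract[OF assms, of i j "conn u x (axis a 1) (axis k 1)"]
    by (simp only: Gam_eq[OF assms, of _ a k])
  show ?thesis unfolding lin_curv_def alt_def p q curv_def by simp
qed

text \<open>The linear curvature is trilinear, so it is determined by its values on basis vectors.\<close>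

lemma lin_curv_zero_iff:
  assumes "x \<in> S"
  shows "(\<forall>i k j a. lin_curv u x i k j a = 0) \<longleftrightarrow> (\<forall>k j a. curv u x k j a = 0)"
proof
  assume "\<forall>i k j a. lin_curv u x i k j a = 0"
  then have "curv u x (axis k 1) (axis j 1) (axis a 1) = 0" for k j a
    by (simp add: lin_curv_eq[OF assms] vec_eq_iff)
  then have "curv u x (axis k 1) (axis j 1) a = 0" for k j a
    by (rule linear_eq_0_axis[OF linear_curv(3)[OF assms]])
  then have "curv u x (axis k 1) j a = 0" for k j a
    by (rule linear_eq_0_axis[OF linear_curv(2)[OF assms]])
  then show "\<forall>k j a. curv u x k j a = 0"
    by (intro allI) (rule linear_eq_0_axis[OF linear_curv(1)[OF assms]])
qed (simp add: lin_curv_eq[OF assms])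

text \<open>Expanding both sides in second derivatives of \<open>u\<close> and products of \<open>\<Gamma>\<close>, the terms agree by
  the symmetry of the second derivative.\<close>

lemma formal_lie_eq:
  assumes x: "x \<in> S"
  shows "formal_lie (integ u) x (\<xi>, \<chi> i j. \<Sum>a\<in>UNIV. Gam u x i a j * \<xi> $ a) i k j
    = curv u x (axis k 1) (axis j 1) \<xi> $ i"
proof -
  let ?k = "axis k 1" and ?j = "axis j 1"
  define T where "T l = (deriv2 u x ?k l *v (G x *v ?j) - conn u x ?k (conn u x l ?j))
    - (deriv2 u x ?j l *v (G x *v ?k) - conn u x ?j (conn u x l ?k))" for l
  have T: "((\<lambda>y. brk u y ?k ?j) has_derivative T) (at x)"
    unfolding brk_def T_def by (intro has_derivative_diff conn_has_derivative x)
  have 1: "(\<Sum>a\<in>UNIV. pd a (\<lambda>x. integ u x i k j) x * \<xi> $ a) = T \<xi> $ i"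
    using linear_axis_sum[OF has_derivative_linear[OF T], of \<xi> i]
    by (simp only: pd_component[OF x integ_eq T] mult.commute)
  have 2: "(\<Sum>b\<in>UNIV. (\<Sum>a\<in>UNIV. Gam u x i a b * \<xi> $ a) * integ u x b k j) = conn u x \<xi> (brk u x ?k ?j) $ i"
    using linear_axis_sum[OF linear_conn(2)[of x \<xi>], of "brk u x ?k ?j" i]
    by (simp only: Gam_contract[OF x] integ_eq[OF x] mult.commute[of "conn u x \<xi> _ $ i"])
  have 3: "(\<Sum>b\<in>UNIV. (\<Sum>a\<in>UNIV. Gam u x b a k * \<xi> $ a) * integ u x i b j) = brk u x (conn u x \<xi> ?k) ?j $ i"
    using linear_axis_sum[OF linear_brk(1)[OF x], of "conn u x \<xi> ?k" ?j i]
    by (simp only: Gam_contract[OF x] integ_eq[OF x])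
  have 4: "(\<Sum>b\<in>UNIV. (\<Sum>a\<in>UNIV. Gam u x b a j * \<xi> $ a) * integ u x i k b) = brk u x ?k (conn u x \<xi> ?j) $ i"
    using linear_axis_sum[OF linear_brk(2)[OF x], of "conn u x \<xi> ?j" ?k i]
    by (simp only: Gam_contract[OF x] integ_eq[OF x])
  have "T \<xi> - conn u x \<xi> (brk u x ?k ?j) + brk u x (conn u x \<xi> ?k) ?j + brk u x ?k (conn u x \<xi> ?j)
      = curv u x ?k ?j \<xi>"
    by (simp add: T_def curv_def brk_def conn_diff(1)[OF x] conn_diff(2) deriv2_sym[OF x, of _ \<xi>])
  then show ?thesis
    unfolding formal_lie_def by (simp add: 1 2 3 4 flip: vector_minus_component vector_add_component)
qed

end

lemma smooth_on_sum: "open S \<Longrightarrow> (\<And>i. i \<in> I \<Longrightarrow> smooth_on S (f i)) \<Longrightarrow> smooth_on S (\<lambda>x. \<Sum>i\<in>I. f i x)"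
  unfolding smooth_on_def by (simp add: Ck_on_sum)

lemma linear_Basis_sum:
  fixes f :: "'a::euclidean_space \<Rightarrow> 'b::real_vector"
  assumes "linear f"
  shows "(\<Sum>i\<in>Basis. (v \<bullet> i) *\<^sub>R f i) = f v"
  by (simp only: linear_sum[OF assms, symmetric] linear_cmul[OF assms, symmetric] euclidean_representation)

lemmas matrix_vector_minus_left = bounded_bilinear.minus_left[OF bilin_mv]
lemmas matrix_vector_minus_right = bounded_bilinear.minus_right[OF bilin_mv]
lemmas matrix_vector_diff_right = bounded_bilinear.diff_right[OF bilin_mv]
lemmas matrix_vector_add_left = bounded_bilinear.add_left[OF bilin_mv]

context frame begin

text \<open>The direction \<open>v q\<close> varies with the point; expanding it in a basis reduces the claim to the
  derivatives in constant directions.\<close>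

lemma Du_has_derivative_comp:
  fixes f :: "'c::real_normed_vector \<Rightarrow> real^'n"
  assumes O: "open O'" "p \<in> O'" "\<And>q. q \<in> O' \<Longrightarrow> f q \<in> S"
    and f: "(f has_derivative f') (at p)" and v: "(v has_derivative v') (at p)"
  shows "((\<lambda>q. Du (f q) (v q)) has_derivative (\<lambda>h. deriv2 u (f p) (v p) (f' h) + Du (f p) (v' h))) (at p)"
proof -
  have fp: "f p \<in> S" using O by blast
  have "((\<lambda>q. \<Sum>i\<in>Basis. (v q \<bullet> i) *\<^sub>R Du (f q) i) has_derivative
      (\<lambda>h. \<Sum>i\<in>Basis. (v p \<bullet> i) *\<^sub>R deriv2 u (f p) i (f' h) + (v' h \<bullet> i) *\<^sub>R Du (f p) i)) (at p)"
    by (intro has_derivative_sum has_derivative_scaleR has_derivative_inner_left v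
        has_derivative_compose[OF f Du_has_derivative[OF fp]])
  then have "((\<lambda>q. \<Sum>i\<in>Basis. (v q \<bullet> i) *\<^sub>R Du (f q) i) has_derivative
      (\<lambda>h. deriv2 u (f p) (v p) (f' h) + Du (f p) (v' h))) (at p)"
    by (simp only: sum.distrib linear_Basis_sum[OF linear_deriv2(2)[OF fp]] linear_Basis_sum[OF linear_Du[OF fp]])
  then show ?thesis
    by (rule has_derivative_transform_within_open[OF _ O(1,2)])
      (simp only: linear_Basis_sum[OF linear_Du[OF O(3)]])
qed

lemma u_struct_fun:
  "x \<in> S \<Longrightarrow> u x *v struct_fun u x a b = Du x (u x *v a) *v b - Du x (u x *v b) *v a"
  "x \<in> S \<Longrightarrow> struct_fun u x a b = G x *v (Du x (u x *v a) *v b - Du x (u x *v b) *v a)"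
  by (simp_all add: struct_fun_def brk_def conn_def)

text \<open>The link between the curvature conditions and the constancy of the structure functions.\<close>

lemma struct_fun_has_derivative:
  assumes x: "x \<in> S"
  shows "((\<lambda>y. struct_fun u y a b) has_derivative (\<lambda>h. G x *v curv u x (u x *v a) (u x *v b) h)) (at x)"
proof -
  have W: "((\<lambda>y. Du y (u y *v a) *v b) has_derivative
      (\<lambda>h. (deriv2 u x (u x *v a) h + Du x (Du x h *v a)) *v b)) (at x)" for a b
    by (intro bounded_linear.has_derivative[OF bounded_bilinear.bounded_linear_left[OF bilin_mv]]
        Du_has_derivative_comp[OF open_S x, where f="\<lambda>y. y" and f'="\<lambda>h. h"] has_derivative_ident Du[OF x])
  let ?T = "Du x (u x *v a) *v b - Du x (u x *v b) *v a"
  let ?T' = "\<lambda>h. (deriv2 u x (u x *v a) h + Du x (Du x h *v a)) *v b - (deriv2 u x (u x *v b) h + Du x (Du x h *v b)) *v a"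
  have "((\<lambda>y. G y *v (Du y (u y *v a) *v b - Du y (u y *v b) *v a)) has_derivative
      (\<lambda>h. G x *v ?T' h + (- (G x ** Du x h ** G x)) *v ?T)) (at x)"
    by (rule bounded_bilinear.FDERIV[OF bilin_mv DG[OF x] has_derivative_diff[OF W W]])
  then have "((\<lambda>y. struct_fun u y a b) has_derivative
      (\<lambda>h. G x *v ?T' h + (- (G x ** Du x h ** G x)) *v ?T)) (at x)"
    by (rule has_derivative_transform_within_open[OF _ open_S x]) (simp only: u_struct_fun(2))
  moreover have "G x *v ?T' h + (- (G x ** Du x h ** G x)) *v ?T = G x *v curv u x (u x *v a) (u x *v b) h" for h
  proof -
    have "curv u x (u x *v a) (u x *v b) h = ?T' h - Du x h *v (G x *v ?T)"
      by (simp add: curv_def conn_def x matrix_vector_add_left matrix_vector_diff_right deriv2_sym[OF x, of _ h])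
    then show ?thesis
      by (simp add: matrix_vector_minus_left matrix_vector_diff_right[of "G x"] matrix_vector_mul_assoc[symmetric])
  qed
  ultimately show ?thesis by simp
qed

text \<open>The equation of the linearization without indices.\<close>

lemma N1_equation_iff:
  assumes x: "x \<in> S" and v: "(v has_derivative v') (at x)"
  shows "(\<forall>i j. pd j (\<lambda>x. v x $ i) x = (\<Sum>a\<in>UNIV. Gam u x i a j * v x $ a)) \<longleftrightarrow> (\<forall>h. v' h = conn u x (v x) h)"
proof -
  have "pd j (\<lambda>x. v x $ i) x = v' (axis j 1) $ i" for i j
    by (rule pd_component[OF x refl v])
  then have "(\<forall>i j. pd j (\<lambda>x. v x $ i) x = (\<Sum>a\<in>UNIV. Gam u x i a j * v x $ a)) \<longleftrightarrow>
      (\<forall>j. v' (axis j 1) - conn u x (v x) (axis j 1) = 0)"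
    by (auto simp: Gam_contract[OF x] vec_eq_iff)
  also have "\<dots> \<longleftrightarrow> (\<forall>h. v' h - conn u x (v x) h = 0)"
    using linear_eq_0_axis[OF linear_compose_sub[OF has_derivative_linear[OF v] linear_conn(2)]] by blast
  finally show ?thesis by simp
qed

lemma frame_combination_has_derivative:
  assumes "x \<in> S" "(a has_derivative a') (at x)"
  shows "((\<lambda>y. u y *v a y) has_derivative (\<lambda>h. u x *v a' h + Du x h *v a x)) (at x)"
  by (rule bounded_bilinear.FDERIV[OF bilin_mv Du[OF assms(1)] assms(2)])

text \<open>In frame components the derivative of the frame and the term with \<open>\<Gamma>\<close> combine to a bracket.
  The resulting equation contains only the structure functions and the frame components of \<open>h\<close>,
  which coordinate changes preserve; so it passes from chart to chart by the chain rule.\<close>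

lemma frame_component_equation_iff:
  assumes x: "x \<in> S"
  shows "(\<forall>h. u x *v a' h + Du x h *v a = conn u x (u x *v a) h) \<longleftrightarrow> (\<forall>h. a' h = struct_fun u x a (G x *v h))"
proof -
  have "(u x *v a' h + Du x h *v a = conn u x (u x *v a) h) \<longleftrightarrow> u x *v a' h = u x *v struct_fun u x a (G x *v h)" for h
    by (auto simp: u_struct_fun(1)[OF x] conn_def x algebra_simps)
  moreover have "u x *v p = u x *v q \<longleftrightarrow> p = q" for p q using inv_simps(1)[OF x] by metis
  ultimately show ?thesis by simp
qed

text \<open>The right-hand side \<open>(x, \<xi>) \<mapsto> (h \<mapsto> \<Gamma>(\<xi>, h))\<close> of the equation of the linearization.\<close>

definition N1_field :: "(real^'n) \<times> (real^'n) \<Rightarrow> real^'n^'n" where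
  "N1_field p = Du (fst p) (snd p) ** G (fst p)"

lemma N1_field_apply: "N1_field (x, \<xi>) *v h = conn u x \<xi> h"
  by (simp add: N1_field_def conn_def matrix_vector_mul_assoc)

lemma N1_field_fun: "(*v) (N1_field (x, \<xi>)) = conn u x \<xi>"
  by (rule ext) (rule N1_field_apply)

lemma smooth_N1_field: "smooth_on (S \<times> UNIV) N1_field"
proof -
  have o: "open (S \<times> (UNIV :: (real^'n) set))" using open_S by (intro open_Times) auto
  have fst: "smooth_on (S \<times> (UNIV :: (real^'n) set)) (\<lambda>p. f (fst p))" if "smooth_on S f"
    for f :: "real^'n \<Rightarrow> 'z::real_normed_vector"
    by (rule smooth_on_compose[OF o smooth_on_linear[OF bounded_linear_fst o smooth_on_id[OF o]] that]) auto
  have "smooth_on (S \<times> UNIV) (\<lambda>p. (\<Sum>i\<in>Basis. (snd p \<bullet> i) *\<^sub>R Du (fst p) i) ** G (fst p))"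
    by (intro smooth_on_matrix_mult smooth_on_sum smooth_on_bilinear[OF bounded_bilinear_scaleR] o
        smooth_on_linear[OF bounded_linear_compose[OF bounded_linear_inner_left bounded_linear_snd] o smooth_on_id[OF o]]
        fst smooth_G smooth_on_frechet_derivative smooth_u)
  then show ?thesis
    by (rule smooth_on_cong[OF o, rotated]) (auto simp: N1_field_def linear_Basis_sum[OF linear_Du])
qed

lemma N1_field_has_derivative:
  assumes x: "x \<in> S"
  shows "(N1_field has_derivative (\<lambda>(k, \<eta>). Du x \<xi> ** (- (G x ** Du x k ** G x)) +
    (deriv2 u x \<xi> k + Du x \<eta>) ** G x)) (at (x, \<xi>))"
proof -
  have "((\<lambda>q. Du (fst q) (snd q)) has_derivative (\<lambda>h. deriv2 u (fst (x, \<xi>)) (snd (x, \<xi>)) (fst h) + Du (fst (x, \<xi>)) (snd h))) (at (x, \<xi>))"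
    by (rule Du_has_derivative_comp[where O'="S \<times> UNIV"])
      (auto intro!: open_Times open_S x derivative_eq_intros)
  moreover have "((\<lambda>q :: (real^'n) \<times> (real^'n). G (fst q)) has_derivative (\<lambda>h. - (G x ** Du x (fst h) ** G x))) (at (x, \<xi>))"
    by (rule has_derivative_compose[where f=fst and f'=fst and g=G and g'="\<lambda>h. - (G x ** Du x h ** G x)"])
      (simp_all add: bounded_linear_imp_has_derivative bounded_linear_fst DG x)
  ultimately have "((\<lambda>q. Du (fst q) (snd q) ** G (fst q)) has_derivative
    (\<lambda>h. Du x \<xi> ** (- (G x ** Du x (fst h) ** G x)) + (deriv2 u x \<xi> (fst h) + Du x (snd h)) ** G x)) (at (x, \<xi>))"
    using bounded_bilinear.FDERIV[OF bilin_mm] by fastforce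
  then show ?thesis by (simp only: N1_field_def[abs_def] case_prod_beta')
qed

text \<open>The integrability condition of the linear equation at \<open>(x, \<xi>)\<close> is the vanishing of the
  linear curvature applied to \<open>\<xi>\<close>.\<close>

lemma N1_field_curvature:
  assumes x: "x \<in> S" and D: "(N1_field has_derivative D) (at (x, \<xi>))"
  shows "D (k, conn u x \<xi> k) *v h - D (h, conn u x \<xi> h) *v k = curv u x k h \<xi>"
proof -
  have "D = (\<lambda>(k, \<eta>). Du x \<xi> ** (- (G x ** Du x k ** G x)) + (deriv2 u x \<xi> k + Du x \<eta>) ** G x)"
    by (rule has_derivative_unique[OF D N1_field_has_derivative[OF x]])
  then have "D (k, conn u x \<xi> k) *v h =
      deriv2 u x \<xi> k *v (G x *v h) - conn u x \<xi> (conn u x k h) + conn u x (conn u x \<xi> k) h" for k h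
    by (simp add: matrix_vector_add_left matrix_vector_minus_left matrix_vector_minus_right
        matrix_vector_mul_assoc[symmetric] conn_def)
  then show ?thesis by (simp add: curv_def)
qed

lemma parallel_exists:
  assumes flat: "\<And>x k j a. x \<in> S \<Longrightarrow> curv u x k j a = 0" and x0: "x0 \<in> S"
  shows "\<exists>r>0. \<exists>\<xi>. ball x0 r \<subseteq> S \<and> \<xi> x0 = \<xi>0 \<and> smooth_on (ball x0 r) \<xi> \<and>
    (\<forall>x\<in>ball x0 r. (\<xi> has_derivative conn u x (\<xi> x)) (at x))"
proof (rule matrix_frobenius_exists[OF open_Times[OF open_S open_UNIV] _ smooth_N1_field])
  show "(x0, \<xi>0) \<in> S \<times> UNIV" using x0 by simp
  show "D (h, N1_field (x, \<xi>) *v h) *v k = D (k, N1_field (x, \<xi>) *v k) *v h"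
    if "(x, \<xi>) \<in> S \<times> UNIV" "(N1_field has_derivative D) (at (x, \<xi>))" for x \<xi> D h k
    using N1_field_curvature[OF _ that(2), of h k] flat that(1) by (simp add: N1_field_apply)
  fix r \<xi>
  assume r: "r > 0" "\<xi> x0 = \<xi>0" "smooth_on (ball x0 r) \<xi>" "\<And>x. x \<in> ball x0 r \<Longrightarrow> (x, \<xi> x) \<in> S \<times> UNIV"
    "\<And>x. x \<in> ball x0 r \<Longrightarrow> (\<xi> has_derivative (*v) (N1_field (x, \<xi> x))) (at x)"
  then show ?thesis unfolding N1_field_fun by (intro exI[of _ r] exI[of _ \<xi>] conjI) auto
qed

lemma parallel_unique:
  assumes O: "open O'" "x0 \<in> O'" "O' \<subseteq> S"
    and v: "\<And>x. x \<in> O' \<Longrightarrow> (v has_derivative conn u x (v x)) (at x)"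
    and w: "\<And>x. x \<in> O' \<Longrightarrow> (w has_derivative conn u x (w x)) (at x)" and eq: "v x0 = w x0"
  shows "\<exists>r>0. \<forall>x\<in>ball x0 r. v x = w x"
  by (rule matrix_total_differential_unique[where y=v and z=w, OF O(1,2) open_Times[OF open_S open_UNIV] _
        smooth_N1_field _ _ eq, unfolded N1_field_fun])
    (use O v w in auto)

lemma parallel_curv_zero:
  assumes O: "open O'" "x0 \<in> O'" "O' \<subseteq> S"
    and v: "\<And>x. x \<in> O' \<Longrightarrow> (v has_derivative conn u x (v x)) (at x)"
  shows "curv u x0 k j (v x0) = 0"
proof -
  have x0: "x0 \<in> S" using O by blast
  obtain D where D: "(N1_field has_derivative D) (at (x0, v x0))" using N1_field_has_derivative[OF x0] by (rule that)
  have "(v has_derivative (*v) (N1_field (x, v x))) (at x)" if "x \<in> O'" for x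
    unfolding N1_field_fun by (rule v[OF that])
  from matrix_total_differential_integrability[OF O(1,2) D this, of k j]
  show ?thesis using N1_field_curvature[OF x0 D, of k j] by (simp add: N1_field_apply)
qed

end

section \<open>Maps between framed charts\<close>

text \<open>The right-hand side of the equation \<open>D\<phi>(x) = w(\<phi> x) u(x)\<^sup>-\<^sup>1\<close> for maps that send the frame
  \<open>u\<close> to the frame \<open>w\<close>.  Its value is also the matrix of the arrow of the invariance groupoid.\<close>

definition frame_field :: "(real^'n \<Rightarrow> real^'n^'n) \<Rightarrow> (real^'n \<Rightarrow> real^'n^'n) \<Rightarrow> (real^'n) \<times> (real^'n) \<Rightarrow> real^'n^'n" where
  "frame_field u w p = w (snd p) ** matrix_inv (u (fst p))"

text \<open>The derivative of \<open>\<phi>\<close> at \<open>x\<close> sends the columns of \<open>u x\<close> to those of \<open>w (\<phi> x)\<close>.\<close>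

abbreviation frame_map ::
  "(real^'n \<Rightarrow> real^'n^'n) \<Rightarrow> (real^'n \<Rightarrow> real^'n^'n) \<Rightarrow> (real^'n \<Rightarrow> real^'n) \<Rightarrow> real^'n \<Rightarrow> bool"
  where "frame_map u w \<phi> x \<equiv> (\<phi> has_derivative (*v) (frame_field u w (x, \<phi> x))) (at x)"

locale frame_pair = U: frame u S + W: frame w T
  for u w :: "real^'n \<Rightarrow> real^'n^'n" and S T
begin

lemma open_ST: "open (S \<times> T)"
  by (intro open_Times U.open_S W.open_S)

lemma smooth_frame_field: "smooth_on (S \<times> T) (frame_field u w)"
proof -
  note o = open_ST
  have "smooth_on (S \<times> T) (\<lambda>p. matrix_inv (u (fst p)))"
    by (rule smooth_on_compose[OF o smooth_on_linear[OF bounded_linear_fst o smooth_on_id[OF o]] U.smooth_G]) auto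
  moreover have "smooth_on (S \<times> T) (\<lambda>p. w (snd p))"
    by (rule smooth_on_compose[OF o smooth_on_linear[OF bounded_linear_snd o smooth_on_id[OF o]] W.smooth_u]) auto
  ultimately show ?thesis unfolding frame_field_def[abs_def] by (intro smooth_on_matrix_mult o)
qed

lemma frame_field_has_derivative:
  assumes x: "x \<in> S" and y: "y \<in> T"
  shows "(frame_field u w has_derivative (\<lambda>(h, \<eta>). w y ** (- (matrix_inv (u x) ** fderiv u x h ** matrix_inv (u x)))
    + fderiv w y \<eta> ** matrix_inv (u x))) (at (x, y))"
proof -
  have "((\<lambda>p. w (snd p)) has_derivative (\<lambda>h. fderiv w y (snd h))) (at (x, y))"
    by (rule has_derivative_compose[where f=snd and f'=snd and g=w and g'="fderiv w y"])
      (simp_all add: bounded_linear_imp_has_derivative bounded_linear_snd W.Du y)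
  moreover have "((\<lambda>p. matrix_inv (u (fst p))) has_derivative
      (\<lambda>h. - (matrix_inv (u x) ** fderiv u x (fst h) ** matrix_inv (u x)))) (at (x, y))"
    by (rule has_derivative_compose[where f=fst and f'=fst and g="\<lambda>x. matrix_inv (u x)"
          and g'="\<lambda>h. - (matrix_inv (u x) ** fderiv u x h ** matrix_inv (u x))"])
      (simp_all add: bounded_linear_imp_has_derivative bounded_linear_fst U.DG x)
  ultimately have "((\<lambda>p. w (snd p) ** matrix_inv (u (fst p))) has_derivative
      (\<lambda>h. w y ** (- (matrix_inv (u x) ** fderiv u x (fst h) ** matrix_inv (u x)))
        + fderiv w y (snd h) ** matrix_inv (u x))) (at (x, y))"
    using bounded_bilinear.FDERIV[OF bilin_mm] by fastforce
  then show ?thesis by (simp only: frame_field_def[abs_def] case_prod_beta')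
qed

text \<open>Both halves of the derivative of \<open>w(y) u(x)\<^sup>-\<^sup>1\<close> contribute a bracket: that of the frame \<open>w\<close> at
  \<open>y\<close> and, with the opposite sign, that of the frame \<open>u\<close> at \<open>x\<close>.\<close>

lemma frame_field_curvature:
  assumes x: "x \<in> S" and y: "y \<in> T" and D: "(frame_field u w has_derivative D) (at (x, y))"
  shows "D (h, frame_field u w (x, y) *v h) *v k - D (k, frame_field u w (x, y) *v k) *v h =
    w y *v (struct_fun w y (matrix_inv (u x) *v h) (matrix_inv (u x) *v k)
      - struct_fun u x (matrix_inv (u x) *v h) (matrix_inv (u x) *v k))"
proof -
  let ?G = "matrix_inv (u x)"
  have "D = (\<lambda>(h, \<eta>). w y ** (- (?G ** fderiv u x h ** ?G)) + fderiv w y \<eta> ** ?G)"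
    by (rule has_derivative_unique[OF D frame_field_has_derivative[OF x y]])
  then have "D (h, frame_field u w (x, y) *v h) *v k =
      fderiv w y (w y *v (?G *v h)) *v (?G *v k) - w y *v (?G *v (fderiv u x h *v (?G *v k)))" for h k
    by (simp add: matrix_vector_add_left matrix_vector_minus_left matrix_vector_minus_right
        matrix_vector_mul_assoc[symmetric] frame_field_def)
  moreover have "w y *v (struct_fun w y a b) = fderiv w y (w y *v a) *v b - fderiv w y (w y *v b) *v a" for a b
    by (rule W.u_struct_fun(1)[OF y])
  ultimately show ?thesis
    by (simp add: matrix_vector_diff_right U.u_struct_fun(2)[OF x] x)
qed

lemma frame_map_exists:
  assumes same: "\<And>x y a b. x \<in> S \<Longrightarrow> y \<in> T \<Longrightarrow> struct_fun u x a b = struct_fun w y a b"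
    and x0: "x0 \<in> S" and y0: "y0 \<in> T"
  shows "\<exists>r>0. \<exists>\<phi>. ball x0 r \<subseteq> S \<and> \<phi> x0 = y0 \<and> \<phi> ` ball x0 r \<subseteq> T \<and> smooth_on (ball x0 r) \<phi> \<and>
    (\<forall>x\<in>ball x0 r. frame_map u w \<phi> x)"
proof (rule matrix_frobenius_exists[OF open_ST _ smooth_frame_field])
  show "(x0, y0) \<in> S \<times> T" using x0 y0 by simp
  show "D (h, frame_field u w (x, y) *v h) *v k = D (k, frame_field u w (x, y) *v k) *v h"
    if "(x, y) \<in> S \<times> T" "(frame_field u w has_derivative D) (at (x, y))" for x y D h k
    using frame_field_curvature[OF _ _ that(2), of h k] same that(1) by simp
  fix r \<phi>
  assume r: "r > 0" "\<phi> x0 = y0" "smooth_on (ball x0 r) \<phi>" "\<And>x. x \<in> ball x0 r \<Longrightarrow> (x, \<phi> x) \<in> S \<times> T"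
    "\<And>x. x \<in> ball x0 r \<Longrightarrow> frame_map u w \<phi> x"
  then show ?thesis by (intro exI[of _ r] exI[of _ \<phi>] conjI) auto
qed

lemma frame_map_smooth:
  assumes O: "open O'" "O' \<subseteq> S" "\<phi> ` O' \<subseteq> T"
    and \<phi>: "\<And>x. x \<in> O' \<Longrightarrow> frame_map u w \<phi> x"
  shows "smooth_on O' \<phi>"
  by (rule matrix_total_differential_smooth[OF O(1) smooth_frame_field open_ST _ \<phi>]) (use O in auto)

lemma frame_map_unique:
  assumes O: "open O'" "x0 \<in> O'" "O' \<subseteq> S" and T: "\<phi> x0 \<in> T"
    and \<phi>: "\<And>x. x \<in> O' \<Longrightarrow> frame_map u w \<phi> x"
    and \<psi>: "\<And>x. x \<in> O' \<Longrightarrow> frame_map u w \<psi> x" and eq: "\<phi> x0 = \<psi> x0"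
  shows "\<exists>r>0. \<forall>x\<in>ball x0 r. \<phi> x = \<psi> x"
  by (rule matrix_total_differential_unique[where y=\<phi> and z=\<psi>, OF O(1,2) open_ST _ smooth_frame_field _ _ eq])
    (use O T \<phi> \<psi> in auto)

text \<open>A map that preserves frames preserves their brackets; it is obtained here as the necessary
  integrability condition.\<close>

lemma frame_map_struct_fun:
  assumes O: "open O'" "x0 \<in> O'" "O' \<subseteq> S" and T: "\<phi> x0 \<in> T"
    and \<phi>: "\<And>x. x \<in> O' \<Longrightarrow> frame_map u w \<phi> x"
  shows "struct_fun u x0 a b = struct_fun w (\<phi> x0) a b"
proof -
  have x0: "x0 \<in> S" using O by blast
  obtain D where D: "(frame_field u w has_derivative D) (at (x0, \<phi> x0))"
    using frame_field_has_derivative[OF x0 T] by (rule that)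
  have "w (\<phi> x0) *v (struct_fun w (\<phi> x0) a b - struct_fun u x0 a b) = 0"
    using frame_field_curvature[OF x0 T D, of "u x0 *v a" "u x0 *v b"] x0
      matrix_total_differential_integrability[OF O(1,2) D \<phi>, of "u x0 *v a" "u x0 *v b"] by simp
  then have "struct_fun w (\<phi> x0) a b - struct_fun u x0 a b = 0"
    using W.inv_simps(1)[OF T] by (metis matrix_vector_mult_0_right)
  then show ?thesis by simp
qed

lemma matrix_inv_frame_field:
  assumes "x \<in> S" "y \<in> T"
  shows "invertible (w y ** matrix_inv (u x))" "matrix_inv (w y ** matrix_inv (u x)) = u x ** matrix_inv (w y)"
proof -
  let ?A = "w y ** matrix_inv (u x)" and ?B = "u x ** matrix_inv (w y)"
  have AB: "?A ** ?B = mat 1" "?B ** ?A = mat 1"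
    using assms by (metis (no_types, lifting) U.inv_simps(3,4) W.inv_simps(3,4) matrix_mul_assoc matrix_mul_rid)+
  then show i: "invertible ?A" unfolding invertible_def by blast
  have "matrix_inv ?A = matrix_inv ?A ** (?A ** ?B)" by (simp only: AB matrix_mul_rid)
  also have "\<dots> = (matrix_inv ?A ** ?A) ** ?B" by (rule matrix_mul_assoc)
  also have "\<dots> = ?B" by (simp only: matrix_inv_left[OF i] matrix_mul_lid)
  finally show "matrix_inv ?A = ?B" .
qed

text \<open>By bilinearity it suffices to compare both tensors on the vectors of the frame \<open>w\<close> at \<open>y\<close>,
  which the inverse of the arrow sends to the frame \<open>u\<close> at \<open>x\<close>.\<close>

lemma push_integ_iff:
  assumes x: "x \<in> S" and y: "y \<in> T"
  shows "(\<forall>i j k. push (w y ** matrix_inv (u x)) (integ u x) i j k = integ w y i j k) \<longleftrightarrow>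
    (\<forall>a b. struct_fun u x a b = struct_fun w y a b)"
proof -
  let ?f = "w y ** matrix_inv (u x)" and ?g = "u x ** matrix_inv (w y)"
  let ?P = "\<lambda>h k. ?f *v brk u x (?g *v h) (?g *v k) - brk w y h k"
  have push: "push ?f (integ u x) i j k = (?f *v brk u x (?g *v axis j 1) (?g *v axis k 1)) $ i" for i j k
  proof -
    have g: "?g $ a $ j = (?g *v axis j 1) $ a" for a j
      by (simp only: matrix_vector_mult_basis column_def vec_lambda_beta)
    have 1: "(\<Sum>b\<in>UNIV. integ u x c a b * ?f $ i $ c * ?g $ a $ j * ?g $ b $ k) =
        (?f $ i $ c * ?g $ a $ j) * brk u x (axis a 1) (?g *v axis k 1) $ c" for c a
      unfolding linear_axis_sum[OF U.linear_brk(2)[OF x], of "?g *v axis k 1" "axis a 1" c, symmetric]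
      by (simp add: U.integ_eq[OF x] g[of _ k] sum_distrib_left mult_ac)
    have 2: "(\<Sum>a\<in>UNIV. (?f $ i $ c * ?g $ a $ j) * brk u x (axis a 1) (?g *v axis k 1) $ c) =
        ?f $ i $ c * brk u x (?g *v axis j 1) (?g *v axis k 1) $ c" for c
      unfolding linear_axis_sum[OF U.linear_brk(1)[OF x], of "?g *v axis j 1" "?g *v axis k 1" c, symmetric]
      by (simp add: g[of _ j] sum_distrib_left mult_ac)
    show ?thesis
      unfolding push_def Let_def matrix_inv_frame_field(2)[OF x y] 1 2
      by (simp add: matrix_vector_mult_def[of ?f])
  qed
  have lin: "linear (\<lambda>h. ?P h k)" "linear (\<lambda>k. ?P h k)" for h k
  proof -
    have l: "linear (\<lambda>h. ?f *v q (?g *v h))" if "linear q" for q :: "real^'n \<Rightarrow> real^'n"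
      using linear_compose[OF linear_compose[OF matrix_vector_mul_linear that] matrix_vector_mul_linear]
      by (simp add: o_def)
    show "linear (\<lambda>h. ?P h k)" by (rule linear_compose_sub[OF l[OF U.linear_brk(1)[OF x]] W.linear_brk(1)[OF y]])
    show "linear (\<lambda>k. ?P h k)" by (rule linear_compose_sub[OF l[OF U.linear_brk(2)[OF x]] W.linear_brk(2)[OF y]])
  qed
  have "(\<forall>i j k. push ?f (integ u x) i j k = integ w y i j k) \<longleftrightarrow> (\<forall>j k. ?P (axis j 1) (axis k 1) = 0)"
    by (auto simp: push W.integ_eq[OF y] vec_eq_iff)
  also have "\<dots> \<longleftrightarrow> (\<forall>h k. ?P h k = 0)"
  proof
    assume "\<forall>j k. ?P (axis j 1) (axis k 1) = 0"
    then have "?P (axis j 1) k = 0" for j k using linear_eq_0_axis[OF lin(2)] by blast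
    then show "\<forall>h k. ?P h k = 0" using linear_eq_0_axis[OF lin(1)] by blast
  qed simp
  also have "\<dots> \<longleftrightarrow> (\<forall>a b. ?P (w y *v a) (w y *v b) = 0)"
    using W.inv_simps(2)[OF y] by metis
  also have "\<dots> \<longleftrightarrow> (\<forall>a b. w y *v (struct_fun u x a b) = w y *v (struct_fun w y a b))"
    by (simp add: struct_fun_def matrix_vector_mul_assoc[symmetric] x y)
  also have "\<dots> \<longleftrightarrow> (\<forall>a b. struct_fun u x a b = struct_fun w y a b)"
    using W.inv_simps(1)[OF y] by metis
  finally show ?thesis .
qed

end

section \<open>Manifolds with a structure object\<close>

lemma jacobian_eqI:
  fixes f :: "real^'n \<Rightarrow> real^'m"
  assumes "(f has_derivative (*v) B) (at x)"
  shows "jacobian f (at x) = B"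
  unfolding jacobian_def frechet_derivative_at[OF assms, symmetric]
  by (rule matrix_of_matrix_vector_mul)

lemma has_derivative_jacobian:
  fixes f :: "real^'n \<Rightarrow> real^'m"
  assumes "(f has_derivative f') (at x)"
  shows "(f has_derivative (*v) (jacobian f (at x))) (at x)"
  using differentiableI[OF assms] unfolding jacobian_works .

abbreviation coords :: "('m, 'n::finite) chart \<Rightarrow> (real^'n) set" where
  "coords c \<equiv> cmap c ` cdom c"

locale framed_manifold =
  fixes M :: "'m topology" and A :: "('m, 'n::finite) chart set" and w :: "('m, 'n) geom_object"
  assumes man: "smooth_manifold M A" and str: "structure_object A w"
begin

lemma charts_at_iff [simp]: "c \<in> charts_at A p \<longleftrightarrow> c \<in> A \<and> p \<in> cdom c"
  by (auto simp: charts_at_def)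

lemma chart: "c \<in> A \<Longrightarrow> is_chart M c"
  using man by (auto simp: smooth_manifold_def)

lemma openin_cdom: "c \<in> A \<Longrightarrow> openin M (cdom c)"
  using chart by (auto simp: is_chart_def)

lemma cdom_subset: "c \<in> A \<Longrightarrow> cdom c \<subseteq> topspace M"
  using openin_cdom openin_subset by blast

lemma ex_chart: "p \<in> topspace M \<Longrightarrow> \<exists>c\<in>A. p \<in> cdom c"
  using man by (auto simp: smooth_manifold_def)

lemma ex_charts:
  assumes "p \<in> topspace M" "q \<in> topspace M"
  obtains c d where "c \<in> A" "p \<in> cdom c" "d \<in> A" "q \<in> cdom d"
  using ex_chart[OF assms(1)] ex_chart[OF assms(2)] by blast

lemma inj_cmap: "c \<in> A \<Longrightarrow> inj_on (cmap c) (cdom c)"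
  using homeomorphic_imp_injective_map[of "subtopology M (cdom c)"] chart[of c] cdom_subset[of c]
  by (auto simp: is_chart_def Int_absorb1)

lemma cinv_cmap [simp]: "c \<in> A \<Longrightarrow> p \<in> cdom c \<Longrightarrow> cinv c (cmap c p) = p"
  unfolding cinv_def by (rule inv_into_f_f[OF inj_cmap])

lemma cmap_cinv: "x \<in> coords c \<Longrightarrow> cmap c (cinv c x) = x" "x \<in> coords c \<Longrightarrow> cinv c x \<in> cdom c"
  unfolding cinv_def by (rule f_inv_into_f, assumption) (rule inv_into_into, assumption)

lemma open_chart_image:
  assumes "c \<in> A" "openin M V"
  shows "open (cmap c ` (cdom c \<inter> V))"
proof -
  have h: "homeomorphic_map (subtopology M (cdom c)) (top_of_set (coords c)) (cmap c)"
    and o: "open (coords c)" using chart[OF assms(1)] by (auto simp: is_chart_def)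
  have "openin (subtopology M (cdom c)) (cdom c \<inter> V)"
    using assms(2) by (auto simp: openin_subtopology)
  then have "openin (top_of_set (coords c)) (cmap c ` (cdom c \<inter> V))"
    using homeomorphic_map_openness_eq[OF h] by blast
  then show ?thesis using o openin_open_trans by blast
qed

lemma openin_chart_preimage:
  assumes "c \<in> A" "open X"
  shows "openin M {p \<in> cdom c. cmap c p \<in> X}"
proof -
  have h: "homeomorphic_map (subtopology M (cdom c)) (top_of_set (coords c)) (cmap c)"
    using chart[OF assms(1)] by (auto simp: is_chart_def)
  have "continuous_map (subtopology M (cdom c)) euclidean (cmap c)"
    using homeomorphic_imp_continuous_map[OF h] continuous_map_in_subtopology by blast
  then have "openin (subtopology M (cdom c)) {p \<in> topspace (subtopology M (cdom c)). cmap c p \<in> X}"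
    by (rule openin_continuous_map_preimage) (simp add: assms(2))
  moreover have "{p \<in> topspace (subtopology M (cdom c)). cmap c p \<in> X} = {p \<in> cdom c. cmap c p \<in> X}"
    using cdom_subset[OF assms(1)] by auto
  ultimately have "openin (subtopology M (cdom c)) {p \<in> cdom c. cmap c p \<in> X}" by (simp only:)
  then show ?thesis by (rule openin_trans_full[OF _ openin_cdom[OF assms(1)]])
qed

lemma open_cimage: "c \<in> A \<Longrightarrow> open (coords c)"
  using chart by (auto simp: is_chart_def)

lemma frame_chart: "c \<in> A \<Longrightarrow> frame (w c) (coords c)"
  using str open_cimage by unfold_locales (auto simp: structure_object_def)

lemma frame_pair_charts: "c \<in> A \<Longrightarrow> d \<in> A \<Longrightarrow> frame_pair (w c) (w d) (coords c) (coords d)"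
  by (intro frame_pair.intro frame_chart)

lemma invertible_w: "c \<in> A \<Longrightarrow> p \<in> cdom c \<Longrightarrow> invertible (w c (cmap c p))"
  using frame.invertible_u[OF frame_chart] by blast

lemma trans_map_cmap [simp]: "c \<in> A \<Longrightarrow> p \<in> cdom c \<Longrightarrow> trans_map c d (cmap c p) = cmap d p"
  by (simp add: trans_map_def)

lemma smooth_trans_map: "c \<in> A \<Longrightarrow> d \<in> A \<Longrightarrow> smooth_on (cmap c ` (cdom c \<inter> cdom d)) (trans_map c d)"
  using man by (auto simp: smooth_manifold_def)

lemma right_cancel_w:
  assumes "c \<in> A" "p \<in> cdom c"
  shows "F ** w c (cmap c p) = B \<longleftrightarrow> F = B ** matrix_inv (w c (cmap c p))"
proof -
  note i = matrix_inv_left[OF invertible_w[OF assms]] matrix_inv_right[OF invertible_w[OF assms]]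
  show ?thesis
    by (metis i matrix_mul_assoc matrix_mul_rid)
qed

lemma trans_map_has_derivative:
  assumes "c \<in> A" "d \<in> A" "p \<in> cdom c" "p \<in> cdom d"
  shows "(trans_map c d has_derivative (*v) (frame_field (w c) (w d) (cmap c p, cmap d p))) (at (cmap c p))"
proof -
  have "jacobian (trans_map c d) (at (cmap c p)) ** w c (cmap c p) = w d (cmap d p)"
    using str assms by (auto simp: structure_object_def)
  then have "jacobian (trans_map c d) (at (cmap c p)) = frame_field (w c) (w d) (cmap c p, cmap d p)"
    by (simp add: right_cancel_w assms frame_field_def)
  then show ?thesis
    using has_derivative_jacobian[OF smooth_on_has_derivative[OF smooth_trans_map[OF assms(1,2)]], of "cmap c p"]
      assms(3,4) by simp
qed

text \<open>Coordinate changes preserve the frame, so they preserve its structure functions.\<close>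

lemma struct_fun_chart_independent:
  assumes "c \<in> A" "d \<in> A" "p \<in> cdom c" "p \<in> cdom d"
  shows "struct_fun (w c) (cmap c p) a b = struct_fun (w d) (cmap d p) a b"
proof -
  interpret frame_pair "w c" "w d" "coords c" "coords d"
    by (rule frame_pair_charts[OF assms(1,2)])
  have "struct_fun (w c) (cmap c p) a b = struct_fun (w d) (trans_map c d (cmap c p)) a b"
  proof (rule frame_map_struct_fun)
    show "open (cmap c ` (cdom c \<inter> cdom d))"
      by (rule open_chart_image[OF assms(1) openin_cdom[OF assms(2)]])
    fix x assume "x \<in> cmap c ` (cdom c \<inter> cdom d)"
    then obtain r where "r \<in> cdom c" "r \<in> cdom d" "x = cmap c r" by blast
    then show "(trans_map c d has_derivative (*v) (frame_field (w c) (w d) (x, trans_map c d x))) (at x)"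
      using trans_map_has_derivative[OF assms(1,2)] assms(1) by simp
  qed (use assms in auto)
  then show ?thesis using assms by simp
qed

text \<open>By chart independence any chart at the point gives the same value.\<close>

definition struct_at :: "'m \<Rightarrow> real^'n \<Rightarrow> real^'n \<Rightarrow> real^'n" where
  "struct_at p = (let c = (SOME c. c \<in> A \<and> p \<in> cdom c) in struct_fun (w c) (cmap c p))"

lemma struct_at_eq:
  assumes "c \<in> A" "p \<in> cdom c"
  shows "struct_fun (w c) (cmap c p) = struct_at p"
proof -
  have "(SOME c. c \<in> A \<and> p \<in> cdom c) \<in> A \<and> p \<in> cdom (SOME c. c \<in> A \<and> p \<in> cdom c)"
    by (rule someI[of "\<lambda>c. c \<in> A \<and> p \<in> cdom c" c]) (use assms in simp)
  then show ?thesis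
    unfolding struct_at_def Let_def using struct_fun_chart_independent[OF assms(1) _ assms(2)] by blast
qed

definition struct_const :: bool where
  "struct_const \<longleftrightarrow> (\<forall>p\<in>topspace M. \<forall>q\<in>topspace M. struct_at p = struct_at q)"

lemma struct_const_charts:
  assumes struct_const "c \<in> A" "d \<in> A" "x \<in> coords c" "y \<in> coords d"
  shows "struct_fun (w c) x = struct_fun (w d) y"
proof -
  obtain p q where pq: "p \<in> cdom c" "x = cmap c p" "q \<in> cdom d" "y = cmap d q" using assms(4,5) by blast
  have "struct_at p = struct_at q"
    using assms(1) cdom_subset[OF assms(2)] cdom_subset[OF assms(3)] pq(1,3) unfolding struct_const_def by blast
  then show ?thesis by (simp add: pq(2,4) struct_at_eq[OF assms(2) pq(1)] struct_at_eq[OF assms(3) pq(3)])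
qed

lemma struct_const_imp_flat:
  assumes struct_const "c \<in> A" "x \<in> coords c"
  shows "curv (w c) x k j a = 0"
proof -
  interpret frame "w c" "coords c" by (rule frame_chart[OF assms(2)])
  note x = assms(3)
  have eq: "struct_fun (w c) y a b = struct_fun (w c) x a b" if "y \<in> coords c" for y a b
    by (simp only: struct_const_charts[OF assms(1,2,2) that x])
  have "(\<lambda>h. G x *v curv (w c) x (w c x *v a) (w c x *v b) h) = (\<lambda>h. 0)" for a b
  proof (rule has_derivative_unique[OF struct_fun_has_derivative[OF x]])
    show "((\<lambda>y. struct_fun (w c) y a b) has_derivative (\<lambda>h. 0)) (at x)"
      by (rule has_derivative_transform_within_open[OF has_derivative_const[of "struct_fun (w c) x a b"] open_S x])
        (simp only: eq)
  qed
  then have "G x *v curv (w c) x (w c x *v (G x *v k)) (w c x *v (G x *v j)) a = 0" by (rule fun_cong)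
  then have "w c x *v (G x *v curv (w c) x k j a) = w c x *v 0" by (simp only: inv_simps[OF x])
  then show ?thesis by (simp only: inv_simps[OF x] matrix_vector_mult_0_right)
qed

text \<open>Vanishing curvature makes the structure functions locally constant; the set where they take
  a given value and its complement are open, and \<open>M\<close> is connected.\<close>

lemma flat_imp_struct_const:
  assumes conn: "connected_space M"
    and flat: "\<And>c x k j a. c \<in> A \<Longrightarrow> x \<in> coords c \<Longrightarrow> curv (w c) x k j a = 0"
  shows struct_const
proof -
  have local: "\<exists>V. openin M V \<and> p \<in> V \<and> (\<forall>q\<in>V. struct_at q = struct_at p)" if p: "p \<in> topspace M" for p
  proof -
    obtain c where c: "c \<in> A" "p \<in> cdom c" using ex_chart[OF p] by blast
    interpret frame "w c" "coords c" by (rule frame_chart[OF c(1)])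
    obtain r where r: "r > 0" "ball (cmap c p) r \<subseteq> coords c"
      using open_S c(2) open_contains_ball by blast
    have const: "struct_fun (w c) y a b = struct_fun (w c) (cmap c p) a b" if y: "y \<in> ball (cmap c p) r" for y a b
    proof (rule has_derivative_zero_unique[OF convex_ball _ y])
      fix z assume "z \<in> ball (cmap c p) r"
      then have z: "z \<in> coords c" using r by blast
      show "((\<lambda>y. struct_fun (w c) y a b) has_derivative (\<lambda>h. 0)) (at z within ball (cmap c p) r)"
        using has_derivative_at_withinI[OF struct_fun_has_derivative[OF z]]
        by (simp only: flat[OF c(1) z] matrix_vector_mult_0_right)
    qed (use r in simp)
    show ?thesis
    proof (intro exI conjI ballI)
      show "openin M {q \<in> cdom c. cmap c q \<in> ball (cmap c p) r}"
        by (rule openin_chart_preimage[OF c(1) open_ball])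
      show "p \<in> {q \<in> cdom c. cmap c q \<in> ball (cmap c p) r}" using c r by simp
      fix q assume "q \<in> {q \<in> cdom c. cmap c q \<in> ball (cmap c p) r}"
      then have q: "q \<in> cdom c" "cmap c q \<in> ball (cmap c p) r" by simp_all
      have "struct_fun (w c) (cmap c q) = struct_fun (w c) (cmap c p)" by (intro ext const q)
      then show "struct_at q = struct_at p" by (simp only: struct_at_eq[OF c(1) q(1)] struct_at_eq[OF c])
    qed
  qed
  have "struct_at q = struct_at p" if p: "p \<in> topspace M" and q: "q \<in> topspace M" for p q
  proof (rule ccontr)
    assume ne: "struct_at q \<noteq> struct_at p"
    let ?E = "\<lambda>P. {r \<in> topspace M. P (struct_at r)}"
    have o: "openin M (?E P)" for P
    proof (subst openin_subopen, intro ballI)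
      fix r assume r: "r \<in> ?E P"
      then obtain V where "openin M V" "r \<in> V" "\<forall>q\<in>V. struct_at q = struct_at r" using local by blast
      with r show "\<exists>T. openin M T \<and> r \<in> T \<and> T \<subseteq> ?E P"
        by (intro exI[of _ V]) (use openin_subset in fastforce)
    qed
    let ?E1 = "?E (\<lambda>s. s = struct_at p)" and ?E2 = "?E (\<lambda>s. s \<noteq> struct_at p)"
    have "?E1 \<inter> ?E2 = {}" "topspace M \<subseteq> ?E1 \<union> ?E2" "?E1 \<noteq> {}" "?E2 \<noteq> {}" using p q ne by auto
    then have "\<exists>E1 E2. openin M E1 \<and> openin M E2 \<and> topspace M \<subseteq> E1 \<union> E2 \<and> E1 \<inter> E2 = {} \<and> E1 \<noteq> {} \<and> E2 \<noteq> {}"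
      by (intro exI[of _ ?E1] exI[of _ ?E2] conjI o)
    with conn show False unfolding connected_space_def by (rule notE)
  qed
  then show ?thesis unfolding struct_const_def by blast
qed

definition flat :: bool where
  "flat \<longleftrightarrow> (\<forall>c\<in>A. \<forall>x\<in>coords c. \<forall>k j a. curv (w c) x k j a = 0)"

lemma struct_const_iff_flat:
  assumes "connected_space M"
  shows "struct_const \<longleftrightarrow> flat"
  unfolding flat_def using struct_const_imp_flat flat_imp_struct_const[OF assms] by blast

section \<open>Maps between charts\<close>

lemma openin_continuous_preimage:
  assumes "openin M U" "continuous_map (subtopology M U) M f" "openin M V"
  shows "openin M {p \<in> U. f p \<in> V}"
proof -
  have "openin (subtopology M U) {p \<in> topspace (subtopology M U). f p \<in> V}"
    by (rule openin_continuous_map_preimage[OF assms(2,3)])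
  moreover have "{p \<in> topspace (subtopology M U). f p \<in> V} = {p \<in> U. f p \<in> V}"
    using openin_subset[OF assms(1)] by auto
  ultimately have "openin (subtopology M U) {p \<in> U. f p \<in> V}" by (simp only:)
  then show ?thesis by (rule openin_trans_full[OF _ assms(1)])
qed

text \<open>A map \<open>\<phi>\<close> from an open set \<open>X\<close> of the coordinates of one chart to the coordinates of another
  is transported to \<open>M\<close>.  The map \<open>f\<close> is only required to agree with the transported map on its
  domain, so that the results apply to \<open>inv_into\<close> as well.\<close>

context
  fixes c d :: "('m, 'n) chart" and X :: "(real^'n) set" and \<phi> :: "real^'n \<Rightarrow> real^'n" and f :: "'m \<Rightarrow> 'm"
  assumes c: "c \<in> A" and d: "d \<in> A" and X: "open X" "X \<subseteq> coords c"
    and \<phi>: "smooth_on X \<phi>" "\<phi> ` X \<subseteq> coords d"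
    and f: "\<And>p. p \<in> cdom c \<Longrightarrow> cmap c p \<in> X \<Longrightarrow> f p = cinv d (\<phi> (cmap c p))"
begin

abbreviation (input) "UX \<equiv> {p \<in> cdom c. cmap c p \<in> X}"

lemma chart_map_in: "p \<in> UX \<Longrightarrow> f p \<in> cdom d" "p \<in> UX \<Longrightarrow> cmap d (f p) = \<phi> (cmap c p)"
proof -
  assume p: "p \<in> UX"
  then have "\<phi> (cmap c p) \<in> coords d" "f p = cinv d (\<phi> (cmap c p))" using \<phi>(2) f by auto
  with cmap_cinv show "f p \<in> cdom d" "cmap d (f p) = \<phi> (cmap c p)" by simp_all
qed

lemma openin_chart_map_preimage:
  assumes "openin M V"
  shows "openin M {p \<in> UX. f p \<in> V}"
proof -
  have "open (X \<inter> \<phi> -` (cmap d ` (cdom d \<inter> V)))"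
    using continuous_open_preimage[OF smooth_on_imp_continuous_on[OF \<phi>(1)] X(1) open_chart_image[OF d assms]] .
  from openin_chart_preimage[OF c this]
  have "openin M {p \<in> cdom c. cmap c p \<in> X \<inter> \<phi> -` (cmap d ` (cdom d \<inter> V))}" .
  moreover have "f p \<in> V \<longleftrightarrow> \<phi> (cmap c p) \<in> cmap d ` (cdom d \<inter> V)" if "p \<in> UX" for p
    unfolding chart_map_in(2)[OF that, symmetric]
    using chart_map_in(1)[OF that] inj_onD[OF inj_cmap[OF d], of "f p"] by auto
  then have "{p \<in> UX. f p \<in> V} = {p \<in> cdom c. cmap c p \<in> X \<inter> \<phi> -` (cmap d ` (cdom d \<inter> V))}" by blast
  ultimately show ?thesis by simp
qed

lemma openin_UX: "openin M UX" by (rule openin_chart_preimage[OF c X(1)])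

lemma local_rep_chart_map:
  assumes "c' \<in> A" "p \<in> cdom c'" "p \<in> UX"
  shows "local_rep c' d' f (cmap c' p) = trans_map d d' (\<phi> (trans_map c' c (cmap c' p)))"
  using assms f by (simp add: local_rep_def trans_map_def)

lemma open_local_rep_domain:
  assumes "c' \<in> A" "d' \<in> A"
  shows "open (cmap c' ` {p \<in> cdom c' \<inter> UX. f p \<in> cdom d'})"
proof -
  have "{p \<in> cdom c' \<inter> UX. f p \<in> cdom d'} = cdom c' \<inter> {p \<in> UX. f p \<in> cdom d'}" by blast
  then show ?thesis
    using open_chart_image[OF assms(1) openin_chart_map_preimage[OF openin_cdom[OF assms(2)]]] by simp
qed

lemma smooth_map_chart_map: "smooth_map M A UX f"
  unfolding smooth_map_def
proof (intro conjI ballI)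
  show "continuous_map (subtopology M UX) M f"
    unfolding continuous_map_def
  proof (intro conjI allI impI)
    show "f \<in> topspace (subtopology M UX) \<rightarrow> topspace M"
      using chart_map_in(1) cdom_subset[OF d] by auto
    fix V assume "openin M V"
    from openin_chart_map_preimage[OF this] have "openin M {p \<in> UX. f p \<in> V}" .
    then have "openin (subtopology M UX) (UX \<inter> {p \<in> UX. f p \<in> V})"
      unfolding openin_subtopology by blast
    moreover have "UX \<inter> {p \<in> UX. f p \<in> V} = {p \<in> topspace (subtopology M UX). f p \<in> V}"
      using cdom_subset[OF c] by auto
    ultimately show "openin (subtopology M UX) {p \<in> topspace (subtopology M UX). f p \<in> V}" by simp
  qed
next
  fix c' d' assume cd: "c' \<in> A" "d' \<in> A"
  let ?Z = "cmap c' ` {p \<in> cdom c' \<inter> UX. f p \<in> cdom d'}"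
  have o: "open ?Z" by (rule open_local_rep_domain[OF cd])
  have 1: "smooth_on ?Z (trans_map c' c)"
    by (rule smooth_on_subset[OF smooth_trans_map[OF cd(1) c]]) auto
  have 2: "smooth_on ?Z (\<lambda>x. \<phi> (trans_map c' c x))"
    by (rule smooth_on_compose[OF o 1 \<phi>(1)]) (use cd c in auto)
  have "smooth_on ?Z (\<lambda>x. trans_map d d' (\<phi> (trans_map c' c x)))"
  proof (rule smooth_on_compose[OF o 2 smooth_trans_map[OF d cd(2)]], clarify)
    fix p assume p: "p \<in> cdom c'" "p \<in> cdom c" "cmap c p \<in> X" "f p \<in> cdom d'"
    then have "\<phi> (trans_map c' c (cmap c' p)) = cmap d (f p)" using cd chart_map_in(2)[of p] by simp
    then show "\<phi> (trans_map c' c (cmap c' p)) \<in> cmap d ` (cdom d \<inter> cdom d')"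
      using chart_map_in(1)[of p] p by blast
  qed
  then show "smooth_on ?Z (local_rep c' d' f)"
  proof (rule smooth_on_cong[OF o, rotated], clarify)
    fix p assume "p \<in> cdom c'" "p \<in> cdom c" "cmap c p \<in> X"
    then show "trans_map d d' (\<phi> (trans_map c' c (cmap c' p))) = local_rep c' d' f (cmap c' p)"
      by (intro local_rep_chart_map[OF cd(1), symmetric]) simp_all
  qed
qed

text \<open>The coordinate changes preserve frames, so this property of \<open>\<phi>\<close> passes to the representatives of
  \<open>f\<close> in all other charts.\<close>

lemma local_rep_has_derivative_frame:
  assumes p: "p \<in> UX" and der: "frame_map (w c) (w d) \<phi> (cmap c p)"
    and cd: "c' \<in> A" "p \<in> cdom c'" "d' \<in> A" "f p \<in> cdom d'"
  shows "(local_rep c' d' f has_derivative (*v) (frame_field (w c') (w d') (cmap c' p, cmap d' (f p)))) (at (cmap c' p))"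
proof -
  have pc: "p \<in> cdom c" using p by simp
  note fp = chart_map_in[OF p]
  have t1: "(trans_map c' c has_derivative (*v) (frame_field (w c') (w c) (cmap c' p, cmap c p))) (at (cmap c' p))"
    by (rule trans_map_has_derivative[OF cd(1) c cd(2) pc])
  have t2: "(\<phi> has_derivative (*v) (frame_field (w c) (w d) (cmap c p, \<phi> (cmap c p)))) (at (trans_map c' c (cmap c' p)))"
    using der cd by simp
  have t3: "(trans_map d d' has_derivative (*v) (frame_field (w d) (w d') (cmap d (f p), cmap d' (f p))))
      (at (\<phi> (trans_map c' c (cmap c' p))))"
    using trans_map_has_derivative[OF d cd(3) fp(1) cd(4)] cd fp(2) by simp
  have "((\<lambda>x. trans_map d d' (\<phi> (trans_map c' c x))) has_derivative
      (\<lambda>h. frame_field (w d) (w d') (cmap d (f p), cmap d' (f p)) *v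
        (frame_field (w c) (w d) (cmap c p, \<phi> (cmap c p)) *v (frame_field (w c') (w c) (cmap c' p, cmap c p) *v h)))) (at (cmap c' p))"
    by (rule has_derivative_compose[OF has_derivative_compose[OF t1 t2] t3])
  moreover have "frame_field (w d) (w d') (cmap d (f p), cmap d' (f p)) *v
        (frame_field (w c) (w d) (cmap c p, \<phi> (cmap c p)) *v (frame_field (w c') (w c) (cmap c' p, cmap c p) *v h))
      = frame_field (w c') (w d') (cmap c' p, cmap d' (f p)) *v h" for h
    using frame.inv_simps(1)[OF frame_chart[OF d] imageI[OF fp(1)]]
      frame.inv_simps(1)[OF frame_chart[OF c] imageI[OF pc]]
    by (simp add: frame_field_def fp(2)[symmetric] matrix_vector_mul_assoc[symmetric])
  ultimately have "((\<lambda>x. trans_map d d' (\<phi> (trans_map c' c x))) has_derivative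
      (*v) (frame_field (w c') (w d') (cmap c' p, cmap d' (f p)))) (at (cmap c' p))" by simp
  then show ?thesis
  proof (rule has_derivative_transform_within_open[OF _ open_local_rep_domain[OF cd(1,3)]])
    show "cmap c' p \<in> cmap c' ` {p \<in> cdom c' \<inter> UX. f p \<in> cdom d'}" using p cd(2,4) by blast
    fix x assume "x \<in> cmap c' ` {p \<in> cdom c' \<inter> UX. f p \<in> cdom d'}"
    then obtain r where r: "r \<in> cdom c'" "r \<in> UX" "x = cmap c' r" by blast
    show "trans_map d d' (\<phi> (trans_map c' c x)) = local_rep c' d' f x"
      unfolding r(3) by (rule local_rep_chart_map[OF cd(1) r(1,2), symmetric])
  qed
qed

lemma local_diffeo_chart_map:
  assumes Y: "open Y" "\<phi> ` X = Y" and \<psi>: "smooth_on Y \<psi>" "\<And>x. x \<in> X \<Longrightarrow> \<psi> (\<phi> x) = x"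
  shows "local_diffeo M A UX f"
proof -
  have inj: "inj_on f UX"
  proof (rule inj_onI)
    fix p q assume pq: "p \<in> UX" "q \<in> UX" "f p = f q"
    have "\<phi> (cmap c p) = \<phi> (cmap c q)" using chart_map_in(2)[OF pq(1)] chart_map_in(2)[OF pq(2)] pq(3) by simp
    then have "\<psi> (\<phi> (cmap c p)) = \<psi> (\<phi> (cmap c q))" by simp
    then have "cmap c p = cmap c q" using \<psi>(2) pq by simp
    then show "p = q" using pq inj_onD[OF inj_cmap[OF c]] by simp
  qed
  have img: "f ` UX = {q \<in> cdom d. cmap d q \<in> Y}"
  proof (intro equalityI subsetI)
    fix q assume "q \<in> f ` UX"
    then obtain p where "p \<in> UX" "q = f p" by blast
    then show "q \<in> {q \<in> cdom d. cmap d q \<in> Y}"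
      using chart_map_in[of p] Y(2) imageI[of "cmap c p" X \<phi>] by simp
  next
    fix q assume q: "q \<in> {q \<in> cdom d. cmap d q \<in> Y}"
    then obtain x where x: "x \<in> X" "cmap d q = \<phi> x" using Y(2) by auto
    then have "x \<in> coords c" using X(2) by blast
    from cmap_cinv[OF this] x(1) have "cinv c x \<in> UX" "cmap c (cinv c x) = x" by simp_all
    moreover from this have "f (cinv c x) = q" using f[of "cinv c x"] x(2)[symmetric] q d by simp
    ultimately show "q \<in> f ` UX" by blast
  qed
  have inv: "inv_into UX f q = cinv c (\<psi> (cmap d q))" if "q \<in> cdom d" "cmap d q \<in> Y" for q
  proof -
    have "q \<in> f ` UX" using that unfolding img by blast
    then obtain p where p: "p \<in> UX" "q = f p" by blast
    have "inv_into UX f q = p" unfolding p(2) by (rule inv_into_f_f[OF inj p(1)])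
    moreover have "cinv c (\<psi> (cmap d q)) = p"
      using p chart_map_in(2)[OF p(1)] \<psi>(2)[of "cmap c p"] c by simp
    ultimately show ?thesis by simp
  qed
  have "smooth_map M A {q \<in> cdom d. cmap d q \<in> Y} (inv_into UX f)"
  proof (rule framed_manifold.smooth_map_chart_map[OF framed_manifold_axioms d c Y(1) _ \<psi>(1)])
    show "Y \<subseteq> coords d" using \<phi>(2) Y(2) by simp
    show "\<psi> ` Y \<subseteq> coords c"
    proof
      fix x assume "x \<in> \<psi> ` Y"
      then have "x \<in> X" using Y(2) \<psi>(2) by auto
      then show "x \<in> coords c" using X(2) by blast
    qed
  qed (rule inv)
  moreover have "openin M {q \<in> cdom d. cmap d q \<in> Y}" by (rule openin_chart_preimage[OF d Y(1)])
  ultimately show ?thesis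
    unfolding local_diffeo_def img by (intro conjI openin_UX inj smooth_map_chart_map)
qed

end

text \<open>In charts the equation \<open>F w = w\<close> determines the matrix of an arrow, and outside the charts at
  its end points it is \<open>0\<close> by convention; so there is at most one arrow.\<close>

lemma groupoid_arrow_memD:
  assumes "(p, q, F) \<in> N1_groupoid M A w"
  shows "p \<in> topspace M" "q \<in> topspace M"
    "F = (\<lambda>c d. if c \<in> charts_at A p \<and> d \<in> charts_at A q then w d (cmap d q) ** matrix_inv (w c (cmap c p)) else 0)" (is "F = ?F")
proof -
  have U1: "(p, q, F) \<in> U1 M A"
    and eq: "\<forall>c\<in>charts_at A p. \<forall>d\<in>charts_at A q. F c d ** w c (cmap c p) = w d (cmap d q)"
    using assms unfolding N1_groupoid_def by simp_all
  obtain f U where fU: "q = f p" "F = jet A f p" "p \<in> U" "local_diffeo M A U f"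
    using U1 unfolding U1_def by blast
  show "p \<in> topspace M" using fU openin_subset unfolding local_diffeo_def by blast
  show "q \<in> topspace M" using fU openin_subset[of M "f ` U"] unfolding local_diffeo_def by blast
  show "F = ?F"
  proof (intro ext)
    fix c d
    show "F c d = ?F c d"
    proof (cases "c \<in> charts_at A p \<and> d \<in> charts_at A q")
      case True
      then have "F c d ** w c (cmap c p) = w d (cmap d q)" using eq by blast
      then show ?thesis using True by (simp add: right_cancel_w)
    next
      case False
      then show ?thesis unfolding fU(1) fU(2) jet_def by (simp only: if_False)
    qed
  qed
qed

text \<open>The matrix \<open>w(q) w(p)\<^sup>-\<^sup>1\<close> is the jet of a map that is affine in a chart at \<open>p\<close> and a chart at
  \<open>q\<close>.\<close>

lemma groupoid_arrow_exists:
  assumes p: "p \<in> topspace M" and q: "q \<in> topspace M"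
  shows "\<exists>F. (p, q, F) \<in> N1_groupoid M A w"
proof -
  obtain c where c: "c \<in> A" "p \<in> cdom c" using ex_chart[OF p] by blast
  obtain d where d: "d \<in> A" "q \<in> cdom d" using ex_chart[OF q] by blast
  let ?x = "cmap c p" and ?y = "cmap d q"
  interpret frame_pair "w c" "w d" "coords c" "coords d" by (rule frame_pair_charts[OF c(1) d(1)])
  define B where "B = frame_field (w c) (w d) (?x, ?y)"
  have iB: "invertible B" unfolding B_def frame_field_def using matrix_inv_frame_field(1)[of ?x ?y] c d by simp
  define \<phi> where "\<phi> x = ?y + B *v (x - ?x)" for x
  define \<psi> where "\<psi> y = ?x + matrix_inv B *v (y - ?y)" for y
  have inv: "\<psi> (\<phi> x) = x" "\<phi> (\<psi> y) = y" for x y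
    by (simp_all add: \<phi>_def \<psi>_def matrix_vector_mul_assoc matrix_inv_left[OF iB] matrix_inv_right[OF iB])
  have sm: "smooth_on Z (\<lambda>x. s + C *v (x - t))" if "open Z" for Z s t and C :: "real^'n^'n"
    using smooth_on_add[OF that smooth_on_const[OF that] smooth_on_matrix_vector_mult[OF that smooth_on_const[OF that]
          smooth_on_add[OF that smooth_on_id[OF that] smooth_on_const[OF that, of "- t"]]], of s C] by simp
  have cont: "continuous_on UNIV \<phi>" "continuous_on UNIV \<psi>"
    unfolding \<phi>_def \<psi>_def by (rule smooth_on_imp_continuous_on[OF sm[OF open_UNIV]])+
  define X where "X = cmap c ` cdom c \<inter> \<phi> -` (coords d)"
  define Y where "Y = cmap d ` cdom d \<inter> \<psi> -` (coords c)"
  have X: "open X" unfolding X_def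
    by (intro open_Int open_cimage c(1) open_vimage[OF open_cimage[OF d(1)] cont(1)])
  have Y: "open Y" unfolding Y_def
    by (intro open_Int open_cimage d(1) open_vimage[OF open_cimage[OF c(1)] cont(2)])
  have XY: "\<phi> ` X = Y"
  proof (intro equalityI subsetI)
    fix y assume "y \<in> \<phi> ` X"
    then obtain x where "x \<in> X" "y = \<phi> x" by blast
    then show "y \<in> Y" unfolding X_def Y_def by (simp add: inv)
  next
    fix y assume y: "y \<in> Y"
    then have "\<psi> y \<in> X" unfolding X_def Y_def by (simp add: inv)
    from imageI[OF this, of \<phi>] show "y \<in> \<phi> ` X" by (simp only: inv(2))
  qed
  have sm\<phi>: "smooth_on X \<phi>" "smooth_on Y \<psi>" unfolding \<phi>_def \<psi>_def by (rule sm[OF X], rule sm[OF Y])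
  have subs: "X \<subseteq> coords c" "\<phi> ` X \<subseteq> coords d" unfolding X_def by auto
  define f where "f r = cinv d (\<phi> (cmap c r))" for r
  have f: "f r = cinv d (\<phi> (cmap c r))" if "r \<in> cdom c" "cmap c r \<in> X" for r by (simp add: f_def)
  let ?U = "{r \<in> cdom c. cmap c r \<in> X}"
  have xX: "?x \<in> X" using c d by (simp add: X_def \<phi>_def)
  have pU: "p \<in> ?U" using xX c by simp
  have fp: "f p = q" using d by (simp add: f_def \<phi>_def)
  have diffeo: "local_diffeo M A ?U f"
    by (rule local_diffeo_chart_map[OF c(1) d(1) X subs(1) sm\<phi>(1) subs(2) f Y XY sm\<phi>(2) inv(1)])
  have "((\<lambda>x. ?y + B *v (x - ?x)) has_derivative (\<lambda>h. B *v h)) (at ?x)"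
    using has_derivative_add[OF has_derivative_const bounded_linear.has_derivative[OF
          bounded_bilinear.bounded_linear_right[OF bilin_mv, of B]
          has_derivative_diff[OF has_derivative_ident has_derivative_const]]] by simp
  then have der: "(\<phi> has_derivative (*v) (frame_field (w c) (w d) (?x, \<phi> ?x))) (at ?x)"
    by (simp add: \<phi>_def[abs_def] B_def)
  have "(p, f p, jet A f p) \<in> U1 M A"
    unfolding U1_def mem_Collect_eq
    by (intro exI[of _ p] exI[of _ f] conjI exI[of _ ?U] refl pU diffeo)
  moreover have "jet A f p c' d' ** w c' (cmap c' p) = w d' (cmap d' (f p))"
    if "c' \<in> charts_at A p" "d' \<in> charts_at A (f p)" for c' d'
  proof -
    have "(local_rep c' d' f has_derivative (*v) (frame_field (w c') (w d') (cmap c' p, cmap d' (f p)))) (at (cmap c' p))"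
      by (rule local_rep_has_derivative_frame[OF c(1) d(1) X subs(1) sm\<phi>(1) subs(2) f pU der]) (use that in auto)
    from jacobian_eqI[OF this] show ?thesis
      using that by (simp add: jet_def right_cancel_w frame_field_def)
  qed
  ultimately have "(p, f p, jet A f p) \<in> N1_groupoid M A w"
    unfolding N1_groupoid_def mem_Collect_eq prod.case by blast
  then show ?thesis unfolding fp by blast
qed

lemma N1_arrow_eq:
  assumes "p \<in> cdom c" "c \<in> A" "q \<in> cdom d" "d \<in> A"
  shows "N1_arrow M A w p q c d = w d (cmap d q) ** matrix_inv (w c (cmap c p))"
proof -
  obtain F where F: "(p, q, F) \<in> N1_groupoid M A w"
    using groupoid_arrow_exists cdom_subset assms by blast
  have "N1_arrow M A w p q = F"
    unfolding N1_arrow_def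
  proof (rule the_equality[where P="\<lambda>F. (p, q, F) \<in> N1_groupoid M A w", OF F])
    fix F' assume F': "(p, q, F') \<in> N1_groupoid M A w"
    show "F' = F" by (rule trans[OF groupoid_arrow_memD(3)[OF F'] groupoid_arrow_memD(3)[OF F, symmetric]])
  qed
  then show ?thesis using groupoid_arrow_memD(3)[OF F] assms by simp
qed

lemma push_arrow_iff:
  assumes "p \<in> cdom c" "c \<in> A" "q \<in> cdom d" "d \<in> A"
  shows "(\<forall>i j k. push (w d (cmap d q) ** matrix_inv (w c (cmap c p))) (integ (w c) (cmap c p)) i j k
      = integ (w d) (cmap d q) i j k) \<longleftrightarrow> struct_at p = struct_at q"
proof -
  interpret frame_pair "w c" "w d" "coords c" "coords d" by (rule frame_pair_charts[OF assms(2,4)])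
  show ?thesis
    using push_integ_iff[of "cmap c p" "cmap d q"] assms by (simp add: struct_at_eq fun_eq_iff)
qed

lemma nonlin_curv_zero_iff: "nonlin_curv_zero M A w \<longleftrightarrow> struct_const"
proof -
  have "(\<forall>c\<in>charts_at A p. \<forall>d\<in>charts_at A q. \<forall>i j k. nonlin_curv M A w p q c d i j k = 0) \<longleftrightarrow> struct_at p = struct_at q" (is "?L \<longleftrightarrow> _")
    if pq: "p \<in> topspace M" "q \<in> topspace M" for p q
  proof -
    obtain c d where cd: "c \<in> A" "p \<in> cdom c" "d \<in> A" "q \<in> cdom d" using pq by (rule ex_charts)
    have eq: "(\<forall>i j k. nonlin_curv M A w p q c d i j k = 0) \<longleftrightarrow> struct_at p = struct_at q"
      if "c \<in> charts_at A p" "d \<in> charts_at A q" for c d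
    proof -
      have cd: "p \<in> cdom c" "c \<in> A" "q \<in> cdom d" "d \<in> A" using that by simp_all
      have "nonlin_curv M A w p q c d i j k = 0 \<longleftrightarrow>
          push (w d (cmap d q) ** matrix_inv (w c (cmap c p))) (integ (w c) (cmap c p)) i j k
            = integ (w d) (cmap d q) i j k" for i j k
        unfolding nonlin_curv_def N1_arrow_eq[OF cd] right_minus_eq by (rule eq_commute)
      then show ?thesis by (simp only: push_arrow_iff[OF cd])
    qed
    have c: "c \<in> charts_at A p" and d: "d \<in> charts_at A q" using cd by simp_all
    show ?thesis
    proof
      assume ?L
      from bspec[OF bspec[OF this c] d] show "struct_at p = struct_at q" by (rule iffD1[OF eq[OF c d]])
    next
      assume "struct_at p = struct_at q"
      then show ?L
        by (intro ballI iffD2[OF eq])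
    qed
  qed
  then show ?thesis unfolding nonlin_curv_zero_def struct_const_def by simp
qed

lemma N1_leaves_integ_invariant_iff: "N1_leaves_integ_invariant M A w \<longleftrightarrow> struct_const"
proof
  assume inv: "N1_leaves_integ_invariant M A w"
  show struct_const
    unfolding struct_const_def
  proof (intro ballI)
    fix p q assume pq: "p \<in> topspace M" "q \<in> topspace M"
    obtain F where F: "(p, q, F) \<in> N1_groupoid M A w" using groupoid_arrow_exists[OF pq] by blast
    obtain c d where cd: "c \<in> A" "p \<in> cdom c" "d \<in> A" "q \<in> cdom d" using pq by (rule ex_charts)
    have c: "c \<in> charts_at A p" and d: "d \<in> charts_at A q" using cd by simp_all
    have "\<forall>i j k. push (F c d) (integ (w c) (cmap c p)) i j k = integ (w d) (cmap d q) i j k"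
      by (rule bspec[OF bspec[OF bspec[OF inv[unfolded N1_leaves_integ_invariant_def] F, unfolded prod.case] c] d])
    moreover have "F c d = w d (cmap d q) ** matrix_inv (w c (cmap c p))"
      using groupoid_arrow_memD(3)[OF F] cd by simp
    ultimately show "struct_at p = struct_at q" using push_arrow_iff[of p c q d] cd by simp
  qed
next
  assume struct_const
  show "N1_leaves_integ_invariant M A w"
    unfolding N1_leaves_integ_invariant_def
  proof (clarify)
    fix p q F c d i j k
    assume F: "(p, q, F) \<in> N1_groupoid M A w" and cd: "c \<in> charts_at A p" "d \<in> charts_at A q"
    note a = groupoid_arrow_memD[OF F]
    have "F c d = w d (cmap d q) ** matrix_inv (w c (cmap c p))" using a(3) cd by simp
    moreover have "struct_at p = struct_at q" using \<open>struct_const\<close> a(1,2) unfolding struct_const_def by blast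
    ultimately show "push (F c d) (integ (w c) (cmap c p)) i j k = integ (w d) (cmap d q) i j k"
      using push_arrow_iff[of p c q d] cd by simp
  qed
qed

lemma lin_curv_zero_iff_flat:
  "lin_curv_zero A w \<longleftrightarrow> flat"
  unfolding lin_curv_zero_def flat_def
proof (intro ball_cong refl)
  fix c x assume "c \<in> A" "x \<in> coords c"
  then show "(\<forall>i k j a. lin_curv (w c) x i k j a = 0) \<longleftrightarrow> (\<forall>k j a. curv (w c) x k j a = 0)"
    using frame.lin_curv_zero_iff[OF frame_chart] by blast
qed

text \<open>This supplies a tangent vector at \<open>p\<close> with prescribed components in one chart: its components
  in the other charts come from the same coefficients in the frame.\<close>

lemma frame_vector_tangent:
  assumes "p \<in> topspace M"
  shows "(p, \<lambda>c. if c \<in> charts_at A p then w c (cmap c p) *v e else 0) \<in> tangent_bundle M A"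
  unfolding tangent_bundle_def
  using assms str by (auto simp: structure_object_def matrix_vector_mul_assoc)

lemma lie_eps_integ_zero_iff_flat:
  "lie_eps_integ_zero M A w \<longleftrightarrow> flat"
proof -
  have lie: "formal_lie (integ (w c)) (cmap c p) (snd (eps A w (p, \<tau>)) c) i k j
      = curv (w c) (cmap c p) (axis k 1) (axis j 1) (\<tau> c) $ i"
    if "c \<in> A" "p \<in> cdom c" for c p \<tau> i k j
    using frame.formal_lie_eq[OF frame_chart[OF that(1)], of "cmap c p" "\<tau> c" i k j] that by (simp add: eps_def)
  show ?thesis
  proof
    assume zero: "lie_eps_integ_zero M A w"
    show flat
      unfolding flat_def
    proof (intro ballI)
      fix c x assume c: "c \<in> A" and "x \<in> coords c"
      then obtain p where p: "p \<in> cdom c" "x = cmap c p" by blast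
      interpret frame "w c" "coords c" by (rule frame_chart[OF c])
      have x: "x \<in> coords c" using p by simp
      have "curv (w c) x (axis k 1) (axis j 1) a $ i = 0" for i k j a
      proof -
        let ?\<tau> = "\<lambda>c. if c \<in> charts_at A p then w c (cmap c p) *v (G x *v a) else 0"
        have "(p, ?\<tau>) \<in> tangent_bundle M A" using frame_vector_tangent cdom_subset[OF c] p by blast
        from bspec[OF zero[unfolded lie_eps_integ_zero_def] this, unfolded prod.case]
        have "\<forall>c\<in>charts_at A p. \<forall>i k j. formal_lie (integ (w c)) (cmap c p) (snd (eps A w (p, ?\<tau>)) c) i k j = 0" .
        moreover have "c \<in> charts_at A p" using c p(1) by simp
        ultimately have "formal_lie (integ (w c)) (cmap c p) (snd (eps A w (p, ?\<tau>)) c) i k j = 0" by blast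
        then show ?thesis unfolding lie[OF c p(1)] using c p x by simp
      qed
      then have "\<forall>i k j a. lin_curv (w c) x i k j a = 0" by (simp add: lin_curv_eq[OF x])
      then show "\<forall>k j a. curv (w c) x k j a = 0" unfolding lin_curv_zero_iff[OF x] .
    qed
  next
    assume flat
    show "lie_eps_integ_zero M A w"
      unfolding lie_eps_integ_zero_def
    proof clarify
      fix p \<tau> c i k j assume "c \<in> charts_at A p"
      then show "formal_lie (integ (w c)) (cmap c p) (snd (eps A w (p, \<tau>)) c) i k j = 0"
        using lie[of c p \<tau> i k j] \<open>flat\<close> by (simp add: flat_def)
    qed
  qed
qed

section \<open>Integrability of the groupoid\<close>

lemma groupoid_solutionD:
  assumes "groupoid_solution M A w (p, q, F) U f"
  shows "p \<in> U" "local_diffeo M A U f" "f p = q" "openin M U" "openin M (f ` U)" "smooth_map M A U f"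
    "\<And>r c d. r \<in> U \<Longrightarrow> c \<in> charts_at A r \<Longrightarrow> d \<in> charts_at A (f r) \<Longrightarrow>
      jacobian (local_rep c d f) (at (cmap c r)) ** w c (cmap c r) = w d (cmap d (f r))"
  using assms unfolding groupoid_solution_def local_diffeo_def by simp_all

lemma groupoid_solution_local_rep:
  assumes sol: "groupoid_solution M A w (p, q, F) U f" and cd: "c \<in> A" "d \<in> A"
  shows "openin M {r \<in> U. f r \<in> cdom d}" "open (cmap c ` {r \<in> cdom c \<inter> U. f r \<in> cdom d})"
    "\<And>r. r \<in> cdom c \<Longrightarrow> r \<in> U \<Longrightarrow> f r \<in> cdom d \<Longrightarrow> frame_map (w c) (w d) (local_rep c d f) (cmap c r)"
proof -
  note U = groupoid_solutionD(4,6)[OF sol]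
  show o: "openin M {r \<in> U. f r \<in> cdom d}"
    by (rule openin_continuous_preimage[OF U(1) conjunct1[OF U(2)[unfolded smooth_map_def]] openin_cdom[OF cd(2)]])
  have eq: "{r \<in> cdom c \<inter> U. f r \<in> cdom d} = cdom c \<inter> {r \<in> U. f r \<in> cdom d}"
    by (simp only: Collect_conj_eq Int_assoc Collect_mem_eq set_eq_iff Int_iff mem_Collect_eq conj_assoc simp_thms)
  show "open (cmap c ` {r \<in> cdom c \<inter> U. f r \<in> cdom d})"
    unfolding eq by (rule open_chart_image[OF cd(1) o])
  fix r assume r: "r \<in> cdom c" "r \<in> U" "f r \<in> cdom d"
  have sm: "smooth_on (cmap c ` {r \<in> cdom c \<inter> U. f r \<in> cdom d}) (local_rep c d f)"
    by (rule bspec[OF bspec[OF conjunct2[OF U(2)[unfolded smooth_map_def]] cd(1)] cd(2)])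
  have "(local_rep c d f has_derivative (*v) (jacobian (local_rep c d f) (at (cmap c r)))) (at (cmap c r))"
    by (rule has_derivative_jacobian[OF smooth_on_has_derivative[OF sm]]) (use r in auto)
  moreover have "jacobian (local_rep c d f) (at (cmap c r)) = frame_field (w c) (w d) (cmap c r, local_rep c d f (cmap c r))"
    using groupoid_solutionD(7)[OF sol r(2), of c d] r cd by (simp add: right_cancel_w frame_field_def local_rep_def)
  ultimately show "frame_map (w c) (w d) (local_rep c d f) (cmap c r)" by simp
qed

text \<open>A solution through the arrow from \<open>p\<close> to \<open>q\<close> is a map that preserves frames.\<close>

lemma groupoid_integrable_imp_struct_const:
  assumes "groupoid_uniquely_locally_integrable M A w"
  shows struct_const
  unfolding struct_const_def
proof (intro ballI)
  fix p q assume pq: "p \<in> topspace M" "q \<in> topspace M"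
  obtain F where F: "(p, q, F) \<in> N1_groupoid M A w" using groupoid_arrow_exists[OF pq] by blast
  from bspec[OF assms[unfolded groupoid_uniquely_locally_integrable_def] this]
  obtain U f where sol: "groupoid_solution M A w (p, q, F) U f" unfolding prod.case by blast
  note pU = groupoid_solutionD(1,3)[OF sol]
  obtain c d where cd: "c \<in> A" "p \<in> cdom c" "d \<in> A" "q \<in> cdom d" using pq by (rule ex_charts)
  note rep = groupoid_solution_local_rep[OF sol cd(1,3)]
  interpret frame_pair "w c" "w d" "coords c" "coords d" by (rule frame_pair_charts[OF cd(1,3)])
  have fp: "local_rep c d f (cmap c p) = cmap d q" using cd pU by (simp add: local_rep_def)
  have "struct_fun (w c) (cmap c p) a b = struct_fun (w d) (local_rep c d f (cmap c p)) a b" for a b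
  proof (rule frame_map_struct_fun[OF rep(2)])
    fix x assume "x \<in> cmap c ` {r \<in> cdom c \<inter> U. f r \<in> cdom d}"
    then obtain r where r: "r \<in> cdom c" "r \<in> U" "f r \<in> cdom d" "x = cmap c r" by blast
    show "frame_map (w c) (w d) (local_rep c d f) x"
      unfolding r(4) by (rule rep(3)[OF r(1-3)])
  qed (use cd pU fp in auto)
  then show "struct_at p = struct_at q" unfolding fp using struct_at_eq[OF cd(1,2)] struct_at_eq[OF cd(3,4)] by (auto simp: fun_eq_iff)
qed

text \<open>The Frobenius theorem gives the map in coordinates; its local inverse exists by the inverse
  function theorem and is smooth because it satisfies the same equation with the frames
  exchanged.\<close>

lemma groupoid_solution_exists:
  assumes const: struct_const and F: "(p, q, F) \<in> N1_groupoid M A w"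
  shows "\<exists>U f. groupoid_solution M A w (p, q, F) U f"
proof -
  note pq = groupoid_arrow_memD[OF F]
  obtain c d where cd: "c \<in> A" "p \<in> cdom c" "d \<in> A" "q \<in> cdom d" using pq(1,2) by (rule ex_charts)
  let ?x = "cmap c p" and ?y = "cmap d q"
  interpret frame_pair "w c" "w d" "coords c" "coords d" by (rule frame_pair_charts[OF cd(1,3)])
  interpret R: frame_pair "w d" "w c" "coords d" "coords c" by (rule frame_pair_charts[OF cd(3,1)])
  have same: "struct_fun (w c) x a b = struct_fun (w d) y a b" if "x \<in> coords c" "y \<in> coords d" for x y a b
    by (simp only: struct_const_charts[OF const cd(1,3) that])
  obtain r \<phi> where r: "r > 0" and \<phi>: "ball ?x r \<subseteq> coords c" "\<phi> ?x = ?y" "\<phi> ` ball ?x r \<subseteq> coords d"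
      "smooth_on (ball ?x r) \<phi>"
    and der: "\<And>x. x \<in> ball ?x r \<Longrightarrow> frame_map (w c) (w d) \<phi> x"
    using frame_map_exists[OF same, of ?x ?y] cd by blast
  let ?f' = "\<lambda>x. mat_blinfun (frame_field (w c) (w d) (x, \<phi> x))"
  have cont: "continuous_on (ball ?x r) ?f'"
  proof -
    have "continuous_on (ball ?x r) (\<lambda>x. frame_field (w c) (w d) (x, \<phi> x))"
      by (rule continuous_on_compose2[OF smooth_on_imp_continuous_on[OF smooth_frame_field]
            continuous_on_Pair[OF continuous_on_id smooth_on_imp_continuous_on[OF \<phi>(4)]]])
        (use \<phi>(1,3) in auto)
    then show ?thesis by (rule bounded_linear.continuous_on[OF bounded_linear_mat_blinfun])
  qed
  have xb: "?x \<in> ball ?x r" using r by simp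
  have inv: "mat_blinfun (frame_field (w d) (w c) (?y, ?x)) o\<^sub>L ?f' ?x = id_blinfun"
    using cd U.inv_simps(2) W.inv_simps(1)
    by (intro blinfun_eqI) (simp add: apply_mat_blinfun frame_field_def \<phi>(2) matrix_vector_mul_assoc[symmetric])
  obtain X Y \<psi> \<psi>' where XY: "open X" "X \<subseteq> ball ?x r" "?x \<in> X" "open Y" "\<phi> ?x \<in> Y" "homeomorphism X Y \<phi> \<psi>"
      "\<And>y. y \<in> Y \<Longrightarrow> (\<psi> has_derivative (\<psi>' y)) (at y)"
      "\<And>y. y \<in> Y \<Longrightarrow> \<psi>' y = Hilbert_Choice.inv (blinfun_apply (?f' (\<psi> y)))"
    by (rule inverse_function_theorem[of "ball ?x r" \<phi> ?f' ?x, OF open_ball _ cont xb inv])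
      (use der in \<open>auto simp: apply_mat_blinfun\<close>)
  note hom = XY(6)[unfolded homeomorphism_def]
  have img: "\<phi> ` X = Y" "\<psi> ` Y = X" and inv1: "\<And>x. x \<in> X \<Longrightarrow> \<psi> (\<phi> x) = x" and inv2: "\<And>y. y \<in> Y \<Longrightarrow> \<phi> (\<psi> y) = y"
    using hom by auto
  have subs: "X \<subseteq> coords c" "\<phi> ` X \<subseteq> coords d" using XY(2) \<phi>(1,3) by blast+
  have sm\<phi>: "smooth_on X \<phi>" by (rule smooth_on_subset[OF \<phi>(4) XY(2)])
  have sm\<psi>: "smooth_on Y \<psi>"
  proof (rule R.frame_map_smooth[OF XY(4)])
    show "Y \<subseteq> coords d" "\<psi> ` Y \<subseteq> coords c" using subs img by auto
    fix y assume y: "y \<in> Y"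
    then have m: "\<psi> y \<in> coords c" "y \<in> coords d" using subs img by auto
    have "Hilbert_Choice.inv ((*v) (frame_field (w c) (w d) (\<psi> y, y))) = (*v) (frame_field (w d) (w c) (y, \<psi> y))"
    proof (rule inv_equality)
      fix v
      show "frame_field (w d) (w c) (y, \<psi> y) *v (frame_field (w c) (w d) (\<psi> y, y) *v v) = v"
        "frame_field (w c) (w d) (\<psi> y, y) *v (frame_field (w d) (w c) (y, \<psi> y) *v v) = v"
        using U.inv_simps[OF m(1)] W.inv_simps[OF m(2)]
        by (simp_all add: frame_field_def matrix_vector_mul_assoc[symmetric])
    qed
    then show "frame_map (w d) (w c) \<psi> y"
      using XY(7)[OF y] XY(8)[OF y] inv2[OF y] by (simp add: apply_mat_blinfun)
  qed
  define f where "f r = cinv d (\<phi> (cmap c r))" for r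
  have f: "f r = cinv d (\<phi> (cmap c r))" if "r \<in> cdom c" "cmap c r \<in> X" for r by (simp add: f_def)
  let ?U = "{r \<in> cdom c. cmap c r \<in> X}"
  have pU: "p \<in> ?U" using XY(3) cd by simp
  have fp: "f p = q" using cd \<phi>(2) by (simp add: f_def)
  have diffeo: "local_diffeo M A ?U f"
    by (rule local_diffeo_chart_map[OF cd(1,3) XY(1) subs(1) sm\<phi> subs(2) f XY(4) img(1) sm\<psi> inv1])
  have eq: "jacobian (local_rep c' d' f) (at (cmap c' s)) = w d' (cmap d' (f s)) ** matrix_inv (w c' (cmap c' s))"
    if s: "s \<in> ?U" "c' \<in> charts_at A s" "d' \<in> charts_at A (f s)" for s c' d'
  proof -
    have "(local_rep c' d' f has_derivative (*v) (frame_field (w c') (w d') (cmap c' s, cmap d' (f s)))) (at (cmap c' s))"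
    proof (rule local_rep_has_derivative_frame[OF cd(1,3) XY(1) subs(1) sm\<phi> subs(2) f s(1)])
      show "frame_map (w c) (w d) \<phi> (cmap c s)"
        using der XY(2) s(1) by blast
    qed (use s in auto)
    from jacobian_eqI[OF this] show ?thesis by (simp add: frame_field_def)
  qed
  have "jet A f p = F"
    unfolding pq(3) jet_def using eq[OF pU] by (intro ext) (auto simp: fp)
  moreover have "jacobian (local_rep c' d' f) (at (cmap c' s)) ** w c' (cmap c' s) = w d' (cmap d' (f s))"
    if "s \<in> ?U" "c' \<in> charts_at A s" "d' \<in> charts_at A (f s)" for s c' d'
    using eq[OF that] that by (simp add: right_cancel_w)
  ultimately show ?thesis
    unfolding groupoid_solution_def using pU diffeo fp by (intro exI[of _ ?U] exI[of _ f]) simp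
qed

lemma groupoid_solution_unique:
  assumes f: "groupoid_solution M A w (p, q, F) U f" and g: "groupoid_solution M A w (p, q, F) V g"
  shows "\<exists>W. openin M W \<and> p \<in> W \<and> W \<subseteq> U \<inter> V \<and> (\<forall>r\<in>W. f r = g r)"
proof -
  note U = groupoid_solutionD(1,3,4,5)[OF f] and V = groupoid_solutionD(1,3)[OF g]
  have "p \<in> topspace M" by (rule subsetD[OF openin_subset[OF U(3)] U(1)])
  moreover have "q \<in> topspace M"
    using subsetD[OF openin_subset[OF U(4)] imageI[OF U(1)]] by (simp only: U(2))
  ultimately
  obtain c d where cd: "c \<in> A" "p \<in> cdom c" "d \<in> A" "q \<in> cdom d" by (rule ex_charts)
  interpret frame_pair "w c" "w d" "coords c" "coords d" by (rule frame_pair_charts[OF cd(1,3)])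
  note rf = groupoid_solution_local_rep[OF f cd(1,3)] and rg = groupoid_solution_local_rep[OF g cd(1,3)]
  let ?N = "{r \<in> U. f r \<in> cdom d} \<inter> {r \<in> V. g r \<in> cdom d}"
  have N: "openin M ?N" by (rule openin_Int[OF rf(1) rg(1)])
  let ?O = "cmap c ` (cdom c \<inter> ?N)"
  have rep: "local_rep c d f (cmap c r) = cmap d (f r)" "local_rep c d g (cmap c r) = cmap d (g r)" if "r \<in> cdom c" for r
    using that cd by (simp_all add: local_rep_def)
  have "\<exists>e>0. \<forall>x\<in>ball (cmap c p) e. local_rep c d f x = local_rep c d g x"
  proof (rule frame_map_unique[where O'="?O"])
    show "open ?O" by (rule open_chart_image[OF cd(1) N])
    show "local_rep c d f (cmap c p) \<in> coords d" "local_rep c d f (cmap c p) = local_rep c d g (cmap c p)"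
      using rep[OF cd(2)] U V cd by simp_all
    fix x assume "x \<in> ?O"
    then obtain r where r: "r \<in> cdom c" "r \<in> U" "f r \<in> cdom d" "r \<in> V" "g r \<in> cdom d" "x = cmap c r" by blast
    show "frame_map (w c) (w d) (local_rep c d f) x"
      unfolding r(6) by (rule rf(3)[OF r(1-3)])
    show "frame_map (w c) (w d) (local_rep c d g) x"
      unfolding r(6) by (rule rg(3)[OF r(1,4,5)])
  next
    show "cmap c p \<in> ?O" using U V cd by (intro imageI) simp
    show "?O \<subseteq> coords c" by blast
  qed
  then obtain e where e: "e > 0" "\<And>x. x \<in> ball (cmap c p) e \<Longrightarrow> local_rep c d f x = local_rep c d g x" by blast
  show ?thesis
  proof (intro exI conjI ballI)
    show "openin M ({r \<in> cdom c. cmap c r \<in> ball (cmap c p) e} \<inter> ?N)"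
      by (intro openin_Int[OF openin_chart_preimage[OF cd(1) open_ball]] N)
    show "p \<in> {r \<in> cdom c. cmap c r \<in> ball (cmap c p) e} \<inter> ?N" using U V cd e(1) by simp
    show "{r \<in> cdom c. cmap c r \<in> ball (cmap c p) e} \<inter> ?N \<subseteq> U \<inter> V" by blast
    fix r assume r: "r \<in> {r \<in> cdom c. cmap c r \<in> ball (cmap c p) e} \<inter> ?N"
    then have "cmap d (f r) = cmap d (g r)" using e(2)[of "cmap c r"] rep[of r] by simp
    then show "f r = g r" using r inj_onD[OF inj_cmap[OF cd(3)]] by simp
  qed
qed

lemma groupoid_integrable_iff: "groupoid_uniquely_locally_integrable M A w \<longleftrightarrow> struct_const"
proof
  assume c: struct_const
  show "groupoid_uniquely_locally_integrable M A w"
    unfolding groupoid_uniquely_locally_integrable_def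
  proof clarify
    fix p q F assume "(p, q, F) \<in> N1_groupoid M A w"
    from groupoid_solution_exists[OF c this] obtain U f where s: "groupoid_solution M A w (p, q, F) U f" by blast
    show "\<exists>U f. groupoid_solution M A w (p, q, F) U f \<and> (\<forall>V g. groupoid_solution M A w (p, q, F) V g \<longrightarrow>
        (\<exists>W. openin M W \<and> p \<in> W \<and> W \<subseteq> U \<inter> V \<and> (\<forall>r\<in>W. f r = g r)))"
      by (rule exI[of _ U], rule exI[of _ f]) (intro conjI allI impI s groupoid_solution_unique[OF s])
  qed
qed (rule groupoid_integrable_imp_struct_const)

section \<open>Integrability of the linearization\<close>

text \<open>The vector field with frame components \<open>a\<close>, where \<open>a\<close> is given in the coordinates of \<open>c\<close>.\<close>

definition frame_section :: "('m, 'n) chart \<Rightarrow> (real^'n \<Rightarrow> real^'n) \<Rightarrow> ('m, 'n) chart \<Rightarrow> real^'n \<Rightarrow> real^'n" where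
  "frame_section c a d x = w d x *v a (trans_map d c x)"

lemma frame_section_vector_field:
  assumes c: "c \<in> A" and X: "open X" "X \<subseteq> coords c" and a: "smooth_on X a"
  shows "vector_field_on M A {p \<in> cdom c. cmap c p \<in> X} (frame_section c a)"
  unfolding vector_field_on_def
proof (intro conjI ballI)
  let ?U = "{p \<in> cdom c. cmap c p \<in> X}"
  show U: "openin M ?U" by (rule openin_chart_preimage[OF c X(1)])
  fix d assume d: "d \<in> A"
  let ?Z = "cmap d ` (cdom d \<inter> ?U)"
  have o: "open ?Z" by (rule open_chart_image[OF d U])
  have 1: "smooth_on ?Z (trans_map d c)"
    by (rule smooth_on_subset[OF smooth_trans_map[OF d c]]) auto
  have 2: "smooth_on ?Z (\<lambda>x. a (trans_map d c x))"
    by (rule smooth_on_compose[OF o 1 a]) (use d in auto)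
  have 3: "smooth_on ?Z (w d)" by (rule smooth_on_subset[OF frame.smooth_u[OF frame_chart[OF d]]]) auto
  show "smooth_on ?Z (frame_section c a d)"
    unfolding frame_section_def[abs_def] by (rule smooth_on_matrix_vector_mult[OF o 3 2])
next
  fix d e p assume d: "d \<in> A" "e \<in> A" and p: "p \<in> cdom d \<inter> cdom e \<inter> {p \<in> cdom c. cmap c p \<in> X}"
  then have "jacobian (trans_map d e) (at (cmap d p)) ** w d (cmap d p) = w e (cmap e p)"
    using str by (auto simp: structure_object_def)
  then show "jacobian (trans_map d e) (at (cmap d p)) *v frame_section c a d (cmap d p) = frame_section c a e (cmap e p)"
    using p d by (simp add: frame_section_def matrix_vector_mul_assoc)
qed

text \<open>The equation for the frame components is the same in all charts, because the structure
  functions are and the coordinate changes preserve the frame.\<close>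

lemma frame_section_N1_equation:
  assumes c: "c \<in> A" "p \<in> cdom c" and d: "d \<in> A" "p \<in> cdom d"
    and a: "(a has_derivative a') (at (cmap c p))"
    and eq: "\<And>h. a' h = struct_fun (w c) (cmap c p) (a (cmap c p)) (matrix_inv (w c (cmap c p)) *v h)"
  shows "pd j (\<lambda>x. frame_section c a d x $ i) (cmap d p)
    = (\<Sum>k\<in>UNIV. Gam (w d) (cmap d p) i k j * frame_section c a d (cmap d p) $ k)"
proof -
  interpret frame "w d" "coords d" by (rule frame_chart[OF d(1)])
  let ?x = "cmap c p" and ?y = "cmap d p"
  have y: "?y \<in> coords d" and x: "?x \<in> coords c" using c d by simp_all
  let ?T = "frame_field (w d) (w c) (?y, ?x)"
  have "(a has_derivative a') (at (trans_map d c ?y))" using a d by simp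
  from has_derivative_compose[OF trans_map_has_derivative[OF d(1) c(1) d(2) c(2)] this]
  have comp: "((\<lambda>x. a (trans_map d c x)) has_derivative (\<lambda>h. a' (?T *v h))) (at ?y)" .
  have "a' (?T *v h) = struct_fun (w d) ?y (a ?x) (G ?y *v h)" for h
    unfolding eq using frame.inv_simps(1)[OF frame_chart[OF c(1)] x]
    by (simp add: frame_field_def matrix_vector_mul_assoc[symmetric] struct_at_eq[OF c] struct_at_eq[OF d])
  then have "\<forall>h. w d ?y *v a' (?T *v h) + Du ?y h *v a ?x = conn (w d) ?y (w d ?y *v a ?x) h"
    using frame_component_equation_iff[OF y, of "\<lambda>h. a' (?T *v h)" "a ?x"] by blast
  moreover have "(frame_section c a d has_derivative (\<lambda>h. w d ?y *v a' (?T *v h) + Du ?y h *v a ?x)) (at ?y)"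
    using frame_combination_has_derivative[OF y comp] d by (simp add: frame_section_def[abs_def])
  moreover have "frame_section c a d ?y = w d ?y *v a ?x" using d by (simp add: frame_section_def)
  ultimately show ?thesis
    using N1_equation_iff[OF y, of "frame_section c a d" "\<lambda>h. w d ?y *v a' (?T *v h) + Du ?y h *v a ?x"] by simp
qed

lemma vector_field_has_derivative:
  assumes "vector_field_on M A U v" "c \<in> A" "p \<in> cdom c" "p \<in> U"
  shows "(v c has_derivative frechet_derivative (v c) (at (cmap c p))) (at (cmap c p))"
  by (rule smooth_on_has_derivative[of "cmap c ` (cdom c \<inter> U)"]) (use assms in \<open>auto simp: vector_field_on_def\<close>)

lemma jacobian_component:
  assumes "c \<in> A" "x \<in> coords c" "(v has_derivative v') (at x)"
  shows "jacobian v (at x) $ i $ j = pd j (\<lambda>x. v x $ i) x"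
  using frame.pd_component[OF frame_chart[OF assms(1)] assms(2) refl assms(3), of j i]
  unfolding jacobian_def frechet_derivative_at[OF assms(3), symmetric] by (simp add: matrix_def)

lemma vjet_in_N1_bundle:
  assumes v: "vector_field_on M A U v" "p \<in> U"
    and eq: "\<And>c i j. c \<in> A \<Longrightarrow> p \<in> cdom c \<Longrightarrow>
      pd j (\<lambda>x. v c x $ i) (cmap c p) = (\<Sum>k\<in>UNIV. Gam (w c) (cmap c p) i k j * v c (cmap c p) $ k)"
  shows "(p, vjet A v p) \<in> N1_bundle M A w"
proof -
  have "(p, vjet A v p) \<in> J1T M A"
    unfolding J1T_def mem_Collect_eq by (intro exI[of _ p] exI[of _ v] conjI exI[of _ U] refl v)
  moreover have "snd (vjet A v p c) $ i $ j = (\<Sum>k\<in>UNIV. Gam (w c) (cmap c p) i k j * fst (vjet A v p c) $ k)"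
    if c: "c \<in> charts_at A p" for c i j
  proof -
    have cA: "c \<in> A" "p \<in> cdom c" using c by simp_all
    show ?thesis
      using jacobian_component[OF cA(1) imageI[OF cA(2)] vector_field_has_derivative[OF v(1) cA v(2)], of i j]
      by (simp add: vjet_def cA eq[OF cA])
  qed
  ultimately show ?thesis unfolding N1_bundle_def mem_Collect_eq prod.case by blast
qed

lemma N1_bundle_topspace:
  assumes "(p, \<eta>) \<in> N1_bundle M A w"
  shows "p \<in> topspace M"
proof -
  have "(p, \<eta>) \<in> J1T M A" using assms unfolding N1_bundle_def by simp
  then obtain v U where "p \<in> U" "vector_field_on M A U v" unfolding J1T_def by blast
  then show ?thesis using openin_subset[of M U] unfolding vector_field_on_def by blast
qed

lemma N1_bundle_transform:
  assumes "(p, \<eta>) \<in> N1_bundle M A w" "c \<in> A" "p \<in> cdom c" "d \<in> A" "p \<in> cdom d"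
  shows "fst (\<eta> d) = jacobian (trans_map c d) (at (cmap c p)) *v fst (\<eta> c)"
proof -
  have "(p, \<eta>) \<in> J1T M A" using assms unfolding N1_bundle_def by simp
  then obtain v U where v: "p \<in> U" "vector_field_on M A U v" "\<eta> = vjet A v p" unfolding J1T_def by blast
  then show ?thesis using assms(2-5) by (auto simp: vjet_def vector_field_on_def)
qed

text \<open>The components of the vector in one chart determine its components in all charts, and these
  determine the first-order part.\<close>

lemma N1_bundle_eqI:
  assumes "(p, \<eta>) \<in> N1_bundle M A w" "(p, \<eta>') \<in> N1_bundle M A w" and c: "c \<in> A" "p \<in> cdom c"
    and eq: "fst (\<eta> c) = fst (\<eta>' c)"
  shows "\<eta> = \<eta>'"
proof
  fix d show "\<eta> d = \<eta>' d"
  proof (cases "d \<in> charts_at A p")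
    case True
    have f: "fst (\<eta> d) = fst (\<eta>' d)"
      using N1_bundle_transform[OF assms(1) c] N1_bundle_transform[OF assms(2) c] True eq by simp
    moreover have "snd (\<eta> d) = snd (\<eta>' d)"
      using assms(1,2) True f by (simp add: N1_bundle_def vec_eq_iff)
    ultimately show ?thesis by (rule prod_eqI)
  next
    case False
    have zero: "\<eta> d = 0" if "(p, \<eta>) \<in> N1_bundle M A w" for \<eta>
      using that False unfolding N1_bundle_def J1T_def vjet_def by auto
    show ?thesis by (simp only: zero[OF assms(1)] zero[OF assms(2)])
  qed
qed

text \<open>Frame components that are affine in the coordinates of \<open>c\<close> satisfy the equation at the single
  point \<open>p\<close>.\<close>

lemma N1_bundle_exists:
  assumes c: "c \<in> A" "p \<in> cdom c"
  shows "\<exists>\<eta>. (p, \<eta>) \<in> N1_bundle M A w \<and> fst (\<eta> c) = \<xi>"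
proof -
  interpret frame "w c" "coords c" by (rule frame_chart[OF c(1)])
  let ?x = "cmap c p"
  have x: "?x \<in> coords c" using c by simp
  define a0 where "a0 = G ?x *v \<xi>"
  define L where "L h = struct_fun (w c) ?x a0 (G ?x *v h)" for h
  have "linear L"
    unfolding L_def[abs_def] struct_fun_def
    using linear_compose[OF linear_compose[OF linear_compose[OF matrix_vector_mul_linear matrix_vector_mul_linear]
          linear_brk(2)[OF x]] matrix_vector_mul_linear] by (simp add: o_def)
  then have bl: "bounded_linear L" by (simp add: linear_conv_bounded_linear)
  define a where "a x = a0 + L (x + (- ?x))" for x
  have sm: "smooth_on (coords c) a"
    unfolding a_def[abs_def]
    by (intro smooth_on_add open_S smooth_on_const smooth_on_linear[OF bl open_S] smooth_on_id)
  have ax: "a ?x = a0" using linear_0[OF \<open>linear L\<close>] by (simp add: a_def)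
  have "((\<lambda>x. x + (- ?x)) has_derivative (\<lambda>h. h)) (at ?x)" by (auto intro!: derivative_eq_intros)
  from has_derivative_add[OF has_derivative_const bounded_linear.has_derivative[OF bl this]]
  have der: "(a has_derivative L) (at ?x)" unfolding a_def[abs_def] by simp
  let ?v = "frame_section c a"
  have "(p, vjet A ?v p) \<in> N1_bundle M A w"
  proof (rule vjet_in_N1_bundle)
    show "vector_field_on M A {p \<in> cdom c. cmap c p \<in> coords c} ?v"
      by (rule frame_section_vector_field[OF c(1) open_S order_refl sm])
    show "p \<in> {p \<in> cdom c. cmap c p \<in> coords c}" using c by simp
    fix d i j assume d: "d \<in> A" "p \<in> cdom d"
    show "pd j (\<lambda>x. ?v d x $ i) (cmap d p) = (\<Sum>k\<in>UNIV. Gam (w d) (cmap d p) i k j * ?v d (cmap d p) $ k)"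
      by (rule frame_section_N1_equation[OF c d der]) (simp only: ax L_def)
  qed
  moreover have "fst (vjet A ?v p c) = \<xi>"
    using c inv_simps(2)[OF x] by (simp add: vjet_def frame_section_def ax a0_def)
  ultimately show ?thesis by blast
qed

lemma bundle_solution_parallel:
  assumes sol: "bundle_solution M A w (p, \<eta>) U v" and c: "c \<in> A" and r: "r \<in> cdom c" "r \<in> U"
  shows "(v c has_derivative conn (w c) (cmap c r) (v c (cmap c r))) (at (cmap c r))"
proof -
  interpret frame "w c" "coords c" by (rule frame_chart[OF c])
  have x: "cmap c r \<in> coords c" using r by simp
  have vf: "vector_field_on M A U v" and
    eq: "\<forall>i j. pd j (\<lambda>x. v c x $ i) (cmap c r) = (\<Sum>a\<in>UNIV. Gam (w c) (cmap c r) i a j * v c (cmap c r) $ a)"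
    using sol c r unfolding bundle_solution_def by auto
  note D = vector_field_has_derivative[OF vf c r]
  have "frechet_derivative (v c) (at (cmap c r)) = conn (w c) (cmap c r) (v c (cmap c r))"
    using N1_equation_iff[OF x D] eq by (simp add: fun_eq_iff)
  with D show ?thesis by simp
qed

lemma bundle_solution_value:
  assumes "bundle_solution M A w (p, \<eta>) U v" "c \<in> A" "p \<in> cdom c"
  shows "v c (cmap c p) = fst (\<eta> c)"
  using assms unfolding bundle_solution_def by (auto simp: vjet_def)

text \<open>There are solutions with every prescribed value at \<open>p\<close>, and each satisfies the necessary
  integrability condition.\<close>

lemma bundle_integrable_imp_flat:
  assumes int: "bundle_uniquely_locally_integrable M A w" and c: "c \<in> A" "x \<in> coords c"
  shows "curv (w c) x k j \<xi> = 0"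
proof -
  obtain p where p: "p \<in> cdom c" "x = cmap c p" using c by blast
  obtain \<eta> where \<eta>: "(p, \<eta>) \<in> N1_bundle M A w" "fst (\<eta> c) = \<xi>" using N1_bundle_exists[OF c(1) p(1)] by blast
  from bspec[OF int[unfolded bundle_uniquely_locally_integrable_def] \<eta>(1)]
  obtain U v where sol: "bundle_solution M A w (p, \<eta>) U v" unfolding prod.case by blast
  then have U: "p \<in> U" "openin M U" unfolding bundle_solution_def vector_field_on_def by auto
  have "curv (w c) x k j (v c x) = 0"
  proof (rule frame.parallel_curv_zero[OF frame_chart[OF c(1)]])
    show "open (cmap c ` (cdom c \<inter> U))" by (rule open_chart_image[OF c(1) U(2)])
    show "x \<in> cmap c ` (cdom c \<inter> U)" "cmap c ` (cdom c \<inter> U) \<subseteq> coords c" using p U by auto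
    fix y assume "y \<in> cmap c ` (cdom c \<inter> U)"
    then obtain r where r: "r \<in> cdom c" "r \<in> U" "y = cmap c r" by blast
    show "(v c has_derivative conn (w c) y (v c y)) (at y)"
      unfolding r(3) by (rule bundle_solution_parallel[OF sol c(1) r(1,2)])
  qed
  then show ?thesis using bundle_solution_value[OF sol c(1) p(1)] p(2) \<eta>(2) by simp
qed

text \<open>Solve the equation in one chart, pass to frame components and spread them to all charts.\<close>

lemma bundle_solution_exists:
  assumes flat: "\<And>c x k j a. c \<in> A \<Longrightarrow> x \<in> coords c \<Longrightarrow> curv (w c) x k j a = 0"
    and \<eta>: "(p, \<eta>) \<in> N1_bundle M A w"
  shows "\<exists>U v. bundle_solution M A w (p, \<eta>) U v"
proof -
  obtain c where c: "c \<in> A" "p \<in> cdom c" using ex_chart[OF N1_bundle_topspace[OF \<eta>]] by blast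
  interpret frame "w c" "coords c" by (rule frame_chart[OF c(1)])
  let ?x = "cmap c p"
  have x: "?x \<in> coords c" using c by simp
  obtain r \<xi> where r: "r > 0" "ball ?x r \<subseteq> coords c" "\<xi> ?x = fst (\<eta> c)" "smooth_on (ball ?x r) \<xi>"
    and par: "\<And>y. y \<in> ball ?x r \<Longrightarrow> (\<xi> has_derivative conn (w c) y (\<xi> y)) (at y)"
    using parallel_exists[OF flat[OF c(1)] x, of "fst (\<eta> c)"] by blast
  define a where "a y = G y *v \<xi> y" for y
  have sm: "smooth_on (ball ?x r) a"
    unfolding a_def[abs_def] by (intro smooth_on_matrix_vector_mult open_ball smooth_on_subset[OF smooth_G r(2)] r(4))
  have \<xi>: "w c y *v a y = \<xi> y" if "y \<in> ball ?x r" for y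
    using inv_simps(2) r(2) that unfolding a_def by blast
  have der: "(a has_derivative fderiv a y) (at y)"
    and eq: "fderiv a y h = struct_fun (w c) y (a y) (G y *v h)" if y: "y \<in> ball ?x r" for y h
  proof -
    have yS: "y \<in> coords c" using y r(2) by blast
    show d: "(a has_derivative fderiv a y) (at y)" by (rule smooth_on_has_derivative[OF sm y])
    let ?D = "\<lambda>h. w c y *v fderiv a y h + Du y h *v a y"
    have "(\<xi> has_derivative ?D) (at y)"
      by (rule has_derivative_transform_within_open[OF frame_combination_has_derivative[OF yS d] open_ball y \<xi>])
    then have "?D = conn (w c) y (\<xi> y)" by (rule has_derivative_unique[OF _ par[OF y]])
    then have "\<forall>h. ?D h = conn (w c) y (w c y *v a y) h" unfolding \<xi>[OF y] by metis
    then show "fderiv a y h = struct_fun (w c) y (a y) (G y *v h)"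
      unfolding frame_component_equation_iff[OF yS] by blast
  qed
  let ?v = "frame_section c a" and ?U = "{q \<in> cdom c. cmap c q \<in> ball ?x r}"
  have vf: "vector_field_on M A ?U ?v" by (rule frame_section_vector_field[OF c(1) open_ball r(2) sm])
  have pU: "p \<in> ?U" using c r by simp
  have N1: "pd j (\<lambda>x. ?v d x $ i) (cmap d q) = (\<Sum>k\<in>UNIV. Gam (w d) (cmap d q) i k j * ?v d (cmap d q) $ k)"
    if "q \<in> ?U" "d \<in> A" "q \<in> cdom d" for q d i j
  proof -
    have q: "q \<in> cdom c" "cmap c q \<in> ball ?x r" using that by simp_all
    show ?thesis by (rule frame_section_N1_equation[OF c(1) q(1) that(2,3) der[OF q(2)] eq[OF q(2)]])
  qed
  have "vjet A ?v p = \<eta>"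
  proof (rule N1_bundle_eqI[OF vjet_in_N1_bundle[OF vf pU N1[OF pU]] \<eta> c])
    show "fst (vjet A ?v p c) = fst (\<eta> c)"
      using c \<xi>[of ?x] r(1,3) by (simp add: vjet_def frame_section_def)
  qed
  moreover have "pd j (\<lambda>x. ?v d x $ i) y = (\<Sum>k\<in>UNIV. Gam (w d) y i k j * ?v d y $ k)"
    if d: "d \<in> A" and y: "y \<in> cmap d ` (cdom d \<inter> ?U)" for d y i j
  proof -
    obtain q where q: "q \<in> cdom d" "q \<in> ?U" "y = cmap d q" using y by blast
    show ?thesis unfolding q(3) by (rule N1[OF q(2) d q(1)])
  qed
  ultimately have "bundle_solution M A w (p, \<eta>) ?U ?v"
    unfolding bundle_solution_def using vf pU by simp
  then show ?thesis by (intro exI)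
qed

lemma bundle_solution_unique:
  assumes \<eta>: "(p, \<eta>) \<in> N1_bundle M A w"
    and v: "bundle_solution M A w (p, \<eta>) U v" and v': "bundle_solution M A w (p, \<eta>) V v'"
  shows "\<exists>W. openin M W \<and> p \<in> W \<and> W \<subseteq> U \<inter> V \<and> (\<forall>d\<in>A. \<forall>x\<in>cmap d ` (cdom d \<inter> W). v d x = v' d x)"
proof -
  have U: "p \<in> U" "openin M U" "vector_field_on M A U v" and V: "p \<in> V" "openin M V" "vector_field_on M A V v'"
    using v v' unfolding bundle_solution_def vector_field_on_def by auto
  obtain c where c: "c \<in> A" "p \<in> cdom c" using ex_chart[OF N1_bundle_topspace[OF \<eta>]] by blast
  let ?O = "cmap c ` (cdom c \<inter> (U \<inter> V))"
  have UV: "openin M (U \<inter> V)" by (rule openin_Int[OF U(2) V(2)])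
  have "\<exists>e>0. \<forall>x\<in>ball (cmap c p) e. v c x = v' c x"
  proof (rule frame.parallel_unique[OF frame_chart[OF c(1)]])
    show "open ?O" by (rule open_chart_image[OF c(1) UV])
    show "cmap c p \<in> ?O" "?O \<subseteq> coords c" using c U V by auto
    show "v c (cmap c p) = v' c (cmap c p)"
      using bundle_solution_value[OF v c] bundle_solution_value[OF v' c] by simp
    fix y assume "y \<in> ?O"
    then obtain r where r: "r \<in> cdom c" "r \<in> U" "r \<in> V" "y = cmap c r" by blast
    show "(v c has_derivative conn (w c) y (v c y)) (at y)"
      unfolding r(4) by (rule bundle_solution_parallel[OF v c(1) r(1,2)])
    show "(v' c has_derivative conn (w c) y (v' c y)) (at y)"
      unfolding r(4) by (rule bundle_solution_parallel[OF v' c(1) r(1,3)])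
  qed
  then obtain e where e: "e > 0" "\<And>x. x \<in> ball (cmap c p) e \<Longrightarrow> v c x = v' c x" by blast
  let ?W = "{r \<in> cdom c. cmap c r \<in> ball (cmap c p) e} \<inter> (U \<inter> V)"
  have "v d x = v' d x" if d: "d \<in> A" and x: "x \<in> cmap d ` (cdom d \<inter> ?W)" for d x
  proof -
    obtain r where r: "r \<in> cdom d" "r \<in> ?W" "x = cmap d r" using x by blast
    have "v d (cmap d r) = jacobian (trans_map c d) (at (cmap c r)) *v v c (cmap c r)"
      "v' d (cmap d r) = jacobian (trans_map c d) (at (cmap c r)) *v v' c (cmap c r)"
      using U(3) V(3) c(1) d r(1,2) unfolding vector_field_on_def by auto
    then show ?thesis unfolding r(3) using e(2) r(2) by simp
  qed
  moreover have "openin M ?W" by (intro openin_Int[OF openin_chart_preimage[OF c(1) open_ball]] UV)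
  moreover have "p \<in> ?W" using c U V e by simp
  ultimately show ?thesis by (intro exI[of _ ?W]) blast
qed

lemma bundle_integrable_iff_flat:
  "bundle_uniquely_locally_integrable M A w \<longleftrightarrow> flat"
proof
  assume int: "bundle_uniquely_locally_integrable M A w"
  show flat
    unfolding flat_def by (intro ballI allI bundle_integrable_imp_flat[OF int])
next
  assume flat
  then have flat: "curv (w c) x k j a = 0" if "c \<in> A" "x \<in> coords c" for c x k j a
    using that unfolding flat_def by blast
  show "bundle_uniquely_locally_integrable M A w"
    unfolding bundle_uniquely_locally_integrable_def
  proof clarify
    fix p \<eta> assume \<eta>: "(p, \<eta>) \<in> N1_bundle M A w"
    from bundle_solution_exists[OF flat this] obtain U v where s: "bundle_solution M A w (p, \<eta>) U v" by blast
    show "\<exists>U v. bundle_solution M A w (p, \<eta>) U v \<and> (\<forall>V v'. bundle_solution M A w (p, \<eta>) V v' \<longrightarrow>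
        (\<exists>W. openin M W \<and> p \<in> W \<and> W \<subseteq> U \<inter> V \<and> (\<forall>c\<in>A. \<forall>x\<in>cmap c ` (cdom c \<inter> W). v c x = v' c x)))"
      by (rule exI[of _ U], rule exI[of _ v]) (intro conjI allI impI s bundle_solution_unique[OF \<eta> s])
  qed
qed

end

theorem proposition13:
  fixes M :: "'m topology"
    and A :: "('m, 'n::finite) chart set"
    and w :: "('m, 'n) geom_object"
  assumes "smooth_manifold M A"
    and "connected_space M"
    and "structure_object A w"
  shows "(nonlin_curv_zero M A w \<longleftrightarrow> groupoid_uniquely_locally_integrable M A w) \<and>
         (groupoid_uniquely_locally_integrable M A w \<longleftrightarrow> N1_leaves_integ_invariant M A w) \<and>
         (N1_leaves_integ_invariant M A w \<longleftrightarrow> lin_curv_zero A w) \<and>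
         (lin_curv_zero A w \<longleftrightarrow> bundle_uniquely_locally_integrable M A w) \<and>
         (bundle_uniquely_locally_integrable M A w \<longleftrightarrow> lie_eps_integ_zero M A w)"
proof -
  interpret framed_manifold M A w by unfold_locales (rule assms)+
  show ?thesis
    by (simp add: nonlin_curv_zero_iff groupoid_integrable_iff N1_leaves_integ_invariant_iff
        lin_curv_zero_iff_flat bundle_integrable_iff_flat lie_eps_integ_zero_iff_flat
        struct_const_iff_flat[OF assms(2)])
qed

end
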